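(* Let $\Omega\subseteq\mathbb{R}^n$ be open and let $P(t,x,D_x)$ be a first-order partial differential operator with real principal symbol $P_1$ and coefficients in $\mathcal{C}^\infty(\mathbb{R}\times\Omega)$ which are constant outside some compact subset of $\Omega$. Assume that $u\in\mathcal{G}(\Omega\times\mathbb{R})$ satisfies the homogeneous Cauchy problem $$\partial_t u+iP(t,x,D_x)u=0,\qquad u(\cdot,0)=g\in\mathcal{G}(\Omega).$$ If $\Phi_t$ denotes the Hamilton flow corresponding to $P_1(t,\cdot,\cdot)$ on $T^*(\Omega)$, then for all $t\in\mathbb{R}$ $$\mathrm{WF}_{\mathrm g}(u(\cdot,t))=\Phi_t\big(\mathrm{WF}_{\mathrm g}(g)\big).$$
   Context: Notation: $D_x=-i\partial_x$; $T^*(\Omega)=\Omega\times\mathbb{R}^n$, $T^*(\Omega)\setminus0=\Omega\times(\mathbb{R}^n\setminus\{0\})$; $\langle\xi\rangle=(1+|\xi|^2)^{1/2}$; $\hat v(\xi)=\int e^{-ix\xi}v(x)\,dx$. Colombeau algebras (for any open $\Omega$; nets are indexed by $\varepsilon\in(0,1]$): $\mathcal{E}_M(\Omega)$ is the set of nets $(u_\varepsilon)_\varepsilon$ in $\mathcal{C}^\infty(\Omega)$ such that for all compact $K\subset\Omega$ and all multi-indices $\alpha$ there is $p\in\mathbb{R}$ with $\|\partial^\alpha u_\varepsilon\|_{L^\infty(K)}=O(\varepsilon^{-p})$ as $\varepsilon\to0$. $\mathcal{N}(\Omega)$ is the set of $(u_\varepsilon)_\varepsilon\in\mathcal{E}_M(\Omega)$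 such that for all compact $K\subset\Omega$ and all $q$, $\|u_\varepsilon\|_{L^\infty(K)}=O(\varepsilon^q)$. $\mathcal{G}(\Omega)=\mathcal{E}_M(\Omega)/\mathcal{N}(\Omega)$. Differential operators with smooth coefficients and restrictions $u(\cdot,t)=[(u_\varepsilon(\cdot,t))_\varepsilon]\in\mathcal{G}(\Omega)$ of $u\in\mathcal{G}(\Omega\times\mathbb{R})$ to fixed $t$ are defined on representatives; equations hold in the Colombeau algebras. Generalized wave front set: $u=[(u_\varepsilon)_\varepsilon]\in\mathcal{G}(\Omega)$ is $\mathcal{G}^\infty$-microlocally regular at $(x_0,\xi_0)\in T^*(\Omega)\setminus0$ if there are $\phi\in\mathcal{C}^\infty_{\mathrm c}(\Omega)$ with $\phi(x_0)=1$, a conic neighborhood $\Gamma$ of $\xi_0$ and $N$ such that for all $l$: $\sup_{\xi\in\Gamma}\langle\xi\rangle^l|\widehat{\phi u_\varepsilon}(\xi)|=O(\varepsilon^{-N})$ as $\varepsilon\to0$. $\mathrm{WF}_{\mathrm g}(u)\subseteq T^*(\Omega)\setminus 0$ is the complement of the set of such points. Hamilton flow: $\Phi_t(x_0,\xi_0)=(x(t),\xi(t))$, where $\dot x=\partial_\xi P_1(t,x,\xi)$, $\dot\xi=-\partial_xP_1(t,x,\xi)$, $(x(0),\xi(0))=(x_0,\xi_0)$.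
   Formalization: The Hamilton flow is assumed to be defined for all times and to map T*(Ω) onto itself for every t; without this the claim fails, e.g. for Ω=(0,1), P=D_x, u=h(x−t), where singularities enter through the boundary. *)

theory Defs
  imports "HOL-Analysis.Analysis" "HOL-Library.Landau_Symbols"
begin

section \<open>Smooth functions\<close>

definition partial_deriv ::
  "'a::euclidean_space \<Rightarrow> ('a \<Rightarrow> 'b::real_normed_vector) \<Rightarrow> 'a \<Rightarrow> 'b" where
  "partial_deriv v f x = frechet_derivative f (at x) v"

text \<open>A multi-index derivative is given by a list of basis directions; for smooth functions the order
  of the directions is irrelevant, so these are exactly the operators \<open>\<partial>\<^sup>\<alpha>\<close>.\<close>

primrec iter_partial ::
  "'a::euclidean_space list \<Rightarrow> ('a \<Rightarrow> 'b::real_normed_vector) \<Rightarrow> 'a \<Rightarrow> 'b" where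
  "iter_partial [] f = f"
| "iter_partial (v # vs) f = partial_deriv v (iter_partial vs f)"

text \<open>Intended for open \<open>S\<close> only. Functions on \<open>S\<close> are represented by total functions whose
  values outside \<open>S\<close> are irrelevant.\<close>

definition smooth_on :: "'a::euclidean_space set \<Rightarrow> ('a \<Rightarrow> 'b::real_normed_vector) \<Rightarrow> bool" where
  "smooth_on S f \<longleftrightarrow>
     (\<forall>vs. set vs \<subseteq> Basis \<longrightarrow> (\<forall>x\<in>S. iter_partial vs f differentiable (at x)))"

definition test_function :: "'a::euclidean_space set \<Rightarrow> ('a \<Rightarrow> complex) \<Rightarrow> bool" where
  "test_function S \<phi> \<longleftrightarrow> smooth_on UNIV \<phi> \<and>
     compact (closure {x. \<phi> x \<noteq> 0}) \<and> closure {x. \<phi> x \<noteq> 0} \<subseteq> S"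


section \<open>Colombeau algebras\<close>

text \<open>The case distinction is needed because the supremum of the empty set of reals is unspecified.\<close>

definition sup_norm_on :: "'a set \<Rightarrow> ('a \<Rightarrow> 'b::real_normed_vector) \<Rightarrow> real" where
  "sup_norm_on K f = (if K = {} then 0 else SUP x\<in>K. norm (f x))"

text \<open>Only the members of a net with index in \<open>{0<..1}\<close> are relevant.\<close>

type_synonym 'a net = "real \<Rightarrow> 'a \<Rightarrow> complex"

definition moderate_nets :: "'a::euclidean_space set \<Rightarrow> 'a net set" where
  "moderate_nets S = {u. (\<forall>\<epsilon>\<in>{0<..1}. smooth_on S (u \<epsilon>)) \<and>
     (\<forall>K vs. compact K \<and> K \<subseteq> S \<and> set vs \<subseteq> Basis \<longrightarrow>
       (\<exists>p::real. (\<lambda>\<epsilon>. sup_norm_on K (iter_partial vs (u \<epsilon>))) \<in> O[at_right 0](\<lambda>\<epsilon>. \<epsilon> powr (- p))))}"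

definition negligible_nets :: "'a::euclidean_space set \<Rightarrow> 'a net set" where
  "negligible_nets S = {u \<in> moderate_nets S.
     \<forall>K (q::real). compact K \<and> K \<subseteq> S \<longrightarrow>
       (\<lambda>\<epsilon>. sup_norm_on K (u \<epsilon>)) \<in> O[at_right 0](\<lambda>\<epsilon>. \<epsilon> powr q)}"

definition colombeau_rel :: "'a::euclidean_space set \<Rightarrow> ('a net \<times> 'a net) set" where
  "colombeau_rel S = {(u, v). u \<in> moderate_nets S \<and> v \<in> moderate_nets S \<and>
     (\<lambda>\<epsilon> x. u \<epsilon> x - v \<epsilon> x) \<in> negligible_nets S}"

definition colombeau :: "'a::euclidean_space set \<Rightarrow> 'a net set set" where
  "colombeau S = moderate_nets S // colombeau_rel S"

definition colombeau_class :: "'a::euclidean_space set \<Rightarrow> 'a net \<Rightarrow> 'a net set" where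
  "colombeau_class S u = colombeau_rel S `` {u}"

text \<open>The map on classes induced by applying \<open>F\<close> to each member of a representative; a class in the
  algebra over \<open>T\<close> is obtained whenever the result is independent of the representative.\<close>

definition colombeau_map ::
  "'b::euclidean_space set \<Rightarrow> (('a::euclidean_space \<Rightarrow> complex) \<Rightarrow> 'b \<Rightarrow> complex) \<Rightarrow>
   'a net set \<Rightarrow> 'b net set" where
  "colombeau_map T F U = (\<Union>u\<in>U. colombeau_class T (\<lambda>\<epsilon>. F (u \<epsilon>)))"

definition colombeau_at_time ::
  "'a::euclidean_space set \<Rightarrow> real \<Rightarrow> ('a \<times> real) net set \<Rightarrow> 'a net set" where
  "colombeau_at_time \<Omega> t U = colombeau_map \<Omega> (\<lambda>f x. f (x, t)) U"


section \<open>Generalized wave front set\<close>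

definition fourier :: "('a::euclidean_space \<Rightarrow> complex) \<Rightarrow> 'a \<Rightarrow> complex" where
  "fourier v \<xi> = (LINT x|lborel. exp (- \<i> * complex_of_real (x \<bullet> \<xi>)) * v x)"

definition japanese_bracket :: "'a::real_normed_vector \<Rightarrow> real" where
  "japanese_bracket \<xi> = sqrt (1 + (norm \<xi>)\<^sup>2)"

definition conic_neighborhood :: "'a::real_normed_vector set \<Rightarrow> 'a \<Rightarrow> bool" where
  "conic_neighborhood \<Gamma> \<xi>0 \<longleftrightarrow>
     \<xi>0 \<in> interior \<Gamma> \<and> 0 \<notin> \<Gamma> \<and> (\<forall>\<xi>\<in>\<Gamma>. \<forall>r>0. r *\<^sub>R \<xi> \<in> \<Gamma>)"

definition microlocally_regular ::
  "'a::euclidean_space set \<Rightarrow> 'a net set \<Rightarrow> 'a \<times> 'a \<Rightarrow> bool" where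
  "microlocally_regular \<Omega> U = (\<lambda>(x0, \<xi>0).
     \<exists>u\<in>U. \<exists>\<phi> \<Gamma> (N::nat). test_function \<Omega> \<phi> \<and> \<phi> x0 = 1 \<and> conic_neighborhood \<Gamma> \<xi>0 \<and>
       (\<forall>l::nat. (\<lambda>\<epsilon>. SUP \<xi>\<in>\<Gamma>. japanese_bracket \<xi> ^ l * norm (fourier (\<lambda>x. \<phi> x * u \<epsilon> x) \<xi>))
          \<in> O[at_right 0](\<lambda>\<epsilon>. \<epsilon> powr (- real N))))"

definition WF_g :: "'a::euclidean_space set \<Rightarrow> 'a net set \<Rightarrow> ('a \<times> 'a) set" where
  "WF_g \<Omega> U = {z \<in> \<Omega> \<times> (UNIV - {0}). \<not> microlocally_regular \<Omega> U z}"


section \<open>First-order operators and the Hamilton flow\<close>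

text \<open>The operator is \<open>P(t, x, D\<^sub>x) = (\<Sum>j. a j (t, x) D\<^sub>j) + b (t, x)\<close>. It acts on functions of \<open>(x, t)\<close>,
  whereas its coefficients are functions of \<open>(t, x)\<close>.\<close>

definition D_x ::
  "'n::finite \<Rightarrow> ((real^'n) \<times> real \<Rightarrow> complex) \<Rightarrow> (real^'n) \<times> real \<Rightarrow> complex" where
  "D_x j f z = - \<i> * partial_deriv (axis j 1, 0) f z"

definition first_order_op ::
  "('n::finite \<Rightarrow> real \<times> (real^'n) \<Rightarrow> complex) \<Rightarrow> (real \<times> (real^'n) \<Rightarrow> complex) \<Rightarrow>
   ((real^'n) \<times> real \<Rightarrow> complex) \<Rightarrow> (real^'n) \<times> real \<Rightarrow> complex" where
  "first_order_op a b f = (\<lambda>(x, t). (\<Sum>j\<in>UNIV. a j (t, x) * D_x j f (x, t)) + b (t, x) * f (x, t))"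

definition evolution_op ::
  "('n::finite \<Rightarrow> real \<times> (real^'n) \<Rightarrow> complex) \<Rightarrow> (real \<times> (real^'n) \<Rightarrow> complex) \<Rightarrow>
   ((real^'n) \<times> real \<Rightarrow> complex) \<Rightarrow> (real^'n) \<times> real \<Rightarrow> complex" where
  "evolution_op a b f z = partial_deriv (0, 1) f z + \<i> * first_order_op a b f z"

definition principal_symbol ::
  "('n::finite \<Rightarrow> real \<times> (real^'n) \<Rightarrow> complex) \<Rightarrow> real \<Rightarrow> real^'n \<Rightarrow> real^'n \<Rightarrow> complex" where
  "principal_symbol a t x \<xi> = (\<Sum>j\<in>UNIV. a j (t, x) * complex_of_real (\<xi> $ j))"

text \<open>The compact set does not depend on \<open>t\<close>; the constant value attained outside of it may.\<close>

definition constant_outside_compact ::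
  "'a::topological_space set \<Rightarrow> (real \<times> 'a \<Rightarrow> complex) \<Rightarrow> bool" where
  "constant_outside_compact \<Omega> a \<longleftrightarrow>
     (\<exists>K. compact K \<and> K \<subseteq> \<Omega> \<and> (\<forall>t. \<exists>c. \<forall>x\<in>\<Omega> - K. a (t, x) = c))"

definition gradient :: "(real^'n \<Rightarrow> real) \<Rightarrow> real^'n \<Rightarrow> real^'n::finite" where
  "gradient f x = (\<chi> j. partial_deriv (axis j 1) f x)"

text \<open>\<open>\<Phi>\<close> is the Hamilton flow of \<open>p\<close> on \<open>T\<^sup>*(\<Omega>)\<close>, started at time \<open>0\<close>. That it is a flow on
  \<open>T\<^sup>*(\<Omega>)\<close> for all times is part of the definition: every \<open>\<Phi> t\<close> maps \<open>T\<^sup>*(\<Omega>)\<close> onto itself (and is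
  then bijective for smooth \<open>p\<close>, by uniqueness for the differential equation). For \<open>\<Omega> = UNIV\<close> and the
  symbols considered here this always holds. In a proper subset, characteristics may
  run out of or enter through the boundary, e.g. for \<open>p t x \<xi> = \<xi>\<close> on an interval; there, the data at
  time \<open>0\<close> do not determine the solution.\<close>

definition hamilton_flow ::
  "(real^'n::finite) set \<Rightarrow> (real \<Rightarrow> real^'n \<Rightarrow> real^'n \<Rightarrow> real) \<Rightarrow>
   (real \<Rightarrow> (real^'n) \<times> (real^'n) \<Rightarrow> (real^'n) \<times> (real^'n)) \<Rightarrow> bool" where
  "hamilton_flow \<Omega> p \<Phi> \<longleftrightarrow>
     (\<forall>t. \<Phi> t ` (\<Omega> \<times> UNIV) = \<Omega> \<times> UNIV) \<and>
     (\<forall>z\<in>\<Omega> \<times> UNIV. \<Phi> 0 z = z \<and>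
       (\<forall>t. ((\<lambda>s. fst (\<Phi> s z)) has_vector_derivative
               gradient (\<lambda>\<eta>. p t (fst (\<Phi> t z)) \<eta>) (snd (\<Phi> t z))) (at t) \<and>
            ((\<lambda>s. snd (\<Phi> s z)) has_vector_derivative
               - gradient (\<lambda>y. p t y (snd (\<Phi> t z))) (fst (\<Phi> t z))) (at t)))"

end

theory Submission
  imports Defs "HOL-Probability.Characteristic_Functions" "HOL-Probability.Sinc_Integral"
begin

text \<open>
  Along a characteristic \<open>t \<mapsto> \<gamma> (t, y)\<close> the equation is an ordinary differential equation for each
  \<open>\<epsilon>\<close>, so that \<open>u (\<gamma> (t, y), t) = exp (- \<i> phase (t, y)) g y\<close> modulo negligible nets. Since the
  Hamiltonian is linear in the covector, the Hamilton flow is \<open>(y, \<xi>) \<mapsto> (\<gamma> (t, y), \<xi> v* X (t, y))\<close>,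
  where \<open>X (t, y)\<close> is the inverse Jacobian of \<open>y \<mapsto> \<gamma> (t, y)\<close>. Hence \<open>u (\<cdot>, t)\<close> and \<open>g\<close> are
  pullbacks of each other under a diffeomorphism, up to a nowhere vanishing smooth factor, and it remains
  to see that microlocal regularity is preserved by such pullbacks. By Fourier inversion the transform of
  a pullback is \<open>\<integral> I(\<xi>, \<eta>) Fv(\<eta>) d\<eta>\<close> with an oscillatory integral \<open>I\<close> that decays rapidly
  outside a cone around the graph of the transposed Jacobian, by the principle of nonstationary phase.
\<close>

section \<open>Functions of class \<open>C\<^sup>k\<close>\<close>

text \<open>The definition of \<open>hamilton_flow\<close> prescribes only the derivatives of
  \<open>\<Phi>\<close> in time, so smoothness in the initial value has to be proved. The covector
  half of the flow makes this possible: it solves the adjoint of the linearised equation, and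
  conjugating the difference of two characteristics with the resulting matrix \<open>X\<close>
  leaves only a quadratic error. This identifies the Jacobian of
  \<open>y \<mapsto> \<gamma> (t, y)\<close> as the inverse \<open>J\<close> of \<open>X\<close>,
  and a bootstrap between \<open>\<gamma>\<close>, \<open>X\<close> and \<open>J\<close> gives all
  higher orders.

  In the definition of regularity the exponent \<open>N\<close> must be the same for all
  \<open>l\<close>. The pullback estimate is therefore linear in two constants: \<open>A\<close>,
  for the decay of \<open>Fv\<close> on the cone, and \<open>D\<close>, for its global supremum.
  Along a net \<open>A\<close> is of order \<open>\<epsilon> powr (- N)\<close> whatever
  \<open>l\<close> is, and \<open>D\<close> is of the one moderate order that the net has on a
  compact set; only the factor in front depends on \<open>l\<close>.

  The two inclusions are pullbacks along the inverse of the flow map, with Jacobian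
  \<open>X\<close>, and along the flow map itself, with Jacobian \<open>J\<close>.\<close>

lemma has_derivative_partial_deriv:
  fixes f :: "'a::euclidean_space \<Rightarrow> 'b::real_normed_vector"
  assumes "f differentiable at x"
  shows "(f has_derivative (\<lambda>h. \<Sum>b\<in>Basis. (h \<bullet> b) *\<^sub>R partial_deriv b f x)) (at x)"
proof -
  have D: "(f has_derivative frechet_derivative f (at x)) (at x)"
    using assms frechet_derivative_works by blast
  interpret bounded_linear "frechet_derivative f (at x)"
    using D by (rule has_derivative_bounded_linear)
  have "frechet_derivative f (at x) h = (\<Sum>b\<in>Basis. (h \<bullet> b) *\<^sub>R partial_deriv b f x)" for h
    by (subst euclidean_representation[of h, symmetric]) (simp only: sum scaleR partial_deriv_def)
  then have "frechet_derivative f (at x) = (\<lambda>h. \<Sum>b\<in>Basis. (h \<bullet> b) *\<^sub>R partial_deriv b f x)"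
    by blast
  with D show ?thesis by simp
qed

lemma partial_deriv_eq:
  "(f has_derivative f') (at x) \<Longrightarrow> partial_deriv b f x = f' b"
  unfolding partial_deriv_def by (metis frechet_derivative_at)

lemma partial_deriv_cong:
  assumes "open S" "x \<in> S" "\<And>y. y \<in> S \<Longrightarrow> f y = g y"
  shows "partial_deriv b f x = partial_deriv b g x"
proof -
  have "(f has_derivative F) (at x) \<longleftrightarrow> (g has_derivative F) (at x)" for F
    by (metis assms has_derivative_transform_within_open)
  then show ?thesis by (simp add: partial_deriv_def frechet_derivative_def)
qed

text \<open>Unlike \<open>smooth_on\<close>, this predicate allows induction on the order of differentiability.\<close>

primrec Ck :: "nat \<Rightarrow> 'a::euclidean_space set \<Rightarrow> ('a \<Rightarrow> 'b::real_normed_vector) \<Rightarrow> bool" where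
  "Ck 0 S f \<longleftrightarrow> continuous_on S f"
| "Ck (Suc k) S f \<longleftrightarrow> (\<forall>x\<in>S. f differentiable at x) \<and> (\<forall>b\<in>Basis. Ck k S (partial_deriv b f))"

lemma Ck_SucD: "Ck (Suc k) S f \<Longrightarrow> Ck k S f"
proof (induction k arbitrary: f)
  case 0
  then show ?case
    by (auto intro!: continuous_at_imp_continuous_on simp: differentiable_imp_continuous_within)
qed simp

lemma Ck_mono: "j \<le> k \<Longrightarrow> Ck k S f \<Longrightarrow> Ck j S f"
  by (induction rule: inc_induct) (auto intro: Ck_SucD simp del: Ck.simps)

lemma Ck_continuous_on: "Ck k S f \<Longrightarrow> continuous_on S f"
  using Ck_mono[of 0 k] by simp

lemma Ck_subset: "Ck k S f \<Longrightarrow> T \<subseteq> S \<Longrightarrow> Ck k T f"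
  by (induction k arbitrary: f) (auto intro: continuous_on_subset)

text \<open>Both continuity and \<open>partial_deriv\<close> at a point of an open set see only the
  values nearby, and values outside the set are arbitrary throughout.\<close>

lemma Ck_cong:
  assumes "open S"
  shows "(\<And>x. x \<in> S \<Longrightarrow> f x = g x) \<Longrightarrow> Ck k S f \<longleftrightarrow> Ck k S g"
proof (induction k arbitrary: f g)
  case 0
  then show ?case by (simp cong: continuous_on_cong)
next
  case (Suc k)
  have "f differentiable at x \<longleftrightarrow> g differentiable at x" if "x \<in> S" for x
    unfolding differentiable_def
    by (metis Suc.prems assms has_derivative_transform_within_open that)
  moreover have "Ck k S (partial_deriv b f) \<longleftrightarrow> Ck k S (partial_deriv b g)" for b
    by (rule Suc.IH) (use Suc.prems partial_deriv_cong[OF assms] in blast)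
  ultimately show ?case by simp
qed

text \<open>Lets an induction step work with an explicit formula for the derivative instead of
  \<open>partial_deriv b f\<close>, which agrees with the formula only on \<open>S\<close>.\<close>

lemma Ck_SucI:
  assumes "open S" "\<And>x. x \<in> S \<Longrightarrow> (f has_derivative f' x) (at x)"
    and "\<And>b. b \<in> Basis \<Longrightarrow> Ck k S (\<lambda>x. f' x b)"
  shows "Ck (Suc k) S f"
proof -
  have "Ck k S (partial_deriv b f)" if "b \<in> Basis" for b
    using Ck_cong[OF \<open>open S\<close>, of "partial_deriv b f" "\<lambda>x. f' x b" k] assms(2,3) that
    by (auto dest: partial_deriv_eq)
  then show ?thesis using assms by (auto simp: differentiable_def)
qed

lemma Ck_Suc_has_derivative:
  assumes "Ck (Suc k) S f" "x \<in> S"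
  shows "(f has_derivative (\<lambda>h. \<Sum>b\<in>Basis. (h \<bullet> b) *\<^sub>R partial_deriv b f x)) (at x)"
  using assms has_derivative_partial_deriv by auto

text \<open>\<open>iter_partial\<close> applies the head of the list last, whereas the recursion of
  \<open>Ck\<close> strips the innermost derivative; appending at the end of the list connects the
  two.\<close>

lemma iter_partial_snoc: "iter_partial (vs @ [v]) f = iter_partial vs (partial_deriv v f)"
  by (induction vs) simp_all

lemma smooth_on_partial_deriv:
  "smooth_on S f \<Longrightarrow> b \<in> Basis \<Longrightarrow> smooth_on S (partial_deriv b f)"
  unfolding smooth_on_def by (auto simp flip: iter_partial_snoc)

text \<open>Continuity of each derivative, which \<open>Ck\<close> asks for and
  \<open>smooth_on\<close> does not mention, comes from its differentiability.\<close>

lemma smooth_on_iff_Ck: "smooth_on S f \<longleftrightarrow> (\<forall>k. Ck k S f)"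
proof
  have "Ck k S f" if "smooth_on S f" for k
    using that
  proof (induction k arbitrary: f)
    case 0
    then have "\<forall>x\<in>S. f differentiable at x" unfolding smooth_on_def
      by (metis empty_set empty_subsetI iter_partial.simps(1))
    then show ?case
      by (auto intro!: continuous_at_imp_continuous_on simp: differentiable_imp_continuous_within)
  next
    case (Suc k)
    then have "\<forall>x\<in>S. f differentiable at x" unfolding smooth_on_def
      by (metis empty_set empty_subsetI iter_partial.simps(1))
    with Suc show ?case by (auto intro: smooth_on_partial_deriv)
  qed
  then show "smooth_on S f \<Longrightarrow> \<forall>k. Ck k S f" by blast
next
  assume C: "\<forall>k. Ck k S f"
  have "\<forall>k. Ck k S (iter_partial vs f)" if "set vs \<subseteq> Basis" for vs
    using that
  proof (induction vs)
    case (Cons v vs)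
    have "Ck (Suc k) S (iter_partial vs f)" for k using Cons by auto
    then show ?case using Cons.prems by auto
  qed (use C in simp)
  then have "Ck (Suc 0) S (iter_partial vs f)" if "set vs \<subseteq> Basis" for vs
    using that by blast
  then show "smooth_on S f" unfolding smooth_on_def by simp
qed

named_theorems Ck_intros

lemma Ck_const [Ck_intros]: "open S \<Longrightarrow> Ck k S (\<lambda>x. c)"
proof (induction k arbitrary: c)
  case (Suc k)
  show ?case by (rule Ck_SucI[where f'="\<lambda>_ _. 0"]) (use Suc in auto)
qed simp

lemma Ck_linear:
  assumes "open S" "bounded_linear L"
  shows "Ck k S L"
proof (cases k)
  case 0
  then show ?thesis using assms by (simp add: linear_continuous_on)
next
  case (Suc j)
  show ?thesis unfolding Suc
    by (rule Ck_SucI[where f'="\<lambda>_. L"])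
      (use assms Ck_const in \<open>auto intro!: bounded_linear_imp_has_derivative\<close>)
qed

lemma Ck_id [Ck_intros]: "open S \<Longrightarrow> Ck k S (\<lambda>x. x)"
  by (rule Ck_linear) auto

lemma Ck_bounded_linear:
  assumes "open S" "bounded_linear L"
  shows "Ck k S f \<Longrightarrow> Ck k S (\<lambda>x. L (f x))"
proof (induction k arbitrary: f)
  case 0
  then show ?case using assms
    by (auto intro: continuous_on_compose2[OF linear_continuous_on[OF assms(2), of UNIV]])
next
  case (Suc k)
  show ?case
  proof (rule Ck_SucI[OF \<open>open S\<close>])
    show "((\<lambda>x. L (f x)) has_derivative (\<lambda>h. L (frechet_derivative f (at x) h))) (at x)"
      if "x \<in> S" for x
      using that Suc.prems by (intro bounded_linear.has_derivative[OF assms(2)])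
        (auto simp: frechet_derivative_works)
    show "Ck k S (\<lambda>x. L (frechet_derivative f (at x) b))" if "b \<in> Basis" for b
      using Suc.IH[of "partial_deriv b f"] Suc.prems that by (simp add: partial_deriv_def[abs_def])
  qed
qed

lemma Ck_add [Ck_intros]:
  assumes "open S"
  shows "Ck k S f \<Longrightarrow> Ck k S g \<Longrightarrow> Ck k S (\<lambda>x. f x + g x)"
proof (induction k arbitrary: f g)
  case 0
  then show ?case by (auto intro: continuous_intros)
next
  case (Suc k)
  show ?case
  proof (rule Ck_SucI[OF \<open>open S\<close>])
    show "((\<lambda>x. f x + g x) has_derivative
        (\<lambda>h. frechet_derivative f (at x) h + frechet_derivative g (at x) h)) (at x)"
      if "x \<in> S" for x
      using that Suc.prems by (intro has_derivative_add) (auto simp: frechet_derivative_works)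
    show "Ck k S (\<lambda>x. frechet_derivative f (at x) b + frechet_derivative g (at x) b)"
      if "b \<in> Basis" for b
      using Suc.IH[of "partial_deriv b f" "partial_deriv b g"] Suc.prems that
      by (simp add: partial_deriv_def[abs_def])
  qed
qed

lemma Ck_sum [Ck_intros]:
  assumes "open S"
  shows "(\<And>i. i \<in> I \<Longrightarrow> Ck k S (f i)) \<Longrightarrow> Ck k S (\<lambda>x. \<Sum>i\<in>I. f i x)"
proof (induction I rule: infinite_finite_induct)
  case (insert i I)
  then show ?case using Ck_add[OF assms, of k "f i" "\<lambda>x. \<Sum>i\<in>I. f i x"] by simp
qed (use Ck_const[OF assms] in simp_all)

text \<open>A single induction on the Leibniz rule serves products, scalings and inner products, and
  later the matrix products.\<close>

lemma Ck_bilinear: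
  assumes "open S" "bounded_bilinear B"
  shows "Ck k S f \<Longrightarrow> Ck k S g \<Longrightarrow> Ck k S (\<lambda>x. B (f x) (g x))"
proof (induction k arbitrary: f g)
  case 0
  then show ?case using bounded_bilinear.continuous_on[OF assms(2)] by auto
next
  case (Suc k)
  show ?case
  proof (rule Ck_SucI[OF \<open>open S\<close>])
    show "((\<lambda>x. B (f x) (g x)) has_derivative
        (\<lambda>h. B (f x) (frechet_derivative g (at x) h) + B (frechet_derivative f (at x) h) (g x))) (at x)"
      if "x \<in> S" for x
      using that Suc.prems by (intro bounded_bilinear.FDERIV[OF assms(2)])
        (auto simp: frechet_derivative_works)
    show "Ck k S (\<lambda>x. B (f x) (frechet_derivative g (at x) b) + B (frechet_derivative f (at x) b) (g x))"
      if "b \<in> Basis" for b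
    proof (rule Ck_add[OF \<open>open S\<close>])
      show "Ck k S (\<lambda>x. B (f x) (frechet_derivative g (at x) b))"
        using Suc.IH[of f "partial_deriv b g"] Ck_SucD[OF Suc.prems(1)] Suc.prems that
        by (simp add: partial_deriv_def[abs_def])
      show "Ck k S (\<lambda>x. B (frechet_derivative f (at x) b) (g x))"
        using Suc.IH[of "partial_deriv b f" g] Ck_SucD[OF Suc.prems(2)] Suc.prems that
        by (simp add: partial_deriv_def[abs_def])
    qed
  qed
qed

lemmas Ck_mult [Ck_intros] = Ck_bilinear[OF _ bounded_bilinear_mult]
lemmas Ck_scaleR [Ck_intros] = Ck_bilinear[OF _ bounded_bilinear_scaleR]
lemmas Ck_inner [Ck_intros] = Ck_bilinear[OF _ bounded_bilinear_inner]
lemmas Ck_of_real [Ck_intros] = Ck_bounded_linear[OF _ bounded_linear_of_real]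
lemmas Ck_Re [Ck_intros] = Ck_bounded_linear[OF _ bounded_linear_Re]
lemmas Ck_minus [Ck_intros] = Ck_bounded_linear[OF _ bounded_linear_minus[OF bounded_linear_ident]]
lemmas Ck_fst [Ck_intros] = Ck_bounded_linear[OF _ bounded_linear_fst]
lemmas Ck_snd [Ck_intros] = Ck_bounded_linear[OF _ bounded_linear_snd]
lemmas Ck_vec_nth [Ck_intros] = Ck_bounded_linear[OF _ bounded_linear_vec_nth]

lemma Ck_diff [Ck_intros]:
  "open S \<Longrightarrow> Ck k S f \<Longrightarrow> Ck k S g \<Longrightarrow> Ck k S (\<lambda>x. f x - g x)"
  using Ck_add[of S k f "\<lambda>x. - g x"] Ck_minus[of S k g] by simp

lemma Ck_Pair [Ck_intros]:
  assumes "open S" "Ck k S f" "Ck k S g"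
  shows "Ck k S (\<lambda>x. (f x, g x))"
proof -
  have "Ck k S (\<lambda>x. (f x, 0) + (0, g x))"
    by (intro Ck_add Ck_bounded_linear[where L="\<lambda>x. (x, 0)"] Ck_bounded_linear[where L="\<lambda>x. (0, x)"] assms)
      (auto intro!: bounded_linear_intros)
  then show ?thesis by simp
qed

lemma bounded_linear_axis: "bounded_linear (axis i :: 'b::real_normed_vector \<Rightarrow> 'b^'i::finite)"
  by (rule bounded_linear_intro[where K=1])
    (auto simp: vec_eq_iff axis_def norm_vec_def L2_set_def if_distrib[of norm] if_distrib[of "\<lambda>x. x ^ _"] cong: if_cong)

lemma sum_axis_eq:
  fixes g :: "'i::finite \<Rightarrow> 'b::comm_monoid_add"
  shows "(\<Sum>i\<in>UNIV. axis i (g i)) = (\<chi> i. g i)"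
  by (simp add: vec_eq_iff axis_def)

lemma Ck_vec_lambda [Ck_intros]:
  fixes f :: "'b::finite \<Rightarrow> 'a::euclidean_space \<Rightarrow> 'c::real_normed_vector"
  assumes "open S" "\<And>i. Ck k S (f i)"
  shows "Ck k S (\<lambda>x. \<chi> i. f i x)"
  unfolding sum_axis_eq[symmetric]
  by (intro Ck_sum Ck_bounded_linear[OF _ bounded_linear_axis] assms)

text \<open>The chain rule is expanded in the basis of the intermediate space: the direction
  \<open>frechet_derivative g (at x) b\<close> varies with \<open>x\<close>, but the induction
  hypothesis covers the derivatives of \<open>f\<close> along fixed basis vectors.\<close>

lemma Ck_compose:
  assumes "open S" "open T" and sub: "\<And>x. x \<in> S \<Longrightarrow> g x \<in> T"
  shows "Ck k T f \<Longrightarrow> Ck k S g \<Longrightarrow> Ck k S (\<lambda>x. f (g x))"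
proof (induction k arbitrary: f)
  case 0
  then show ?case using sub by (auto intro: continuous_on_compose2)
next
  case (Suc k)
  show ?case
  proof (rule Ck_SucI[OF \<open>open S\<close>])
    show "((\<lambda>x. f (g x)) has_derivative
        (\<lambda>h. \<Sum>i\<in>Basis. (frechet_derivative g (at x) h \<bullet> i) *\<^sub>R partial_deriv i f (g x))) (at x)"
      if "x \<in> S" for x
    proof -
      have "(g has_derivative frechet_derivative g (at x)) (at x)"
        using Suc.prems that by (auto simp: frechet_derivative_works)
      from has_derivative_compose[OF this Ck_Suc_has_derivative[OF Suc.prems(1) sub[OF that]]]
      show ?thesis .
    qed
    show "Ck k S (\<lambda>x. \<Sum>i\<in>Basis. (frechet_derivative g (at x) b \<bullet> i) *\<^sub>R partial_deriv i f (g x))"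
      if "b \<in> Basis" for b
      using Suc.IH[of "partial_deriv _ f"] Ck_SucD[OF Suc.prems(2)] Suc.prems that
      by (intro Ck_intros \<open>open S\<close>) (simp_all add: partial_deriv_def[abs_def])
  qed
qed

lemma Ck_inverse [Ck_intros]:
  fixes f :: "'a::euclidean_space \<Rightarrow> 'b::real_normed_field"
  assumes "open S" and nz: "\<And>x. x \<in> S \<Longrightarrow> f x \<noteq> 0"
  shows "Ck k S f \<Longrightarrow> Ck k S (\<lambda>x. inverse (f x))"
proof (induction k)
  case 0
  then show ?case using nz by (auto intro!: continuous_intros)
next
  case (Suc k)
  show ?case
  proof (rule Ck_SucI[OF \<open>open S\<close>])
    show "((\<lambda>x. inverse (f x)) has_derivative
        (\<lambda>h. - (inverse (f x) * frechet_derivative f (at x) h * inverse (f x)))) (at x)"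
      if "x \<in> S" for x
      using that Suc.prems nz
      by (intro Deriv.has_derivative_inverse) (auto simp: frechet_derivative_works)
    show "Ck k S (\<lambda>x. - (inverse (f x) * frechet_derivative f (at x) b * inverse (f x)))"
      if "b \<in> Basis" for b
      using Suc.IH Ck_SucD[OF Suc.prems] Suc.prems that
      by (intro Ck_intros \<open>open S\<close>) (simp_all add: partial_deriv_def[abs_def])
  qed
qed

lemma Ck_divide [Ck_intros]:
  fixes f :: "'a::euclidean_space \<Rightarrow> 'b::real_normed_field"
  shows "open S \<Longrightarrow> Ck k S f \<Longrightarrow> Ck k S g \<Longrightarrow> (\<And>x. x \<in> S \<Longrightarrow> g x \<noteq> 0) \<Longrightarrow> Ck k S (\<lambda>x. f x / g x)"
  unfolding divide_inverse by (intro Ck_intros)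

lemma Ck_exp [Ck_intros]:
  fixes f :: "'a::euclidean_space \<Rightarrow> 'b::{real_normed_field,banach}"
  assumes "open S"
  shows "Ck k S f \<Longrightarrow> Ck k S (\<lambda>x. exp (f x))"
proof (induction k)
  case 0
  then show ?case by (auto intro!: continuous_intros)
next
  case (Suc k)
  show ?case
  proof (rule Ck_SucI[OF \<open>open S\<close>])
    show "((\<lambda>x. exp (f x)) has_derivative
        (\<lambda>h. exp (f x) * frechet_derivative f (at x) h)) (at x)"
      if "x \<in> S" for x
    proof -
      have "(exp has_derivative (*) (exp (f x))) (at (f x))"
        using DERIV_exp by (simp add: has_field_derivative_def)
      moreover have "(f has_derivative frechet_derivative f (at x)) (at x)"
        using that Suc.prems by (auto simp: frechet_derivative_works)
      ultimately show ?thesis by (auto dest: has_derivative_compose)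
    qed
    show "Ck k S (\<lambda>x. exp (f x) * frechet_derivative f (at x) b)"
      if "b \<in> Basis" for b
      using Suc.IH Ck_SucD[OF Suc.prems] Suc.prems that
      by (intro Ck_intros \<open>open S\<close>) (simp_all add: partial_deriv_def[abs_def])
  qed
qed

lemma Ck_Un:
  assumes "open S" "open T"
  shows "Ck k S f \<Longrightarrow> Ck k T f \<Longrightarrow> Ck k (S \<union> T) f"
  by (induction k arbitrary: f) (auto intro: continuous_on_open_Un assms)

lemma Ck_partial_deriv: "Ck (Suc k) S f \<Longrightarrow> b \<in> Basis \<Longrightarrow> Ck k S (partial_deriv b f)"
  by simp

section \<open>Differentiation under the integral sign\<close>

lemma continuous_on_blinfun_componentwise':
  fixes f :: "'a::t2_space \<Rightarrow> 'b::euclidean_space \<Rightarrow> 'c::real_normed_vector"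
  assumes bl: "\<And>x. bounded_linear (f x)" and c: "\<And>b. b \<in> Basis \<Longrightarrow> continuous_on S (\<lambda>x. f x b)"
  shows "continuous_on S (\<lambda>x. Blinfun (f x))"
  by (rule continuous_on_blinfun_componentwise)
    (use c in \<open>simp add: bounded_linear_Blinfun_apply[OF bl]\<close>)

lemma has_derivative_integral_param:
  fixes H :: "'z::euclidean_space \<Rightarrow> real \<Rightarrow> 'b::euclidean_space"
  assumes "open S" "x \<in> S"
    and D: "\<And>x t. x \<in> S \<Longrightarrow> t \<in> {0..1} \<Longrightarrow> ((\<lambda>x. H x t) has_derivative H' x t) (at x)"
    and c: "continuous_on (S \<times> {0..1}) (\<lambda>(x, t). H x t)"
    and c': "\<And>b. b \<in> Basis \<Longrightarrow> continuous_on (S \<times> {0..1}) (\<lambda>(x, t). H' x t b)"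
  shows "((\<lambda>x. integral {0..1} (H x)) has_derivative (\<lambda>h. integral {0..1} (\<lambda>t. H' x t h))) (at x)"
proof -
  obtain r where r: "r > 0" "ball x r \<subseteq> S" using assms(1,2) openE by blast
  \<comment> \<open>The Leibniz rule wants the derivative as a bounded linear map. The value 0 off
    \<open>S \<times> {0..1}\<close> makes the argument of \<open>Blinfun\<close> linear everywhere,
    so that \<open>blinfun_apply\<close> can always be evaluated.\<close>
  define fx where "fx = (\<lambda>y t. Blinfun (\<lambda>h. if y \<in> S \<and> t \<in> {0..1} then H' y t h else 0))"
  have bl: "bounded_linear (\<lambda>h. if y \<in> S \<and> t \<in> {0..1} then H' y t h else 0)" for y t
    using D[of y t] has_derivative_bounded_linear by (cases "y \<in> S \<and> t \<in> {0..1}") auto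
  have fx: "blinfun_apply (fx y t) h = H' y t h" if "y \<in> S" "t \<in> {0..1}" for y t h
    unfolding fx_def using that by (subst bounded_linear_Blinfun_apply[OF bl]) auto
  have cfx: "continuous_on (S \<times> {0..1}) (\<lambda>(y, t). fx y t)"
    unfolding fx_def split_beta
  proof (rule continuous_on_blinfun_componentwise')
    fix b :: 'z assume b: "b \<in> Basis"
    show "continuous_on (S \<times> {0..1})
        (\<lambda>p. if fst p \<in> S \<and> snd p \<in> {0..1} then H' (fst p) (snd p) b else 0)"
      by (rule continuous_on_eq[OF c'[OF b]]) (auto simp: split_beta)
  qed (rule bl)
  have cH: "continuous_on {0..1} (H y)" if "y \<in> S" for y
    by (rule continuous_on_compose2[OF c, where f="\<lambda>t. (y, t)", simplified])
      (use that in \<open>auto intro!: continuous_intros\<close>)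
  have "((\<lambda>x. integral (cbox 0 1) (H x)) has_derivative integral (cbox 0 1) (fx x)) (at x within ball x r)"
  proof (rule leibniz_rule)
    show "((\<lambda>x. H x t) has_derivative blinfun_apply (fx y t)) (at y within ball x r)"
      if "y \<in> ball x r" "t \<in> cbox 0 1" for y t
    proof -
      have "y \<in> S" "t \<in> {0..1}" using that r by auto
      then have "blinfun_apply (fx y t) = H' y t" using fx by blast
      then show ?thesis
        using D[OF \<open>y \<in> S\<close> \<open>t \<in> {0..1}\<close>] by (auto intro!: has_derivative_at_withinI)
    qed
    show "H y integrable_on cbox 0 1" if "y \<in> ball x r" for y
      using cH[of y] that r integrable_continuous_interval[of 0 1 "H y"] by (auto simp: subset_iff)
    show "continuous_on (ball x r \<times> cbox 0 1) (\<lambda>(x, y). fx x y)"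
      by (rule continuous_on_subset[OF cfx]) (use r in auto)
  qed (use r in auto)
  then have "((\<lambda>x. integral {0..1} (H x)) has_derivative integral {0..1} (fx x)) (at x)"
    using r(1) by (simp add: at_within_open[of x "ball x r"])
  moreover have *: "blinfun_apply (integral {0..1} (fx x)) h = integral {0..1} (\<lambda>t. H' x t h)" for h
  proof -
    have "continuous_on {0..1} (fx x)"
      by (rule continuous_on_compose2[OF cfx, where f="\<lambda>t. (x, t)", simplified])
        (use \<open>x \<in> S\<close> in \<open>auto intro!: continuous_intros\<close>)
    then have "fx x integrable_on {0..1}" by (rule integrable_continuous_interval)
    then have "blinfun_apply (integral {0..1} (fx x)) h = integral {0..1} (\<lambda>t. blinfun_apply (fx x t) h)"
      by (metis blinfun_apply_integral)
    also have "\<dots> = integral {0..1} (\<lambda>t. H' x t h)"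
      by (rule integral_cong) (use fx \<open>x \<in> S\<close> in auto)
    finally show ?thesis .
  qed
  moreover from * have "blinfun_apply (integral {0..1} (fx x)) = (\<lambda>h. integral {0..1} (\<lambda>t. H' x t h))" by blast
  ultimately show ?thesis by metis
qed

lemma Ck_integral_param:
  fixes H :: "'z::euclidean_space \<times> real \<Rightarrow> 'b::euclidean_space"
  assumes "open S"
  shows "Ck k (S \<times> UNIV) H \<Longrightarrow> Ck k S (\<lambda>x. integral {0..1} (\<lambda>t. H (x, t)))"
proof (induction k arbitrary: H)
  case 0
  have "continuous_on (S \<times> {0..1}) H" by (rule continuous_on_subset[of "S \<times> UNIV"]) (use 0 in auto)
  then show ?case
    using integral_continuous_on_param[of S 0 1 "\<lambda>x t. H (x, t)"] by simp
next
  case (Suc k)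
  have cD: "continuous_on (S \<times> UNIV) (partial_deriv b H)" if "b \<in> Basis" for b
    using Suc.prems that Ck_continuous_on[of k _ "partial_deriv b H"] by simp
  show ?case
  proof (rule Ck_SucI[OF \<open>open S\<close>])
    fix x assume "x \<in> S"
    show "((\<lambda>x. integral {0..1} (\<lambda>t. H (x, t))) has_derivative
       (\<lambda>h. integral {0..1} (\<lambda>t. frechet_derivative H (at (x, t)) (h, 0)))) (at x)"
    proof (rule has_derivative_integral_param[OF \<open>open S\<close> \<open>x \<in> S\<close>])
      show "((\<lambda>x. H (x, t)) has_derivative (\<lambda>h. frechet_derivative H (at (y, t)) (h, 0))) (at y)"
        if "y \<in> S" for y t
        by (rule has_derivative_compose[where f="\<lambda>x. (x, t)" and g'="frechet_derivative H (at (y, t))"])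
          (use Suc.prems that in \<open>auto simp: frechet_derivative_works intro!: derivative_eq_intros\<close>)
      show "continuous_on (S \<times> {0..1}) (\<lambda>(x, t). H (x, t))"
        using continuous_on_subset[OF Ck_continuous_on[OF Suc.prems], of "S \<times> {0..1}"] by auto
      show "continuous_on (S \<times> {0..1}) (\<lambda>(x, t). frechet_derivative H (at (x, t)) (b, 0))"
        if "b \<in> Basis" for b
        using continuous_on_subset[OF cD[of "(b, 0)"], of "S \<times> {0..1}"] that
        by (auto simp: Basis_prod_def partial_deriv_def split_beta)
    qed
  next
    fix b :: 'z assume "b \<in> Basis"
    then show "Ck k S (\<lambda>x. integral {0..1} (\<lambda>t. frechet_derivative H (at (x, t)) (b, 0)))"
      using Suc.IH[of "partial_deriv (b, 0) H"] Suc.prems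
      by (auto simp: Basis_prod_def partial_deriv_def[abs_def])
  qed
qed

section \<open>Fourier transform of test functions\<close>

lemma integrable_compact_support:
  fixes f :: "'a::euclidean_space \<Rightarrow> 'b::{banach, second_countable_topology}"
  assumes "continuous_on UNIV f" "compact K" "\<And>x. x \<notin> K \<Longrightarrow> f x = 0"
  shows "integrable lborel f"
proof -
  have "integrable lborel (\<lambda>x. indicator K x *\<^sub>R f x)"
    using assms by (intro borel_integrable_compact) (auto intro: continuous_on_subset)
  moreover have "(\<lambda>x. indicator K x *\<^sub>R f x) = f"
    using assms(3) by (auto simp: fun_eq_iff indicator_def)
  ultimately show ?thesis by simp
qed

lemma partial_deriv_const: "partial_deriv b (\<lambda>x. c) x = 0"
  by (rule partial_deriv_eq[OF has_derivative_const])

lemma partial_deriv_zero_outside: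
  assumes "closed K" "\<And>x. x \<notin> K \<Longrightarrow> f x = 0" "x \<notin> K"
  shows "partial_deriv b f x = 0"
proof -
  have "partial_deriv b f x = partial_deriv b (\<lambda>_. 0) x"
    by (rule partial_deriv_cong[of "- K"]) (use assms in auto)
  then show ?thesis by (simp add: partial_deriv_const)
qed

lemma bounded_compact_support:
  fixes f :: "'a::euclidean_space \<Rightarrow> 'b::real_normed_vector"
  assumes "continuous_on UNIV f" "compact K" "\<And>x. x \<notin> K \<Longrightarrow> f x = 0"
  obtains C where "C > 0" "\<And>x. norm (f x) \<le> C"
proof -
  have "bounded (f ` K)"
    using assms by (auto intro!: compact_imp_bounded compact_continuous_image intro: continuous_on_subset)
  then obtain C where "C > 0" "\<forall>x\<in>K. norm (f x) \<le> C" by (auto simp: bounded_pos)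
  then have "norm (f x) \<le> C" for x using assms(3)[of x] by (cases "x \<in> K") auto
  with \<open>C > 0\<close> show thesis using that by blast
qed

section \<open>Invariance of Lebesgue measure and integration by parts\<close>

lemma lborel_integral_shift:
  fixes f :: "'a::euclidean_space \<Rightarrow> 'b::{banach, second_countable_topology}"
  assumes [measurable]: "f \<in> borel_measurable borel"
  shows "(LINT x|lborel. f (c + x)) = (LINT x|lborel. f x)"
  by (subst (2) lborel_distr_plus[of c, symmetric]) (simp add: integral_distr)

lemma lborel_integral_affine:
  fixes f :: "'a::euclidean_space \<Rightarrow> 'b::{banach, second_countable_topology}"
  assumes [measurable]: "f \<in> borel_measurable borel" and "c > 0"
  shows "(LINT x|lborel. f x) = c ^ DIM('a) *\<^sub>R (LINT x|lborel. f (t + c *\<^sub>R x))"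
  using assms(2) by (subst lborel_affine[of c t]) (simp_all add: integral_density integral_distr)

lemma has_vector_derivative_iff_tendsto:
  "(f has_vector_derivative D) (at x) \<longleftrightarrow> ((\<lambda>h. (1 / h) *\<^sub>R (f (x + h) - f x)) \<longlongrightarrow> D) (at (0::real))"
proof -
  have "(f has_vector_derivative D) (at x) \<longleftrightarrow>
      ((\<lambda>h. norm (f (x + h) - f x - h *\<^sub>R D) / norm h) \<longlongrightarrow> 0) (at 0)"
    by (simp add: has_vector_derivative_def has_derivative_at bounded_linear_scaleR_left)
  also have "\<dots> \<longleftrightarrow> ((\<lambda>h. norm ((1 / h) *\<^sub>R (f (x + h) - f x) - D)) \<longlongrightarrow> 0) (at 0)"
  proof (rule tendsto_cong)
    have "norm (f (x + h) - f x - h *\<^sub>R D) / norm h = norm ((1 / h) *\<^sub>R (f (x + h) - f x) - D)"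
      if "h \<noteq> 0" for h
    proof -
      have "(1 / h) *\<^sub>R (f (x + h) - f x) - D = (1 / h) *\<^sub>R (f (x + h) - f x - h *\<^sub>R D)"
        using that by (simp add: scaleR_diff_right)
      then show ?thesis by simp
    qed
    then show "\<forall>\<^sub>F h in at 0. norm (f (x + h) - f x - h *\<^sub>R D) / norm h = norm ((1 / h) *\<^sub>R (f (x + h) - f x) - D)"
      by (auto simp: eventually_at_filter)
  qed
  also have "\<dots> \<longleftrightarrow> ((\<lambda>h. (1 / h) *\<^sub>R (f (x + h) - f x)) \<longlongrightarrow> D) (at 0)"
    by (simp add: tendsto_norm_zero_iff LIM_zero_iff)
  finally show ?thesis .
qed

text \<open>By translation invariance every difference quotient of \<open>h\<close> in the direction
  \<open>b\<close> has integral 0, and dominated convergence passes to the limit.\<close>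

lemma integral_partial_deriv_eq_0:
  fixes h :: "'a::euclidean_space \<Rightarrow> 'b::euclidean_space"
  assumes h: "Ck 1 UNIV h" and K: "compact K" and 0: "\<And>x. x \<notin> K \<Longrightarrow> h x = 0" and b: "b \<in> Basis"
  shows "(LINT x|lborel. partial_deriv b h x) = 0"
proof -
  have ch: "continuous_on UNIV h" using h by (rule Ck_continuous_on)
  have cD: "continuous_on UNIV (partial_deriv b h)" using h b by auto
  have D0: "partial_deriv b h x = 0" if "x \<notin> K" for x
    using partial_deriv_zero_outside[OF compact_imp_closed[OF K] 0 that] .
  obtain B where B: "B > 0" "\<And>x. norm (partial_deriv b h x) \<le> B"
    using bounded_compact_support[OF cD K D0] by blast
  obtain R where R: "R > 0" "K \<subseteq> cball 0 R"
    using compact_imp_bounded[OF K] bounded_subset_cball by (metis bounded_pos mem_cball_0 subsetI)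
  define t where "t n = 1 / real (Suc n)" for n
  have t: "t n > 0" "t n \<le> 1" for n by (auto simp: t_def)
  have t0: "t n \<noteq> 0" for n using t(1)[of n] by simp
  have tlim: "t \<longlonglongrightarrow> 0" unfolding t_def by (rule LIMSEQ_Suc[OF lim_1_over_n])
  have hd: "((\<lambda>s. h (x + s *\<^sub>R b)) has_vector_derivative partial_deriv b h (x + s *\<^sub>R b)) (at s)" for x s
  proof -
    have "(h has_derivative frechet_derivative h (at (x + s *\<^sub>R b))) (at (x + s *\<^sub>R b))"
      using h by (auto simp: frechet_derivative_works)
    moreover have "((\<lambda>s. x + s *\<^sub>R b) has_derivative (\<lambda>s. s *\<^sub>R b)) (at s)"
      by (auto intro!: derivative_eq_intros)
    ultimately have "((\<lambda>s. h (x + s *\<^sub>R b)) has_derivative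
        (\<lambda>r. frechet_derivative h (at (x + s *\<^sub>R b)) (r *\<^sub>R b))) (at s)"
      by (metis has_derivative_compose)
    then show ?thesis
      unfolding has_vector_derivative_def partial_deriv_def
      by (simp add: linear_cmul linear_frechet_derivative h[simplified])
  qed
  have bound: "norm (h (x + s *\<^sub>R b) - h x) \<le> B * s" if "s \<ge> 0" for x s
  proof -
    have "norm (h (x + s *\<^sub>R b) - h (x + 0 *\<^sub>R b)) \<le> B * norm (s - 0)"
    proof (rule differentiable_bound[where S="{0..s}"])
      show "((\<lambda>s. h (x + s *\<^sub>R b)) has_derivative (\<lambda>r. r *\<^sub>R partial_deriv b h (x + u *\<^sub>R b))) (at u within {0..s})" for u
        using hd unfolding has_vector_derivative_def by (rule has_derivative_at_withinI)
      show "onorm (\<lambda>r. r *\<^sub>R partial_deriv b h (x + u *\<^sub>R b)) \<le> B" for u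
      proof (rule onorm_le)
        show "norm (r *\<^sub>R partial_deriv b h (x + u *\<^sub>R b)) \<le> B * norm r" for r
          using mult_left_mono[OF B(2)[of "x + u *\<^sub>R b"], of "\<bar>r\<bar>"] by (simp add: mult.commute)
      qed
    qed (use that in auto)
    then show ?thesis using that by simp
  qed
  let ?q = "\<lambda>n x. (1 / t n) *\<^sub>R (h (t n *\<^sub>R b + x) - h x)"
  \<comment> \<open>The quotients are bounded by \<open>B\<close> by the mean value inequality.
    Since \<open>t n \<le> 1\<close> and \<open>b\<close> is a unit vector, they vanish outside
    \<open>cball 0 (R + 1)\<close>, which gives the integrable majorant.\<close>
  have lim: "(\<lambda>n. LINT x|lborel. ?q n x) \<longlonglongrightarrow> (LINT x|lborel. partial_deriv b h x)"
  proof (rule integral_dominated_convergence[where w="\<lambda>x. B * indicator (cball 0 (R + 1)) x"])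
    show "integrable lborel (\<lambda>x. B * indicator (cball (0::'a) (R + 1)) x)"
      using borel_integrable_compact[of "cball (0::'a) (R + 1)" "\<lambda>_. B"] by (simp add: mult.commute)
    show "AE x in lborel. (\<lambda>n. ?q n x) \<longlonglongrightarrow> partial_deriv b h x"
    proof (rule AE_I2)
      fix x
      have "((\<lambda>s. (1 / s) *\<^sub>R (h (s *\<^sub>R b + x) - h x)) \<longlongrightarrow> partial_deriv b h x) (at 0)"
        using hd[of x 0] by (simp add: has_vector_derivative_iff_tendsto add.commute)
      then show "(\<lambda>n. ?q n x) \<longlonglongrightarrow> partial_deriv b h x"
        by (rule filterlim_compose) (use tlim t0 in \<open>simp add: filterlim_at\<close>)
    qed
    show "AE x in lborel. norm (?q n x) \<le> B * indicator (cball 0 (R + 1)) x" for n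
    proof (rule AE_I2)
      fix x
      show "norm (?q n x) \<le> B * indicator (cball 0 (R + 1)) x"
      proof (cases "norm x \<le> R + 1")
        case True
        have "norm (?q n x) = norm (h (x + t n *\<^sub>R b) - h x) / t n"
          using t(1)[of n] by (simp add: add.commute)
        also have "\<dots> \<le> B" using bound[of "t n" x] t(1)[of n] by (simp add: divide_le_eq)
        finally show ?thesis using True by simp
      next
        case False
        have nb: "norm (t n *\<^sub>R b) \<le> 1" using t[of n] b by simp
        have "norm x \<le> norm (t n *\<^sub>R b + x) + norm (t n *\<^sub>R b)"
          by (metis add_diff_cancel_left' norm_triangle_ineq4)
        then have "t n *\<^sub>R b + x \<notin> K" "x \<notin> K" using False nb R(2) by (auto simp: subset_iff)
        then show ?thesis using 0 B(1) by auto
      qed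
    qed
    show "partial_deriv b h \<in> borel_measurable lborel"
      using cD by (simp add: borel_measurable_continuous_onI)
    show "?q n \<in> borel_measurable lborel" for n
      using ch by (auto intro!: borel_measurable_continuous_onI continuous_intros continuous_on_compose2[OF ch])
  qed
  have ih: "integrable lborel h" by (rule integrable_compact_support[OF ch K 0])
  have mh: "h \<in> borel_measurable borel" using ch by (rule borel_measurable_continuous_onI)
  have q0: "(LINT x|lborel. ?q n x) = 0" for n
  proof -
    have "integrable lborel (\<lambda>x. h (t n *\<^sub>R b + x))"
      using ih mh lborel_distr_plus[of "t n *\<^sub>R b"] integrable_distr_eq[of "(+) (t n *\<^sub>R b)" lborel borel h] by simp
    then show ?thesis using ih lborel_integral_shift[OF mh] by simp
  qed
  have "(\<lambda>n. LINT x|lborel. ?q n x) \<longlonglongrightarrow> 0" by (simp only: q0 tendsto_const)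
  with lim show ?thesis by (rule LIMSEQ_unique)
qed

text \<open>The derivative of \<open>v\<close> times the exponential integrates to 0.\<close>

lemma fourier_partial_deriv:
  fixes v :: "'a::euclidean_space \<Rightarrow> complex"
  assumes v: "Ck 1 UNIV v" and K: "compact K" and 0: "\<And>x. x \<notin> K \<Longrightarrow> v x = 0" and b: "b \<in> Basis"
  shows "fourier (partial_deriv b v) \<xi> = \<i> * of_real (\<xi> \<bullet> b) * fourier v \<xi>"
proof -
  let ?e = "\<lambda>x. exp (- \<i> * complex_of_real (x \<bullet> \<xi>))"
  have Ce: "Ck 1 UNIV ?e" by (intro Ck_intros) auto
  have eq: "partial_deriv b (\<lambda>x. ?e x * v x) x = ?e x * partial_deriv b v x - \<i> * of_real (\<xi> \<bullet> b) * (?e x * v x)" for x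
  proof -
    have "(v has_derivative frechet_derivative v (at x)) (at x)"
      using v by (auto simp: frechet_derivative_works)
    moreover have "(?e has_derivative (\<lambda>h. ?e x * (- \<i> * complex_of_real (h \<bullet> \<xi>)))) (at x)"
    proof -
      have "((\<lambda>x. - \<i> * complex_of_real (x \<bullet> \<xi>)) has_derivative (\<lambda>h. - \<i> * complex_of_real (h \<bullet> \<xi>))) (at x)"
        by (auto intro!: derivative_eq_intros)
      moreover have "(exp has_derivative (*) (exp z)) (at z)" for z :: complex
        using DERIV_exp by (simp add: has_field_derivative_def)
      ultimately show ?thesis by (metis has_derivative_compose)
    qed
    ultimately have "((\<lambda>x. ?e x * v x) has_derivative
       (\<lambda>h. ?e x * frechet_derivative v (at x) h + ?e x * (- \<i> * complex_of_real (h \<bullet> \<xi>)) * v x)) (at x)"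
      by (intro has_derivative_mult)
    then show ?thesis by (simp add: partial_deriv_eq partial_deriv_def[of b v] algebra_simps inner_commute)
  qed
  have cv: "continuous_on UNIV v" "continuous_on UNIV (partial_deriv b v)" "continuous_on UNIV ?e"
    using v b Ck_continuous_on[OF Ce] Ck_continuous_on[OF v] by auto
  have D0: "partial_deriv b v x = 0" if "x \<notin> K" for x
    using partial_deriv_zero_outside[OF compact_imp_closed[OF K] 0 that] .
  have "0 = (LINT x|lborel. partial_deriv b (\<lambda>x. ?e x * v x) x)"
    by (rule integral_partial_deriv_eq_0[symmetric, OF Ck_mult[OF open_UNIV Ce v] K _ b]) (simp add: 0)
  also have "\<dots> = (LINT x|lborel. ?e x * partial_deriv b v x) - (LINT x|lborel. \<i> * of_real (\<xi> \<bullet> b) * (?e x * v x))"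
    unfolding eq
    by (intro Bochner_Integration.integral_diff integrable_compact_support[OF _ K] continuous_intros cv)
      (use 0 D0 in auto)
  finally show ?thesis by (simp add: fourier_def)
qed

lemma integrable_fourier_integrand:
  fixes v :: "'a::euclidean_space \<Rightarrow> complex"
  assumes "integrable lborel v"
  shows "integrable lborel (\<lambda>x. exp (- \<i> * complex_of_real (x \<bullet> \<xi>)) * v x)"
proof -
  have [measurable]: "v \<in> borel_measurable borel" using borel_measurable_integrable[OF assms] by simp
  show ?thesis
  proof (rule Bochner_Integration.integrable_bound[OF assms])
    show "(\<lambda>x. exp (- \<i> * complex_of_real (x \<bullet> \<xi>)) * v x) \<in> borel_measurable lborel"
      by measurable
  qed (simp add: norm_mult)
qed

lemma norm_fourier_le:
  "integrable lborel v \<Longrightarrow> norm (fourier v \<xi>) \<le> (LINT x|lborel. norm (v x))"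
  unfolding fourier_def
  by (rule order.trans[OF integral_norm_bound]) (simp add: norm_mult)

text \<open>Each step of the induction replaces \<open>v\<close> by \<open>v\<close> minus its
  Laplacian, which has the same support properties and whose transform is that of \<open>v\<close>
  times \<open>1 + (norm \<xi>)\<^sup>2\<close>.\<close>

lemma fourier_decay:
  fixes v :: "'a::euclidean_space \<Rightarrow> complex"
  assumes "\<And>k. Ck k UNIV v" and K: "compact K" and "\<And>x. x \<notin> K \<Longrightarrow> v x = 0"
  shows "\<exists>C. \<forall>\<xi>. (1 + (norm \<xi>)\<^sup>2) ^ l * norm (fourier v \<xi>) \<le> C"
  using assms(1,3)
proof (induction l arbitrary: v)
  case 0
  then show ?case using norm_fourier_le integrable_compact_support[OF Ck_continuous_on[OF 0(1)] K]
    by (metis mult_1 power_0)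
next
  case (Suc l)
  let ?w = "\<lambda>x. v x - (\<Sum>b\<in>Basis. partial_deriv b (partial_deriv b v) x)"
  have P1: "Ck k UNIV (partial_deriv b v)" if "b \<in> Basis" for b k
    using Suc.prems(1)[of "Suc k"] that by simp
  have P2: "Ck k UNIV (partial_deriv b (partial_deriv b v))" if "b \<in> Basis" for b k
    using P1[of b "Suc k"] that by simp
  have D1: "partial_deriv b v x = 0" if "x \<notin> K" for x b
    using partial_deriv_zero_outside[OF compact_imp_closed[OF K] Suc.prems(2) that] .
  have D2: "partial_deriv b (partial_deriv b v) x = 0" if "x \<notin> K" for x b
    using partial_deriv_zero_outside[OF compact_imp_closed[OF K] D1 that] .
  have iv: "integrable lborel v" by (rule integrable_compact_support[OF Ck_continuous_on[OF Suc.prems(1)] K Suc.prems(2)])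
  have i2: "integrable lborel (partial_deriv b (partial_deriv b v))" if "b \<in> Basis" for b
    by (rule integrable_compact_support[OF Ck_continuous_on[OF P2[OF that]] K D2])
  have "fourier ?w \<xi> = of_real (1 + (norm \<xi>)\<^sup>2) * fourier v \<xi>" for \<xi>
  proof -
    have "fourier ?w \<xi> = fourier v \<xi> - (\<Sum>b\<in>Basis. fourier (partial_deriv b (partial_deriv b v)) \<xi>)"
      unfolding fourier_def right_diff_distrib sum_distrib_left
      using integrable_fourier_integrand[OF iv, of \<xi>] integrable_fourier_integrand[OF i2, of _ \<xi>]
      by (subst Bochner_Integration.integral_diff) (auto simp: Bochner_Integration.integral_sum)
    also have "(\<Sum>b\<in>Basis. fourier (partial_deriv b (partial_deriv b v)) \<xi>) =
        (\<Sum>b\<in>Basis. - of_real ((\<xi> \<bullet> b) * (\<xi> \<bullet> b)) * fourier v \<xi>)"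
    proof (rule sum.cong)
      fix b :: 'a assume b: "b \<in> Basis"
      have "fourier (partial_deriv b (partial_deriv b v)) \<xi> = \<i> * of_real (\<xi> \<bullet> b) * fourier (partial_deriv b v) \<xi>"
        by (rule fourier_partial_deriv[OF P1[OF b] K D1 b])
      also have "fourier (partial_deriv b v) \<xi> = \<i> * of_real (\<xi> \<bullet> b) * fourier v \<xi>"
        by (rule fourier_partial_deriv[OF Suc.prems(1) K Suc.prems(2) b])
      also have "\<i> * of_real (\<xi> \<bullet> b) * (\<i> * of_real (\<xi> \<bullet> b) * fourier v \<xi>)
          = (\<i> * \<i>) * (of_real (\<xi> \<bullet> b) * of_real (\<xi> \<bullet> b)) * fourier v \<xi>"
        by (simp only: mult_ac)
      finally show "fourier (partial_deriv b (partial_deriv b v)) \<xi> = - of_real ((\<xi> \<bullet> b) * (\<xi> \<bullet> b)) * fourier v \<xi>"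
        by simp
    qed simp
    also have "\<dots> = - of_real ((norm \<xi>)\<^sup>2) * fourier v \<xi>"
      by (simp add: power2_norm_eq_inner euclidean_inner[of \<xi> \<xi>] sum_negf flip: sum_distrib_right)
    finally show ?thesis by (simp add: algebra_simps)
  qed
  moreover have "\<exists>C. \<forall>\<xi>. (1 + (norm \<xi>)\<^sup>2) ^ l * norm (fourier ?w \<xi>) \<le> C"
  proof (rule Suc.IH)
    show "Ck k UNIV ?w" for k by (intro Ck_intros open_UNIV Suc.prems P2)
    show "?w x = 0" if "x \<notin> K" for x using Suc.prems(2)[OF that] D2[OF that] by simp
  qed
  then obtain C where "\<And>\<xi>. (1 + (norm \<xi>)\<^sup>2) ^ l * norm (fourier ?w \<xi>) \<le> C"
    by blast
  moreover have "norm (complex_of_real (1 + (norm \<xi>)\<^sup>2)) = 1 + (norm \<xi>)\<^sup>2" for \<xi> :: 'a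
    by (simp only: norm_of_real) simp
  ultimately have "(1 + (norm \<xi>)\<^sup>2) ^ l * ((1 + (norm \<xi>)\<^sup>2) * norm (fourier v \<xi>)) \<le> C" for \<xi>
    by (metis norm_mult)
  then show ?case by (auto simp: mult_ac intro!: exI[of _ C])
qed

section \<open>Products over coordinates and Fubini\<close>

interpretation lborel_Basis: product_sigma_finite "\<lambda>_::'a::euclidean_space. lborel :: real measure"
  by standard

lemma
  fixes f :: "'a::euclidean_space \<Rightarrow> real \<Rightarrow> 'b::{real_normed_field, banach, second_countable_topology}"
  assumes "\<And>b. b \<in> Basis \<Longrightarrow> integrable lborel (f b)"
  shows integrable_prod_Basis: "integrable lborel (\<lambda>x. \<Prod>b\<in>Basis. f b (x \<bullet> b))"
    and integral_prod_Basis: "(LINT x|lborel. (\<Prod>b\<in>Basis. f b (x \<bullet> b))) = (\<Prod>b\<in>Basis. LINT s|lborel. f b s)"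
proof -
  have fm: "f b \<in> borel_measurable borel" if "b \<in> Basis" for b
    using borel_measurable_integrable[OF assms[OF that]] by simp
  have T: "(\<lambda>g. \<Sum>b\<in>Basis. g b *\<^sub>R b) \<in> measurable (\<Pi>\<^sub>M b\<in>(Basis::'a set). lborel) borel"
    by measurable
  have F: "(\<lambda>x. \<Prod>b\<in>Basis. f b (x \<bullet> b)) \<in> borel_measurable borel"
    by (rule borel_measurable_prod) (rule measurable_compose[OF _ fm], auto)
  have eq: "(\<Prod>b\<in>Basis. f b ((\<Sum>c\<in>Basis. g c *\<^sub>R c) \<bullet> b)) = (\<Prod>b\<in>Basis. f b (g b))" for g :: "'a \<Rightarrow> real"
    by (rule prod.cong) simp_all
  show "integrable lborel (\<lambda>x. \<Prod>b\<in>Basis. f b (x \<bullet> b))"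
    apply (subst lborel_eq[where 'a='a])
    apply (subst integrable_distr_eq[OF T F])
    apply (subst eq)
    apply (rule lborel_Basis.product_integrable_prod)
    using assms by auto
  show "(LINT x|lborel. (\<Prod>b\<in>Basis. f b (x \<bullet> b))) = (\<Prod>b\<in>Basis. LINT s|lborel. f b s)"
    apply (subst lborel_eq[where 'a='a])
    apply (subst integral_distr[OF T F])
    apply (subst eq)
    apply (rule lborel_Basis.product_integral_prod)
    using assms by auto
qed

text \<open>Each of the \<open>DIM('a)\<close> factors \<open>1 + (norm x)\<^sup>2\<close> dominates
  one factor \<open>1 + (x \<bullet> b)\<^sup>2\<close>, and the reciprocals of the latter are
  integrable on the line. This weight makes the later integrals over frequencies converge.\<close>

lemma integrable_inverse_power_norm:
  "integrable lborel (\<lambda>\<xi>::'a::euclidean_space. inverse ((1 + (norm \<xi>)\<^sup>2) ^ DIM('a)))"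
proof (rule Bochner_Integration.integrable_bound)
  have "integrable lborel (\<lambda>x::real. inverse (1 + x^2))"
    using integrable_inverse_1_plus_square by (simp add: set_integrable_def)
  then show "integrable lborel (\<lambda>x::'a. \<Prod>b\<in>Basis. inverse (1 + (x \<bullet> b)\<^sup>2))"
    by (intro integrable_prod_Basis)
  show "AE x in lborel. norm (inverse ((1 + (norm (x::'a))\<^sup>2) ^ DIM('a)))
      \<le> norm (\<Prod>b\<in>Basis. inverse (1 + (x \<bullet> b)\<^sup>2))"
  proof (rule AE_I2)
    fix x :: 'a
    have pos: "0 < (\<Prod>b\<in>Basis. 1 + (x \<bullet> b)\<^sup>2)"
      by (intro prod_pos ballI) (smt (verit) zero_le_power2)
    have "(\<Prod>b\<in>Basis. 1 + (x \<bullet> b)\<^sup>2) \<le> (\<Prod>b\<in>(Basis::'a set). 1 + (norm x)\<^sup>2)"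
    proof (intro prod_mono conjI)
      fix b :: 'a assume "b \<in> Basis"
      then have "(x \<bullet> b)\<^sup>2 \<le> (norm x)\<^sup>2"
        using Basis_le_norm[of b x] by (metis abs_norm_cancel abs_le_square_iff)
      then show "1 + (x \<bullet> b)\<^sup>2 \<le> 1 + (norm x)\<^sup>2" by simp
    qed simp
    also have "\<dots> = (1 + (norm x)\<^sup>2) ^ DIM('a)" by simp
    finally have "inverse ((1 + (norm x)\<^sup>2) ^ DIM('a)) \<le> inverse (\<Prod>b\<in>Basis. 1 + (x \<bullet> b)\<^sup>2)"
      using pos by (rule le_imp_inverse_le)
    then show "norm (inverse ((1 + (norm x)\<^sup>2) ^ DIM('a))) \<le> norm (\<Prod>b\<in>Basis. inverse (1 + (x \<bullet> b)\<^sup>2))"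
      using pos by (simp add: prod_inversef[unfolded o_def])
  qed
qed measurable

text \<open>A bounded kernel adds no integrability of its own, so \<open>f x * g y\<close> is the
  majorant. In both uses the kernel is an exponential of modulus 1.\<close>

lemma Fubini_bounded_kernel:
  fixes f :: "'a::euclidean_space \<Rightarrow> complex" and g :: "'b::euclidean_space \<Rightarrow> complex"
  assumes f: "integrable lborel f" and g: "integrable lborel g"
    and k[measurable]: "k \<in> borel_measurable (borel \<Otimes>\<^sub>M borel)" and k1: "\<And>x y. norm (k (x, y)) \<le> 1"
  shows "(LINT x|lborel. f x * (LINT y|lborel. g y * k (x, y))) = (LINT y|lborel. g y * (LINT x|lborel. f x * k (x, y)))"
proof -
  have [measurable]: "f \<in> borel_measurable borel" "g \<in> borel_measurable borel"
    using f g by (auto dest: borel_measurable_integrable)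
  have "integrable (lborel \<Otimes>\<^sub>M lborel) (\<lambda>(x, y). f x * g y)"
  proof (rule lborel_pair.Fubini_integrable)
    show "integrable lborel (\<lambda>x. LINT y|lborel. norm (case (x, y) of (x, y) \<Rightarrow> f x * g y))"
      using f by (simp add: norm_mult)
    show "AE x in lborel. integrable lborel (\<lambda>y. case (x, y) of (x, y) \<Rightarrow> f x * g y)"
      using g by simp
  qed measurable
  then have I: "integrable (lborel \<Otimes>\<^sub>M lborel) (\<lambda>(x, y). f x * g y * k (x, y))"
  proof (rule Bochner_Integration.integrable_bound)
    show "AE p in lborel \<Otimes>\<^sub>M lborel. norm (case p of (x, y) \<Rightarrow> f x * g y * k (x, y))
        \<le> norm (case p of (x, y) \<Rightarrow> f x * g y)"
      using mult_left_mono[OF k1, of "norm (f _) * norm (g _)"]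
      by (intro AE_I2) (auto simp: norm_mult split: prod.split)
  qed measurable
  have "(LINT x|lborel. f x * (LINT y|lborel. g y * k (x, y))) = (LINT x|lborel. LINT y|lborel. f x * g y * k (x, y))"
    by (simp add: mult.assoc)
  also have "\<dots> = (LINT y|lborel. LINT x|lborel. f x * g y * k (x, y))"
    by (rule lborel_pair.Fubini_integral[OF I, symmetric])
  also have "\<dots> = (LINT y|lborel. LINT x|lborel. g y * (f x * k (x, y)))"
    by (intro Bochner_Integration.integral_cong refl) (simp add: mult_ac)
  also have "\<dots> = (LINT y|lborel. g y * (LINT x|lborel. f x * k (x, y)))"
    by simp
  finally show ?thesis .
qed

section \<open>Gaussians and Fourier inversion\<close>

definition gauss :: "'a::euclidean_space \<Rightarrow> complex" where
  "gauss x = (\<Prod>b\<in>Basis. complex_of_real (std_normal_density (x \<bullet> b)))"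

lemma integrable_gauss: "integrable lborel (gauss :: 'a::euclidean_space \<Rightarrow> complex)"
  unfolding gauss_def[abs_def] by (rule integrable_prod_Basis) simp

lemma norm_gauss_le: "norm (gauss x) \<le> 1"
proof -
  have "std_normal_density s \<le> 1" for s
  proof -
    have "1 / sqrt (2 * pi) \<le> 1" using pi_gt3 by simp
    moreover have "exp (- s\<^sup>2 / 2) \<le> 1" by simp
    ultimately show ?thesis unfolding std_normal_density_def by (intro mult_le_one) auto
  qed
  then show ?thesis unfolding gauss_def
    by (auto simp: norm_mult prod_norm[symmetric] normal_density_nonneg intro!: prod_le_1)
qed

lemma continuous_gauss: "continuous_on UNIV gauss"
  unfolding gauss_def std_normal_density_def by (intro continuous_intros) auto

lemma gauss_0: "gauss (0 :: 'a::euclidean_space) \<noteq> 0"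
  unfolding gauss_def std_normal_density_def by simp

text \<open>Since \<open>gauss\<close> is a product over coordinates, this reduces to the
  characteristic function of the standard normal distribution, taken at \<open>- t\<close> because
  of the sign in \<open>fourier\<close>.\<close>

lemma fourier_gauss:
  "fourier gauss (z :: 'a::euclidean_space) = of_real (sqrt (2 * pi)) ^ DIM('a) * gauss z"
proof -
  have 1: "(LINT s|lborel. exp (- \<i> * of_real (s * t)) * complex_of_real (std_normal_density s)) = of_real (sqrt (2 * pi)) * complex_of_real (std_normal_density t)" for t
  proof -
    have "(LINT s|lborel. exp (- \<i> * of_real (s * t)) * complex_of_real (std_normal_density s)) = char std_normal_distribution (- t)"
      unfolding char_def
      by (subst integral_density)
       (auto simp: normal_density_nonneg scaleR_conv_of_real mult_ac)
    also have "\<dots> = of_real (sqrt (2 * pi)) * complex_of_real (std_normal_density t)"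
    proof -
      have "exp (- (t^2) / 2) = sqrt (2 * pi) * std_normal_density t"
        by (simp add: std_normal_density_def)
      then show ?thesis
        unfolding char_std_normal_distribution by (metis of_real_mult power2_minus)
    qed
    finally show ?thesis .
  qed
  have "fourier gauss z = (LINT x|lborel. (\<Prod>b\<in>Basis. (\<lambda>s. exp (- \<i> * of_real (s * (z \<bullet> b))) * complex_of_real (std_normal_density s)) (x \<bullet> b)))"
    unfolding fourier_def gauss_def
    by (rule Bochner_Integration.integral_cong)
      (simp_all add: prod.distrib euclidean_inner[of _ z] sum_distrib_left exp_sum flip: sum_negf)
  also have "\<dots> = (\<Prod>b\<in>Basis. LINT s|lborel. exp (- \<i> * of_real (s * (z \<bullet> b))) * complex_of_real (std_normal_density s))"
  proof (rule integral_prod_Basis)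
    show "integrable lborel (\<lambda>s. exp (- \<i> * of_real (s * (z \<bullet> b))) * complex_of_real (std_normal_density s))" for b
      by (rule Bochner_Integration.integrable_bound[of _ "std_normal_density"]) (auto simp: norm_mult)
  qed
  also have "\<dots> = of_real (sqrt (2 * pi)) ^ DIM('a) * gauss z"
    unfolding 1 by (simp add: prod.distrib gauss_def)
  finally show ?thesis .
qed

lemma continuous_fourier:
  assumes "integrable lborel v"
  shows "continuous_on UNIV (fourier v)"
proof -
  have [measurable]: "v \<in> borel_measurable borel" using assms by (auto dest: borel_measurable_integrable)
  have "(\<lambda>n. fourier v (s n)) \<longlonglongrightarrow> fourier v a" if "s \<longlonglongrightarrow> a" for s a
    unfolding fourier_def
  proof (rule integral_dominated_convergence[where w="\<lambda>x. norm (v x)"])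
    show "AE x in lborel. (\<lambda>n. exp (- \<i> * complex_of_real (x \<bullet> s n)) * v x)
        \<longlonglongrightarrow> exp (- \<i> * complex_of_real (x \<bullet> a)) * v x"
      by (intro AE_I2 tendsto_intros that)
  qed (use assms in \<open>auto simp: norm_mult\<close>)
  then show ?thesis
    by (auto simp: continuous_on_sequentially o_def)
qed

lemma integrable_fourier:
  fixes v :: "'a::euclidean_space \<Rightarrow> complex"
  assumes v: "\<And>k. Ck k UNIV v" and K: "compact K" and 0: "\<And>x. x \<notin> K \<Longrightarrow> v x = 0"
  shows "integrable lborel (fourier v)"
proof -
  have iv: "integrable lborel v" by (rule integrable_compact_support[OF Ck_continuous_on[OF v] K 0])
  obtain C where C: "(1 + (norm \<xi>)\<^sup>2) ^ DIM('a) * norm (fourier v \<xi>) \<le> C" for \<xi>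
    using fourier_decay[OF v K 0, of "DIM('a)"] by blast
  show ?thesis
  proof (rule Bochner_Integration.integrable_bound)
    show "integrable lborel (\<lambda>\<xi>::'a. C * inverse ((1 + (norm \<xi>)\<^sup>2) ^ DIM('a)))"
      using integrable_inverse_power_norm[where 'a='a] by simp
    show "fourier v \<in> borel_measurable lborel"
      using continuous_fourier[OF iv] by (simp add: borel_measurable_continuous_onI)
    show "AE \<xi> in lborel. norm (fourier v \<xi>) \<le> norm (C * inverse ((1 + (norm \<xi>)\<^sup>2) ^ DIM('a)))"
    proof (rule AE_I2)
      fix \<xi> :: 'a
      have "0 < (1 + (norm \<xi>)\<^sup>2) ^ DIM('a)" by (intro zero_less_power) (smt (verit) zero_le_power2)
      then have "norm (fourier v \<xi>) \<le> C * inverse ((1 + (norm \<xi>)\<^sup>2) ^ DIM('a))"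
        using C[of \<xi>] by (simp add: field_simps)
      then show "norm (fourier v \<xi>) \<le> norm (C * inverse ((1 + (norm \<xi>)\<^sup>2) ^ DIM('a)))"
        by (metis abs_ge_self order.trans real_norm_def)
    qed
  qed
qed

lemma fourier_inversion:
  fixes v :: "'a::euclidean_space \<Rightarrow> complex"
  assumes v: "\<And>k. Ck k UNIV v" and K: "compact K" and 0: "\<And>x. x \<notin> K \<Longrightarrow> v x = 0"
  shows "(LINT \<eta>|lborel. fourier v \<eta> * exp (\<i> * of_real (y \<bullet> \<eta>))) = of_real (2 * pi) ^ DIM('a) * v y"
proof -
  let ?C = "complex_of_real (sqrt (2 * pi)) ^ DIM('a)"
  have cv: "continuous_on UNIV v" by (rule Ck_continuous_on[OF v])
  have iv: "integrable lborel v" by (rule integrable_compact_support[OF cv K 0])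
  have ifv: "integrable lborel (fourier v)" by (rule integrable_fourier[OF v K 0])
  have [measurable]: "fourier v \<in> borel_measurable borel" "v \<in> borel_measurable borel"
    "(gauss :: 'a \<Rightarrow> complex) \<in> borel_measurable borel"
    using ifv iv integrable_gauss by (auto dest: borel_measurable_integrable)
  define t where "t n = 1 / real (Suc n)" for n
  have t: "t n > 0" "t n \<le> 1" for n by (auto simp: t_def)
  have tlim: "t \<longlonglongrightarrow> 0" unfolding t_def by (rule LIMSEQ_Suc[OF lim_1_over_n])
  have glim: "(\<lambda>n. gauss (t n *\<^sub>R \<eta>)) \<longlonglongrightarrow> gauss (0::'a)" for \<eta> :: 'a
  proof (rule isCont_tendsto_compose[where g=gauss])
    show "isCont gauss (0::'a)" using continuous_gauss[where 'a='a] by (simp add: continuous_on_eq_continuous_at)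
    show "(\<lambda>n. t n *\<^sub>R \<eta>) \<longlonglongrightarrow> 0" using tendsto_scaleR[OF tlim tendsto_const[of \<eta>]] by simp
  qed
  \<comment> \<open>Gaussian regularisation: with \<open>gauss (t n *\<^sub>R \<eta>)\<close> as a factor the integrals can be exchanged
    (E below), and both sides converge as \<open>t n \<rightarrow> 0\<close>.\<close>
  have L1: "(\<lambda>n. LINT \<eta>|lborel. fourier v \<eta> * exp (\<i> * of_real (y \<bullet> \<eta>)) * gauss (t n *\<^sub>R \<eta>))
      \<longlonglongrightarrow> (LINT \<eta>|lborel. fourier v \<eta> * exp (\<i> * of_real (y \<bullet> \<eta>)) * gauss (0::'a))"
  proof (rule integral_dominated_convergence[where w="\<lambda>x. norm (fourier v x)"])
    show "AE \<eta> in lborel. norm (fourier v \<eta> * exp (\<i> * of_real (y \<bullet> \<eta>)) * gauss (t n *\<^sub>R \<eta>)) \<le> norm (fourier v \<eta>)" for n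
      by (intro AE_I2) (simp add: norm_mult mult_left_le norm_gauss_le)
    show "AE \<eta> in lborel. (\<lambda>n. fourier v \<eta> * exp (\<i> * of_real (y \<bullet> \<eta>)) * gauss (t n *\<^sub>R \<eta>))
        \<longlonglongrightarrow> fourier v \<eta> * exp (\<i> * of_real (y \<bullet> \<eta>)) * gauss (0::'a)"
      by (intro AE_I2 tendsto_intros glim)
  qed (use ifv in auto)
  have E: "(LINT \<eta>|lborel. fourier v \<eta> * exp (\<i> * of_real (y \<bullet> \<eta>)) * gauss (s *\<^sub>R \<eta>))
      = ?C * (LINT z|lborel. v (y + s *\<^sub>R z) * gauss z)" if s: "s > 0" for s
  proof -
    have ig: "integrable lborel (\<lambda>\<eta>::'a. gauss (s *\<^sub>R \<eta>))"
    proof -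
      have "integrable (density (distr lborel borel (\<lambda>x. 0 + s *\<^sub>R x)) (\<lambda>_. ennreal (\<bar>s\<bar> ^ DIM('a)))) (gauss :: 'a \<Rightarrow> complex)"
        using integrable_gauss[where 'a='a] s lborel_affine[of s "0::'a"] by (simp add: ennreal_power)
      then have "integrable lborel (\<lambda>x::'a. s ^ DIM('a) *\<^sub>R (gauss (s *\<^sub>R x) :: complex))"
        using s by (simp add: integrable_density integrable_distr_eq)
      then have "integrable lborel (\<lambda>x::'a. inverse (s ^ DIM('a)) *\<^sub>R (s ^ DIM('a) *\<^sub>R (gauss (s *\<^sub>R x) :: complex)))"
        by (rule integrable_scaleR_right)
      then show ?thesis using s by simp
    qed
    have "(LINT \<eta>|lborel. fourier v \<eta> * exp (\<i> * of_real (y \<bullet> \<eta>)) * gauss (s *\<^sub>R \<eta>))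
      = (LINT \<eta>|lborel. gauss (s *\<^sub>R \<eta>) * (LINT x|lborel. v x * exp (\<i> * of_real ((y - x) \<bullet> \<eta>))))"
    proof (rule Bochner_Integration.integral_cong)
      fix \<eta> :: 'a
      have "fourier v \<eta> * exp (\<i> * of_real (y \<bullet> \<eta>)) = (LINT x|lborel. v x * exp (\<i> * of_real ((y - x) \<bullet> \<eta>)))"
      proof -
        have "fourier v \<eta> * exp (\<i> * of_real (y \<bullet> \<eta>)) = (LINT x|lborel. exp (- \<i> * complex_of_real (x \<bullet> \<eta>)) * v x * exp (\<i> * of_real (y \<bullet> \<eta>)))"
          unfolding fourier_def by simp
        also have "\<dots> = (LINT x|lborel. v x * exp (\<i> * of_real ((y - x) \<bullet> \<eta>)))"
          by (rule Bochner_Integration.integral_cong)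
            (simp_all add: inner_diff_left right_diff_distrib exp_diff exp_minus field_simps)
        finally show ?thesis .
      qed
      then show "fourier v \<eta> * exp (\<i> * of_real (y \<bullet> \<eta>)) * gauss (s *\<^sub>R \<eta>)
        = gauss (s *\<^sub>R \<eta>) * (LINT x|lborel. v x * exp (\<i> * of_real ((y - x) \<bullet> \<eta>)))"
        by (simp add: mult.commute)
    qed simp
    also have "\<dots> = (LINT x|lborel. v x * (LINT \<eta>|lborel. gauss (s *\<^sub>R \<eta>) * exp (\<i> * of_real ((y - x) \<bullet> \<eta>))))"
      using Fubini_bounded_kernel[OF ig iv, of "\<lambda>(\<eta>, x). exp (\<i> * of_real ((y - x) \<bullet> \<eta>))"] by simp
    also have "\<dots> = (LINT x|lborel. v x * (?C * gauss ((1 / s) *\<^sub>R (x - y)) / of_real s ^ DIM('a)))"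
    proof (rule Bochner_Integration.integral_cong)
      fix x :: 'a
      have "?C * gauss ((1 / s) *\<^sub>R (x - y)) = (LINT \<zeta>|lborel. exp (\<i> * of_real (((1 / s) *\<^sub>R (y - x)) \<bullet> \<zeta>)) * gauss \<zeta>)"
        unfolding fourier_gauss[symmetric] fourier_def
        by (simp add: inner_diff_right inner_diff_left inner_commute diff_divide_distrib algebra_simps)
      also have "\<dots> = of_real s ^ DIM('a) * (LINT \<eta>|lborel. gauss (s *\<^sub>R \<eta>) * exp (\<i> * of_real ((y - x) \<bullet> \<eta>)))"
      proof -
        have "(LINT \<zeta>|lborel. exp (\<i> * of_real (((1 / s) *\<^sub>R (y - x)) \<bullet> \<zeta>)) * gauss \<zeta>)
          = s ^ DIM('a) *\<^sub>R (LINT \<eta>|lborel. exp (\<i> * of_real (((1 / s) *\<^sub>R (y - x)) \<bullet> (0 + s *\<^sub>R \<eta>))) * gauss (0 + s *\<^sub>R \<eta>))"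
          by (rule lborel_integral_affine[OF _ s]) measurable
        also have "\<dots> = of_real s ^ DIM('a) * (LINT \<eta>|lborel. gauss (s *\<^sub>R \<eta>) * exp (\<i> * of_real ((y - x) \<bullet> \<eta>)))"
          using s by (simp add: scaleR_conv_of_real mult.commute)
        finally show ?thesis .
      qed
      finally show "v x * (LINT \<eta>|lborel. gauss (s *\<^sub>R \<eta>) * exp (\<i> * of_real ((y - x) \<bullet> \<eta>)))
          = v x * (?C * gauss ((1 / s) *\<^sub>R (x - y)) / of_real s ^ DIM('a))" using s by simp
    qed simp
    \<comment> \<open>Substitution \<open>x = y + s *\<^sub>R z\<close>: the Gaussian of width
      \<open>s\<close> becomes a fixed one, and \<open>v\<close> is evaluated close to
      \<open>y\<close>.\<close>
    also have "\<dots> = ?C * (LINT z|lborel. v (y + s *\<^sub>R z) * gauss z)"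
    proof -
      have "(LINT x|lborel. v x * (?C * gauss ((1 / s) *\<^sub>R (x - y)) / of_real s ^ DIM('a)))
        = s ^ DIM('a) *\<^sub>R (LINT z|lborel. v (y + s *\<^sub>R z) * (?C * gauss ((1 / s) *\<^sub>R ((y + s *\<^sub>R z) - y)) / of_real s ^ DIM('a)))"
        by (rule lborel_integral_affine[OF _ s]) measurable
      also have "\<dots> = s ^ DIM('a) *\<^sub>R (LINT z|lborel. (?C / of_real s ^ DIM('a)) * (v (y + s *\<^sub>R z) * gauss z))"
        using s by (simp add: mult_ac)
      also have "\<dots> = ?C * (LINT z|lborel. v (y + s *\<^sub>R z) * gauss z)"
        using s by (simp only: integral_mult_right_zero) (simp add: scaleR_conv_of_real)
      finally show ?thesis .
    qed
    finally show ?thesis .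
  qed
  obtain B where B: "\<And>x. norm (v x) \<le> B" using bounded_compact_support[OF cv K 0] by blast
  have L2: "(\<lambda>n. LINT z|lborel. v (y + t n *\<^sub>R z) * gauss z) \<longlonglongrightarrow> (LINT z|lborel. v y * gauss (z::'a))"
  proof (rule integral_dominated_convergence[where w="\<lambda>z. B * norm (gauss z)"])
    show "AE z in lborel. norm (v (y + t n *\<^sub>R z) * gauss z) \<le> B * norm (gauss z)" for n
      using mult_right_mono[OF B] by (intro AE_I2) (auto simp: norm_mult)
    show "AE z in lborel. (\<lambda>n. v (y + t n *\<^sub>R z) * gauss z) \<longlonglongrightarrow> v y * gauss z"
    proof (rule AE_I2)
      fix z
      have "(\<lambda>n. v (y + t n *\<^sub>R z)) \<longlonglongrightarrow> v y"
      proof (rule isCont_tendsto_compose[where g=v])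
        show "isCont v y" using cv by (simp add: continuous_on_eq_continuous_at)
        show "(\<lambda>n. y + t n *\<^sub>R z) \<longlonglongrightarrow> y"
          using tendsto_add[OF tendsto_const[of y] tendsto_scaleR[OF tlim tendsto_const[of z]]] by simp
      qed
      then show "(\<lambda>n. v (y + t n *\<^sub>R z) * gauss z) \<longlonglongrightarrow> v y * gauss z" by (intro tendsto_intros)
    qed
  qed (use integrable_gauss[where 'a='a] in auto)
  \<comment> \<open>The factor \<open>gauss 0\<close> arises on both sides, from the limit of the
    regulariser and from the total mass of \<open>gauss\<close>, and cancels at the end.\<close>
  have g0: "(LINT z|lborel. gauss (z::'a)) = ?C * gauss (0::'a)"
    using fourier_gauss[of "0::'a"] by (simp add: fourier_def)
  have "(LINT \<eta>|lborel. fourier v \<eta> * exp (\<i> * of_real (y \<bullet> \<eta>)) * gauss (0::'a)) = ?C * (LINT z|lborel. v y * gauss (z::'a))"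
  proof (rule LIMSEQ_unique[OF L1])
    show "(\<lambda>n. LINT \<eta>|lborel. fourier v \<eta> * exp (\<i> * of_real (y \<bullet> \<eta>)) * gauss (t n *\<^sub>R \<eta>))
        \<longlonglongrightarrow> ?C * (LINT z|lborel. v y * gauss (z::'a))"
      unfolding E[OF t(1)] by (rule tendsto_mult_left[OF L2])
  qed
  then have "(LINT \<eta>|lborel. fourier v \<eta> * exp (\<i> * of_real (y \<bullet> \<eta>))) * gauss (0::'a) = ?C * ?C * v y * gauss (0::'a)"
    by (simp add: g0 mult_ac)
  moreover have "?C * ?C = of_real (2 * pi) ^ DIM('a)"
    by (simp flip: power_mult_distrib of_real_mult)
  ultimately show ?thesis using gauss_0[where 'a='a] by (metis mult_right_cancel)
qed

section \<open>Oscillatory integrals\<close>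

lemma Ck_compose_slice:
  assumes "open W" "Ck k W f"
  shows "Ck k {x. (\<omega>, x) \<in> W} (\<lambda>x. f (\<omega>, x))"
proof (rule Ck_compose[OF _ \<open>open W\<close> _ \<open>Ck k W f\<close>])
  show o: "open {x. (\<omega>, x) \<in> W}"
    using open_vimage[OF \<open>open W\<close>, of "\<lambda>x. (\<omega>, x)"] by (simp add: vimage_def continuous_intros)
  show "Ck k {x. (\<omega>, x) \<in> W} (\<lambda>x. (\<omega>, x))" by (intro Ck_intros o)
qed simp

lemma partial_deriv_slice:
  assumes "f differentiable at (\<omega>, x)"
  shows "partial_deriv b (\<lambda>x. f (\<omega>, x)) x = partial_deriv (0, b) f (\<omega>, x)"
proof -
  have "((\<lambda>x. (\<omega>, x)) has_derivative (\<lambda>h. (0, h))) (at x)"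
    by (auto intro!: derivative_eq_intros)
  moreover have "(f has_derivative frechet_derivative f (at (\<omega>, x))) (at (\<omega>, x))"
    using assms frechet_derivative_works by blast
  ultimately have "((\<lambda>x. f (\<omega>, x)) has_derivative (\<lambda>h. frechet_derivative f (at (\<omega>, x)) (0, h))) (at x)"
    by (rule has_derivative_compose)
  then show ?thesis by (simp add: partial_deriv_eq partial_deriv_def[of "(0, b)"])
qed

lemma partial_deriv_mult:
  fixes f g :: "'a::euclidean_space \<Rightarrow> 'b::real_normed_algebra"
  assumes "f differentiable at x" "g differentiable at x"
  shows "partial_deriv b (\<lambda>x. f x * g x) x = f x * partial_deriv b g x + partial_deriv b f x * g x"
  using partial_deriv_eq[OF has_derivative_mult[OF assms[unfolded frechet_derivative_works]]]
  by (simp add: partial_deriv_def)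

lemma partial_deriv_expi:
  assumes "\<psi> differentiable at x"
  shows "partial_deriv b (\<lambda>x. exp (\<i> * complex_of_real (\<psi> x))) x
    = \<i> * of_real (partial_deriv b \<psi> x) * exp (\<i> * complex_of_real (\<psi> x))"
proof -
  have "(\<psi> has_derivative frechet_derivative \<psi> (at x)) (at x)"
    using assms frechet_derivative_works by blast
  then have "((\<lambda>x. \<i> * complex_of_real (\<psi> x)) has_derivative (\<lambda>h. \<i> * complex_of_real (frechet_derivative \<psi> (at x) h))) (at x)"
    by (auto intro!: derivative_eq_intros)
  moreover have "(exp has_derivative (*) (exp z)) (at z)" for z :: complex
    using DERIV_exp by (simp add: has_field_derivative_def)
  ultimately have "((\<lambda>x. exp (\<i> * complex_of_real (\<psi> x))) has_derivative
    (\<lambda>h. exp (\<i> * complex_of_real (\<psi> x)) * (\<i> * complex_of_real (frechet_derivative \<psi> (at x) h)))) (at x)"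
    by (rule has_derivative_compose)
  then show ?thesis by (simp add: partial_deriv_eq partial_deriv_def[of b \<psi>] mult_ac)
qed

text \<open>Extension by zero: \<open>S\<close> carries a formula for \<open>f\<close>, and
  \<open>T\<close> is the complement of a set outside which \<open>f\<close> vanishes.\<close>

lemma Ck_Un_zero:
  assumes "open S" "open T" "Ck k S f" "\<And>x. x \<in> T \<Longrightarrow> f x = 0"
  shows "Ck k (S \<union> T) f"
proof (rule Ck_Un[OF assms(1,2,3)])
  show "Ck k T f" using Ck_cong[OF \<open>open T\<close>, of f "\<lambda>_. 0" k] Ck_const[OF \<open>open T\<close>] assms(4) by simp
qed

text \<open>\<open>e\<close> stands for an exponential of arbitrary frequency, so the constant may
  depend only on the supremum of \<open>f\<close> over \<open>Z \<times> K\<close> and on the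
  measure of \<open>K\<close>.\<close>

lemma oscillatory_integral_bound:
  fixes f :: "'p::euclidean_space \<times> 'a::euclidean_space \<Rightarrow> complex"
  assumes W: "open W" "Z \<times> UNIV \<subseteq> W" and Z: "compact Z" and K: "compact K"
    and f: "Ck 0 W f" and f0: "\<And>\<omega> x. x \<notin> K \<Longrightarrow> f (\<omega>, x) = 0"
  shows "\<exists>C. \<forall>\<omega>\<in>Z. \<forall>e. (\<forall>x. norm (e x) \<le> 1) \<longrightarrow> norm (LINT x|lborel. e x * f (\<omega>, x)) \<le> C"
proof -
  have "continuous_on (Z \<times> K) f" using f W by (auto intro: continuous_on_subset)
  then have "bounded (f ` (Z \<times> K))"
    using Z K by (intro compact_imp_bounded compact_continuous_image compact_Times)
  then obtain B where B: "B > 0" "\<forall>p\<in>Z \<times> K. norm (f p) \<le> B" by (auto simp: bounded_pos)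
  have ind: "integrable lborel (\<lambda>x. B * indicator K x)"
    using borel_integrable_compact[OF K, of "\<lambda>_. B"] by (simp add: mult.commute)
  have "norm (LINT x|lborel. e x * f (\<omega>, x)) \<le> (LINT x|lborel. B * indicator K x)"
    if "\<omega> \<in> Z" "\<forall>x. norm (e x) \<le> 1" for \<omega> e
  proof (rule order.trans[OF integral_norm_bound integral_mono'[OF ind]])
    fix x
    show "0 \<le> B * indicat_real K x" using B by simp
    have "norm (e x * f (\<omega>, x)) \<le> 1 * norm (f (\<omega>, x))"
      unfolding norm_mult using that by (intro mult_right_mono) auto
    also have "\<dots> \<le> B * indicator K x" using B that f0[of x \<omega>] by (cases "x \<in> K") auto
    finally show "norm (e x * f (\<omega>, x)) \<le> B * indicator K x" .
  qed
  then show ?thesis by blast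
qed

text \<open>Treating the parameter \<open>\<omega>\<close> as a further variable makes the constant uniform over compact sets of parameters.\<close>

lemma nonstationary_phase:
  fixes S :: "'p::euclidean_space \<times> 'a::euclidean_space \<Rightarrow> real" and \<theta> :: "'a \<Rightarrow> complex"
  assumes V: "open V" and K: "compact K" "K \<subseteq> V" and Z: "compact Z"
    and S: "\<And>k. Ck k (UNIV \<times> V) S"
    and grad: "\<And>\<omega> x. \<omega> \<in> Z \<Longrightarrow> x \<in> K \<Longrightarrow> \<exists>b\<in>Basis. partial_deriv (0, b) S (\<omega>, x) \<noteq> 0"
    and \<theta>: "\<And>k. Ck k UNIV \<theta>" and \<theta>0: "\<And>x. x \<notin> K \<Longrightarrow> \<theta> x = 0"
  shows "\<exists>C. \<forall>\<omega>\<in>Z. \<forall>r>0. r ^ k * norm (LINT x|lborel. exp (\<i> * of_real (r * S (\<omega>, x))) * \<theta> x) \<le> C"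
proof -
  define G where "G p = (\<Sum>b\<in>Basis. (partial_deriv (0, b) S p) * (partial_deriv (0, b) S p))" for p
  define Q where "Q = {p \<in> UNIV \<times> V. G p \<noteq> 0}"
  \<comment> \<open>Division by the squared gradient \<open>G\<close> is possible only on
    \<open>Q\<close>, and off \<open>K\<close> all amplitudes are zero. The union is an open set
    containing \<open>Z \<times> UNIV\<close> on which smoothness survives every step of the
    induction.\<close>
  define W where "W = Q \<union> UNIV \<times> (- K)"
  have oV: "open (UNIV \<times> V :: ('p \<times> 'a) set)" using V by (simp add: open_Times)
  have DS: "Ck k (UNIV \<times> V) (partial_deriv (0, b) S)" if "b \<in> Basis" for b k
    using Ck_partial_deriv[OF S] that by (auto simp: Basis_prod_def)
  have CG: "Ck k (UNIV \<times> V) G" for k unfolding G_def by (intro Ck_intros oV DS)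
  have oQ: "open Q"
  proof -
    have "open (G -` (- {0}) \<inter> UNIV \<times> V)"
      using continuous_on_open_vimage[OF oV, of G] Ck_continuous_on[OF CG] by (metis open_delete open_UNIV Compl_eq_Diff_UNIV)
    also have "G -` (- {0}) \<inter> UNIV \<times> V = Q" by (auto simp: Q_def)
    finally show ?thesis .
  qed
  have oN: "open (UNIV \<times> (- K) :: ('p \<times> 'a) set)" using compact_imp_closed[OF K(1)] by (simp add: open_Times open_Compl)
  have oW: "open W" unfolding W_def using oQ oN by auto
  have ZK: "(\<omega>, x) \<in> Q" if "\<omega> \<in> Z" "x \<in> K" for \<omega> x
  proof -
    obtain b where b: "b \<in> Basis" "partial_deriv (0, b) S (\<omega>, x) \<noteq> 0" using grad \<open>\<omega> \<in> Z\<close> \<open>x \<in> K\<close> by blast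
    then have "G (\<omega>, x) > 0" unfolding G_def
      by (intro sum_pos2[of _ b]) (auto simp: not_square_less_zero zero_less_mult_iff linorder_neq_iff)
    then show ?thesis using \<open>x \<in> K\<close> K by (auto simp: Q_def)
  qed
  have ZW: "Z \<times> UNIV \<subseteq> W" using ZK by (auto simp: W_def)
  have S_diff: "S differentiable at p" if "p \<in> UNIV \<times> V" for p using S[of 1] that by auto
  \<comment> \<open>The claim is generalised from \<open>\<theta>\<close> to amplitudes that depend
    on \<open>\<omega>\<close>, because the first integration by parts already introduces this
    dependence through the gradient of \<open>S\<close>.\<close>
  have "\<exists>C. \<forall>\<omega>\<in>Z. \<forall>r>0. r ^ k * norm (LINT x|lborel. exp (\<i> * of_real (r * S (\<omega>, x))) * f (\<omega>, x)) \<le> C"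
    if "\<And>k. Ck k W f" "\<And>\<omega> x. x \<notin> K \<Longrightarrow> f (\<omega>, x) = 0" for f :: "'p \<times> 'a \<Rightarrow> complex"
    using that
  proof (induction k arbitrary: f)
    case 0
    obtain C where C: "\<And>\<omega> e. \<omega> \<in> Z \<Longrightarrow> (\<forall>x. norm (e x) \<le> 1) \<Longrightarrow> norm (LINT x|lborel. e x * f (\<omega>, x)) \<le> C"
      using oscillatory_integral_bound[OF oW ZW Z K(1) 0] by blast
    then show ?case by (intro exI[of _ C]) auto
  next
    case (Suc k)
    \<comment> \<open>Integration by parts along \<open>grad S / |grad S|\<^sup>2\<close> replaces \<open>f\<close> by \<open>f'\<close> and gains a factor \<open>1 / r\<close>.\<close>
    define q where "q b p = partial_deriv (0, b) S p / G p" for b p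
    define g where "g b p = complex_of_real (q b p) * f p" for b p
    define f' where "f' p = (\<Sum>b\<in>Basis. partial_deriv (0, b) (g b) p)" for p
    have fQ: "Ck k Q f" for k using Suc.prems(1)[of k] by (rule Ck_subset) (auto simp: W_def)
    have Cq: "Ck k Q (q b)" if "b \<in> Basis" for k b
      unfolding q_def
      by (intro Ck_divide oQ Ck_subset[OF DS[OF that]] Ck_subset[OF CG]) (auto simp: Q_def)
    have CgQ: "Ck k Q (g b)" if "b \<in> Basis" for k b
      unfolding g_def by (intro Ck_intros oQ Cq that fQ)
    have g0: "g b (\<omega>, x) = 0" if "x \<notin> K" for b \<omega> x
      using Suc.prems(2)[OF that] by (simp add: g_def)
    have Cg: "Ck k W (g b)" if "b \<in> Basis" for k b
      unfolding W_def by (rule Ck_Un_zero[OF oQ oN CgQ[OF that]]) (auto simp: g0)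
    have Cf': "Ck k W f'" for k
      unfolding f'_def
    proof (rule Ck_sum[OF oW])
      show "Ck k W (partial_deriv (0, b) (g b))" if "b \<in> Basis" for b
        using Ck_partial_deriv[OF Cg[OF that], of "(0, b)"] that by (auto simp: Basis_prod_def)
    qed
    have pg0: "partial_deriv (0, b) (g b) (\<omega>, x) = 0" if "x \<notin> K" for b \<omega> x
    proof -
      have "partial_deriv (0, b) (g b) (\<omega>, x) = partial_deriv (0, b) (\<lambda>_. 0) (\<omega>, x)"
        by (rule partial_deriv_cong[OF oN]) (use that g0 in auto)
      then show ?thesis by (simp add: partial_deriv_const)
    qed
    have f'0: "f' (\<omega>, x) = 0" if "x \<notin> K" for \<omega> x
      using pg0[OF that] by (simp add: f'_def)
    obtain C where C: "\<And>\<omega> r. \<omega> \<in> Z \<Longrightarrow> r > 0 \<Longrightarrow> r ^ k * norm (LINT x|lborel. exp (\<i> * of_real (r * S (\<omega>, x))) * f' (\<omega>, x)) \<le> C"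
      using Suc.IH[OF Cf' f'0] by blast
    have "r ^ Suc k * norm (LINT x|lborel. exp (\<i> * of_real (r * S (\<omega>, x))) * f (\<omega>, x)) \<le> C"
      if "\<omega> \<in> Z" "r > 0" for \<omega> r
    proof -
      let ?E = "\<lambda>p. exp (\<i> * complex_of_real (r * S p))"
      have CEQ: "Ck k (UNIV \<times> V) ?E" for k by (intro Ck_intros oV S)
      have CE: "Ck k W (\<lambda>p. ?E p * h p)" if "\<And>k. Ck k W h" "\<And>\<omega> x. x \<notin> K \<Longrightarrow> h (\<omega>, x) = 0" for h k
        unfolding W_def
        by (rule Ck_Un_zero[OF oQ oN Ck_mult[OF oQ Ck_subset[OF CEQ] Ck_subset[OF that(1)]]])
          (auto simp: that Q_def W_def)
      have slice: "Ck k UNIV (\<lambda>x. h (\<omega>, x))" if "Ck k W h" for k and h :: "'p \<times> 'a \<Rightarrow> complex"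
      proof -
        have "{x. (\<omega>, x) \<in> W} = UNIV" using ZW \<open>\<omega> \<in> Z\<close> by auto
        then show ?thesis using Ck_compose_slice[OF oW that, of \<omega>] by simp
      qed
      have pd: "partial_deriv b (\<lambda>x. ?E (\<omega>, x) * g b (\<omega>, x)) x
          = \<i> * of_real r * (?E (\<omega>, x) * (of_real (partial_deriv (0, b) S (\<omega>, x) * q b (\<omega>, x)) * f (\<omega>, x)))
            + ?E (\<omega>, x) * partial_deriv (0, b) (g b) (\<omega>, x)" if b: "b \<in> Basis" for b x
      proof (cases "x \<in> K")
        case True
        then have xV: "(\<omega>, x) \<in> UNIV \<times> V" using K by auto
        have d1: "(\<lambda>p. r * S p) differentiable at (\<omega>, x)" using S_diff[OF xV] by simp
        have d2: "?E differentiable at (\<omega>, x)" using CEQ[of 1] xV by auto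
        have d3: "g b differentiable at (\<omega>, x)" using CgQ[OF b, of 1] ZK[OF \<open>\<omega> \<in> Z\<close> True] by auto
        have rS: "partial_deriv (0, b) (\<lambda>p. r * S p) (\<omega>, x) = r * partial_deriv (0, b) S (\<omega>, x)"
          using partial_deriv_mult[OF differentiable_const S_diff[OF xV], of "(0, b)" r] by (simp add: partial_deriv_const)
        have "partial_deriv b (\<lambda>x. ?E (\<omega>, x) * g b (\<omega>, x)) x = partial_deriv (0, b) (\<lambda>p. ?E p * g b p) (\<omega>, x)"
          by (rule partial_deriv_slice) (intro differentiable_mult d2 d3)
        also have "\<dots> = ?E (\<omega>, x) * partial_deriv (0, b) (g b) (\<omega>, x) + partial_deriv (0, b) ?E (\<omega>, x) * g b (\<omega>, x)"
          by (rule partial_deriv_mult[OF d2 d3])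
        also have "partial_deriv (0, b) ?E (\<omega>, x) = \<i> * of_real (r * partial_deriv (0, b) S (\<omega>, x)) * ?E (\<omega>, x)"
          using partial_deriv_expi[OF d1, of "(0, b)"] rS by simp
        also have "g b (\<omega>, x) = of_real (q b (\<omega>, x)) * f (\<omega>, x)" by (simp add: g_def)
        finally show ?thesis by (simp add: mult_ac)
      next
        case False
        have "partial_deriv b (\<lambda>x. ?E (\<omega>, x) * g b (\<omega>, x)) x = 0"
          by (rule partial_deriv_zero_outside[OF compact_imp_closed[OF K(1)] _ False]) (simp add: g0)
        then show ?thesis using pg0[OF False] Suc.prems(2)[OF False] by simp
      qed
      have int0: "(LINT x|lborel. partial_deriv b (\<lambda>x. ?E (\<omega>, x) * g b (\<omega>, x)) x) = 0" if "b \<in> Basis" for b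
        by (rule integral_partial_deriv_eq_0[OF slice[OF CE[OF Cg[OF that]]] K(1) _ that]) (auto simp: g0)
      have int: "integrable lborel (partial_deriv b (\<lambda>x. ?E (\<omega>, x) * g b (\<omega>, x)))" if "b \<in> Basis" for b
      proof (rule integrable_compact_support[OF _ K(1)])
        show "continuous_on UNIV (partial_deriv b (\<lambda>x. ?E (\<omega>, x) * g b (\<omega>, x)))"
          using Ck_partial_deriv[OF slice[OF CE[OF Cg[OF that] g0, of "Suc 0"]] that] by simp
        show "partial_deriv b (\<lambda>x. ?E (\<omega>, x) * g b (\<omega>, x)) x = 0" if "x \<notin> K" for x
          by (rule partial_deriv_zero_outside[OF compact_imp_closed[OF K(1)] _ that]) (simp add: g0)
      qed
      have sumq: "(\<Sum>b\<in>Basis. partial_deriv (0, b) S (\<omega>, x) * q b (\<omega>, x)) = 1" if "x \<in> K" for x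
        using ZK[OF \<open>\<omega> \<in> Z\<close> that]
        by (simp add: q_def G_def Q_def flip: sum_divide_distrib)
      have sum: "(\<Sum>b\<in>Basis. partial_deriv b (\<lambda>x. ?E (\<omega>, x) * g b (\<omega>, x)) x)
          = \<i> * of_real r * (?E (\<omega>, x) * f (\<omega>, x)) + ?E (\<omega>, x) * f' (\<omega>, x)" for x
      proof (cases "x \<in> K")
        case True
        have "(\<Sum>b\<in>Basis. partial_deriv b (\<lambda>x. ?E (\<omega>, x) * g b (\<omega>, x)) x)
          = (\<Sum>b\<in>Basis. \<i> * of_real r * (?E (\<omega>, x) * (of_real (partial_deriv (0, b) S (\<omega>, x) * q b (\<omega>, x)) * f (\<omega>, x))))
            + (\<Sum>b\<in>Basis. ?E (\<omega>, x) * partial_deriv (0, b) (g b) (\<omega>, x))"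
          unfolding sum.distrib[symmetric] by (rule sum.cong[OF refl pd])
        also have "(\<Sum>b\<in>Basis. \<i> * of_real r * (?E (\<omega>, x) * (of_real (partial_deriv (0, b) S (\<omega>, x) * q b (\<omega>, x)) * f (\<omega>, x))))
          = \<i> * of_real r * (?E (\<omega>, x) * (of_real (\<Sum>b\<in>Basis. partial_deriv (0, b) S (\<omega>, x) * q b (\<omega>, x)) * f (\<omega>, x)))"
          by (simp only: sum_distrib_left sum_distrib_right of_real_sum)
        finally show ?thesis using sumq[OF True] by (simp add: f'_def sum_distrib_left)
      next
        case False
        have "partial_deriv b (\<lambda>x. ?E (\<omega>, x) * g b (\<omega>, x)) x = 0" for b
          by (rule partial_deriv_zero_outside[OF compact_imp_closed[OF K(1)] _ False]) (simp add: g0)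
        then show ?thesis using f'0[OF False] Suc.prems(2)[OF False] by simp
      qed
      have i1: "integrable lborel (\<lambda>x. ?E (\<omega>, x) * f (\<omega>, x))"
        by (rule integrable_compact_support[OF Ck_continuous_on[OF slice[OF CE[OF Suc.prems, of 0]]] K(1)])
          (use Suc.prems(2) in auto)
      have i2: "integrable lborel (\<lambda>x. ?E (\<omega>, x) * f' (\<omega>, x))"
        by (rule integrable_compact_support[OF Ck_continuous_on[OF slice[OF CE[OF Cf' f'0, of 0]]] K(1)])
          (use f'0 in auto)
      have "0 = (\<Sum>b\<in>Basis. LINT x|lborel. partial_deriv b (\<lambda>x. ?E (\<omega>, x) * g b (\<omega>, x)) x)"
        by (rule sum.neutral[symmetric], rule ballI, rule int0)
      also have "\<dots> = (LINT x|lborel. (\<Sum>b\<in>Basis. partial_deriv b (\<lambda>x. ?E (\<omega>, x) * g b (\<omega>, x)) x))"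
        by (rule Bochner_Integration.integral_sum[symmetric]) (rule int)
      also have "\<dots> = \<i> * of_real r * (LINT x|lborel. ?E (\<omega>, x) * f (\<omega>, x)) + (LINT x|lborel. ?E (\<omega>, x) * f' (\<omega>, x))"
        unfolding sum using i1 i2 by simp
      finally have "\<i> * of_real r * (LINT x|lborel. ?E (\<omega>, x) * f (\<omega>, x)) = - (LINT x|lborel. ?E (\<omega>, x) * f' (\<omega>, x))"
        by (simp add: eq_neg_iff_add_eq_0)
      then have "norm (\<i> * of_real r * (LINT x|lborel. ?E (\<omega>, x) * f (\<omega>, x))) = norm (LINT x|lborel. ?E (\<omega>, x) * f' (\<omega>, x))"
        by simp
      then have "r * norm (LINT x|lborel. ?E (\<omega>, x) * f (\<omega>, x)) = norm (LINT x|lborel. ?E (\<omega>, x) * f' (\<omega>, x))"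
        using \<open>r > 0\<close> by (simp add: norm_mult)
      then have "r ^ k * (r * norm (LINT x|lborel. ?E (\<omega>, x) * f (\<omega>, x))) \<le> C"
        using C[OF that] by (simp only:)
      then show ?thesis by (simp only: power_Suc mult.assoc mult.left_commute[of r])
    qed
    then show ?case by blast
  qed
  from this[of "\<lambda>p. \<theta> (snd p)"] show ?thesis
    using \<theta>0 Ck_compose[OF oW open_UNIV _ \<theta> Ck_snd[OF oW Ck_id[OF oW]]] by simp
qed

text \<open>By \<open>fourier_pullback\<close> this is, up to a power of \<open>2 * pi\<close>, the
  kernel that turns the transform of \<open>v\<close> into the transform of \<open>\<theta>\<close>
  times the pullback of \<open>v\<close> by \<open>\<kappa>\<close>.\<close>

definition osc :: "('a::euclidean_space \<Rightarrow> 'a) \<Rightarrow> ('a \<Rightarrow> complex) \<Rightarrow> 'a \<Rightarrow> 'a \<Rightarrow> complex" where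
  "osc \<kappa> \<theta> \<xi> \<eta> = (LINT x|lborel. exp (\<i> * of_real (\<kappa> x \<bullet> \<eta> - x \<bullet> \<xi>)) * \<theta> x)"

lemma norm_osc_le: "integrable lborel \<theta> \<Longrightarrow> norm (osc \<kappa> \<theta> \<xi> \<eta>) \<le> (LINT x|lborel. norm (\<theta> x))"
  unfolding osc_def by (rule order.trans[OF integral_norm_bound]) (simp add: norm_mult)

text \<open>Merges a trivial bound for small frequencies and a homogeneous bound, as
  \<open>nonstationary_phase\<close> gives it, into one inhomogeneous weight.\<close>

lemma one_plus_power_le:
  fixes x :: real
  assumes "x \<ge> 0"
  shows "(1 + x) ^ l \<le> 2 ^ l * (1 + x ^ l)"
proof (cases "x \<le> 1")
  case True
  then have "(1 + x) ^ l \<le> 2 ^ l" using assms by (intro power_mono) auto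
  also have "\<dots> \<le> 2 ^ l * (1 + x ^ l)" using assms by simp
  finally show ?thesis .
next
  case False
  then have "(1 + x) ^ l \<le> (2 * x) ^ l" by (intro power_mono) auto
  also have "\<dots> \<le> 2 ^ l * (1 + x ^ l)" by (simp add: power_mult_distrib)
  finally show ?thesis .
qed

lemma scale_interior_cone:
  assumes "\<forall>\<xi>\<in>\<Gamma>. \<forall>r>0. r *\<^sub>R \<xi> \<in> \<Gamma>" "\<xi> \<in> interior \<Gamma>" "r > 0"
  shows "r *\<^sub>R \<xi> \<in> interior (\<Gamma> :: 'a::real_normed_vector set)"
proof (rule interiorI)
  show "open ((*\<^sub>R) r ` interior \<Gamma>)" using assms(3) by (intro open_scaling) auto
  show "r *\<^sub>R \<xi> \<in> (*\<^sub>R) r ` interior \<Gamma>" using assms(2) by blast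
  show "(*\<^sub>R) r ` interior \<Gamma> \<subseteq> \<Gamma>" using assms(1,3) interior_subset by blast
qed

text \<open>The circular cone about \<open>e\<close> is written by a homogeneous inequality, so that
  it is closed with its vertex: compactness arguments use \<open>C\<close>, conic neighbourhoods use
  \<open>C - {0}\<close>.\<close>

lemma closed_cone:
  fixes e :: "'a::real_normed_vector"
  assumes "r > 0" "r < 1" "norm e = 1" "s > 0"
  defines "C \<equiv> {\<xi>. norm (\<xi> - norm \<xi> *\<^sub>R e) \<le> r * norm \<xi>}"
  shows "closed C" "conic_neighborhood (C - {0}) (s *\<^sub>R e)"
    "\<And>\<xi> t. \<xi> \<in> C \<Longrightarrow> t > 0 \<Longrightarrow> t *\<^sub>R \<xi> \<in> C"
    "\<And>\<xi>. \<xi> \<in> C \<Longrightarrow> \<xi> \<noteq> 0 \<Longrightarrow> (1 / norm \<xi>) *\<^sub>R \<xi> \<in> cball e r"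
proof -
  show "closed C" unfolding C_def by (intro closed_Collect_le continuous_intros)
  show cone: "t *\<^sub>R \<xi> \<in> C" if "\<xi> \<in> C" "t > 0" for \<xi> t
  proof -
    have "norm (t *\<^sub>R \<xi> - norm (t *\<^sub>R \<xi>) *\<^sub>R e) = t * norm (\<xi> - norm \<xi> *\<^sub>R e)"
      using that(2) by (simp add: scaleR_diff_right[symmetric] flip: scaleR_scaleR)
    then show ?thesis using that by (simp add: C_def mult.left_commute)
  qed
  show "(1 / norm \<xi>) *\<^sub>R \<xi> \<in> cball e r" if "\<xi> \<in> C" "\<xi> \<noteq> 0" for \<xi>
  proof -
    have "norm (e - (1 / norm \<xi>) *\<^sub>R \<xi>) = norm ((1 / norm \<xi>) *\<^sub>R (\<xi> - norm \<xi> *\<^sub>R e))"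
      using that(2) by (simp add: scaleR_diff_right norm_minus_commute)
    also have "\<dots> = norm (\<xi> - norm \<xi> *\<^sub>R e) / norm \<xi>" by simp
    also have "\<dots> \<le> r" using that by (simp add: C_def divide_le_eq)
    finally show ?thesis by (simp add: dist_norm)
  qed
  have "s *\<^sub>R e \<in> interior (C - {0})"
  proof (rule interiorI)
    show "open {\<xi>. norm (\<xi> - norm \<xi> *\<^sub>R e) < r * norm \<xi>}" by (intro open_Collect_less continuous_intros)
    show "s *\<^sub>R e \<in> {\<xi>. norm (\<xi> - norm \<xi> *\<^sub>R e) < r * norm \<xi>}" using assms by simp
    show "{\<xi>. norm (\<xi> - norm \<xi> *\<^sub>R e) < r * norm \<xi>} \<subseteq> C - {0}" by (auto simp: C_def)
  qed
  then show "conic_neighborhood (C - {0}) (s *\<^sub>R e)"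
    using cone by (auto simp: conic_neighborhood_def)
qed

text \<open>At \<open>x0\<close> the phase is stationary exactly if \<open>T \<eta> = \<xi>\<close>.
  For \<open>\<xi>\<close> in a narrow cone about \<open>T \<eta>0\<close> this forces
  \<open>\<eta>\<close> into \<open>\<Gamma>\<close> and makes it comparable in size with
  \<open>\<xi>\<close>, so each of the two alternatives in the conclusion excludes stationarity. The
  cone, the ball and \<open>\<delta>\<close> are fixed before \<open>\<theta>\<close> and
  \<open>l\<close>, because the amplitude is built only after the ball is known and \<open>l\<close>
  is arbitrary.\<close>

lemma osc_decay:
  fixes \<kappa> :: "'a::euclidean_space \<Rightarrow> 'a"
  assumes \<Omega>: "open \<Omega>" "x0 \<in> \<Omega>" and \<kappa>: "\<And>k. Ck k \<Omega> \<kappa>"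
    and T: "linear T" "inj T" "\<And>h \<eta>. frechet_derivative \<kappa> (at x0) h \<bullet> \<eta> = h \<bullet> T \<eta>"
    and \<Gamma>: "conic_neighborhood \<Gamma> \<eta>0"
  obtains \<Gamma>' r \<delta> where "conic_neighborhood \<Gamma>' (T \<eta>0)" "r > 0" "cball x0 r \<subseteq> \<Omega>" "0 < \<delta>" "\<delta> \<le> 1"
    "\<And>\<theta> l. (\<And>k. Ck k UNIV \<theta>) \<Longrightarrow> (\<And>x. x \<notin> cball x0 r \<Longrightarrow> \<theta> x = 0) \<Longrightarrow>
      \<exists>C. \<forall>\<xi>\<in>\<Gamma>'. \<forall>\<eta>. \<eta> \<notin> \<Gamma> \<or> norm \<eta> \<le> \<delta> * norm \<xi> \<longrightarrow>
        (1 + ((norm \<xi>)\<^sup>2 + (norm \<eta>)\<^sup>2)) ^ l * norm (osc \<kappa> \<theta> \<xi> \<eta>) \<le> C"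
proof -
  define S :: "('a \<times> 'a) \<times> 'a \<Rightarrow> real" where "S = (\<lambda>p. \<kappa> (snd p) \<bullet> snd (fst p) - snd p \<bullet> fst (fst p))"
  have oV: "open (UNIV \<times> \<Omega> :: (('a \<times> 'a) \<times> 'a) set)" using \<Omega> by (simp add: open_Times)
  have CS: "Ck k (UNIV \<times> \<Omega>) S" for k
    unfolding S_def
    by (intro Ck_intros oV Ck_compose[OF oV \<Omega>(1) _ \<kappa>]) auto
  have DS: "partial_deriv (0, b) S ((\<xi>, \<eta>), x) = frechet_derivative \<kappa> (at x) b \<bullet> \<eta> - b \<bullet> \<xi>"
    if "x \<in> \<Omega>" for b \<xi> \<eta> x
  proof -
    have "(\<kappa> has_derivative frechet_derivative \<kappa> (at x)) (at x)"
      using \<kappa>[of 1] that by (auto simp: frechet_derivative_works)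
    then have d1: "((\<lambda>x. S ((\<xi>, \<eta>), x)) has_derivative (\<lambda>h. frechet_derivative \<kappa> (at x) h \<bullet> \<eta> - h \<bullet> \<xi>)) (at x)"
      unfolding S_def by (auto intro!: derivative_eq_intros)
    have "S differentiable at ((\<xi>, \<eta>), x)" using CS[of 1] that by auto
    then have "partial_deriv (0, b) S ((\<xi>, \<eta>), x) = partial_deriv b (\<lambda>x. S ((\<xi>, \<eta>), x)) x"
      by (rule partial_deriv_slice[symmetric])
    also note partial_deriv_eq[OF d1]
    finally show ?thesis .
  qed
  define G where "G p = (\<Sum>b\<in>Basis. (partial_deriv (0, b) S p) * (partial_deriv (0, b) S p))" for p
  have CDS: "Ck k (UNIV \<times> \<Omega>) (partial_deriv (0, b) S)" if "b \<in> Basis" for b k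
    by (rule Ck_partial_deriv[OF CS]) (use that in \<open>auto simp: Basis_prod_def\<close>)
  have CG: "Ck k (UNIV \<times> \<Omega>) G" for k unfolding G_def
    by (intro Ck_intros oV CDS)
  define Q where "Q = {p \<in> UNIV \<times> \<Omega>. G p \<noteq> 0}"
  have oQ: "open Q"
  proof -
    have "open (G -` (- {0}) \<inter> UNIV \<times> \<Omega>)"
      using continuous_on_open_vimage[OF oV, of G] Ck_continuous_on[OF CG] by (metis open_delete open_UNIV Compl_eq_Diff_UNIV)
    also have "G -` (- {0}) \<inter> UNIV \<times> \<Omega> = Q" by (auto simp: Q_def)
    finally show ?thesis .
  qed
  have \<eta>0: "\<eta>0 \<in> interior \<Gamma>" "\<eta>0 \<noteq> 0" "0 \<notin> \<Gamma>" "\<forall>\<xi>\<in>\<Gamma>. \<forall>r>0. r *\<^sub>R \<xi> \<in> \<Gamma>"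
    using \<Gamma> interior_subset by (auto simp: conic_neighborhood_def)
  have T0: "T \<eta> = 0 \<longleftrightarrow> \<eta> = 0" for \<eta>
    using T(1,2) linear_injective_0[of T] linear_0[of T] by auto
  define e where "e = (1 / norm (T \<eta>0)) *\<^sub>R T \<eta>0"
  have nT: "norm (T \<eta>0) > 0" using T0 \<eta>0 by auto
  have e: "norm e = 1" "T \<eta>0 = norm (T \<eta>0) *\<^sub>R e" using nT by (auto simp: e_def)
  \<comment> \<open>An injective linear map of a finite-dimensional space to itself is onto, hence
    open.\<close>
  have "open (T ` interior \<Gamma>)"
    using T(1,2) linear_injective_imp_surjective by (intro open_surjective_linear_image) auto
  moreover have "e \<in> T ` interior \<Gamma>"
    using scale_interior_cone[OF \<eta>0(4,1), of "1 / norm (T \<eta>0)"] nT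
    by (auto simp: e_def linear_cmul[OF T(1), symmetric])
  ultimately obtain r0 where r0: "r0 > 0" "cball e r0 \<subseteq> T ` interior \<Gamma>"
    by (meson open_contains_cball)
  \<comment> \<open>\<open>closed_cone\<close> asks for an aperture below 1.\<close>
  define \<rho> where "\<rho> = min r0 (1/2)"
  have \<rho>: "\<rho> > 0" "\<rho> < 1" "cball e \<rho> \<subseteq> T ` interior \<Gamma>" using r0 by (auto simp: \<rho>_def)
  define D where "D = {\<xi>. norm (\<xi> - norm \<xi> *\<^sub>R e) \<le> \<rho> * norm \<xi>}"
  note D = closed_cone[OF \<rho>(1,2) e(1) nT, folded D_def, folded e(2)]
  have DT: "\<xi> \<in> T ` interior \<Gamma>" if "\<xi> \<in> D" "\<xi> \<noteq> 0" for \<xi>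
  proof -
    have "(1 / norm \<xi>) *\<^sub>R \<xi> \<in> T ` interior \<Gamma>" using D(4)[OF that] \<rho>(3) by blast
    then obtain \<eta> where \<eta>: "\<eta> \<in> interior \<Gamma>" "(1 / norm \<xi>) *\<^sub>R \<xi> = T \<eta>" by blast
    then have "T (norm \<xi> *\<^sub>R \<eta>) = \<xi>" using that(2) by (simp add: linear_cmul[OF T(1)] flip: \<eta>(2))
    then show ?thesis using scale_interior_cone[OF \<eta>0(4) \<eta>(1), of "norm \<xi>"] that(2) by force
  qed
  obtain M where M: "M > 0" "\<And>\<eta>. norm (T \<eta>) \<le> M * norm \<eta>"
    using linear_bounded_pos[OF T(1)] by blast
  \<comment> \<open>Stationarity together with
    \<open>norm \<eta> \<le> \<delta> * norm \<xi>\<close> would give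
    \<open>norm \<eta> \<le> \<delta> * M * norm \<eta>\<close>, at most half of
    \<open>norm \<eta>\<close>. The bound 1 is for \<open>pullback_weight_bound\<close>.\<close>
  define \<delta> where "\<delta> = min 1 (1 / (2 * M))"
  have \<delta>: "\<delta> > 0" "\<delta> \<le> 1" "\<delta> * M \<le> 1/2" using M(1) by (auto simp: \<delta>_def min_def field_simps)
  \<comment> \<open>The phase has gradient \<open>T \<eta> - \<xi>\<close> at \<open>x0\<close>, which does not vanish on \<open>Z\<close>; by compactness it does not
    vanish for \<open>x\<close> close to \<open>x0\<close> either. Homogeneity in \<open>(\<xi>, \<eta>)\<close> extends the estimate beyond the unit sphere.\<close>
  define Z where "Z = {p::'a\<times>'a. fst p \<in> D \<and> (snd p \<in> - interior \<Gamma> \<or> norm (snd p) \<le> \<delta> * norm (fst p))} \<inter> sphere 0 1"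
  \<comment> \<open>Taking the complement of the interior of \<open>\<Gamma>\<close>, rather than of
    \<open>\<Gamma>\<close>, makes the set closed.\<close>
  have "closed {p::'a\<times>'a. fst p \<in> D \<and> (snd p \<in> - interior \<Gamma> \<or> norm (snd p) \<le> \<delta> * norm (fst p))}"
  proof (intro closed_Collect_conj closed_Collect_disj closed_Collect_le continuous_intros)
    show "closed {p::'a\<times>'a. fst p \<in> D}"
      using closed_vimage[OF D(1), of fst] by (simp add: vimage_def continuous_on_fst)
    show "closed {p::'a\<times>'a. snd p \<in> - interior \<Gamma>}"
      using closed_vimage[of "- interior \<Gamma>" snd] by (simp add: vimage_def continuous_on_snd closed_Compl)
  qed
  then have Z: "compact Z" unfolding Z_def by (intro closed_Int_compact) auto
  have TZ: "T \<eta> \<noteq> \<xi>" if "(\<xi>, \<eta>) \<in> Z" for \<xi> \<eta>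
  proof
    assume eq: "T \<eta> = \<xi>"
    have nz: "\<xi> \<noteq> 0"
    proof
      assume "\<xi> = 0"
      then have "\<eta> = 0" using eq T0[of \<eta>] by simp
      then show False using that \<open>\<xi> = 0\<close> by (simp add: Z_def)
    qed
    have "\<xi> \<in> T ` interior \<Gamma>" using DT[of \<xi>] that nz by (auto simp: Z_def)
    then obtain \<eta>' where "\<eta>' \<in> interior \<Gamma>" "T \<eta>' = \<xi>" by blast
    then have "\<eta> \<in> interior \<Gamma>" using eq T(2) by (metis injD)
    then have "norm \<eta> \<le> \<delta> * norm \<xi>" using that by (auto simp: Z_def)
    also have "\<dots> \<le> \<delta> * (M * norm \<eta>)" using M(2)[of \<eta>] eq \<delta> by (intro mult_left_mono) auto
    also have "\<dots> \<le> 1/2 * norm \<eta>" using mult_right_mono[OF \<delta>(3), of "norm \<eta>"] by (simp add: mult_ac)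
    finally have "\<eta> = 0" by simp
    then have "T \<eta> = 0" using T0[of \<eta>] by simp
    then show False using nz eq by simp
  qed
  have "Z \<times> {x0} \<subseteq> Q"
  proof
    fix p assume "p \<in> Z \<times> {x0}"
    then obtain \<xi> \<eta> where p: "p = ((\<xi>, \<eta>), x0)" "(\<xi>, \<eta>) \<in> Z" by (metis SigmaE singletonD prod.collapse)
    then have "T \<eta> - \<xi> \<noteq> 0" using TZ by simp
    then obtain b where b: "b \<in> Basis" "(T \<eta> - \<xi>) \<bullet> b \<noteq> 0" by (metis euclidean_all_zero_iff)
    then have "partial_deriv (0, b) S p \<noteq> 0"
      using DS[OF \<Omega>(2)] T(3) p by (auto simp: inner_diff_left inner_diff_right inner_commute)
    then have "G p > 0" unfolding G_def using b(1)
      by (intro sum_pos2[of _ b]) (auto simp: zero_less_mult_iff linorder_neq_iff)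
    then show "p \<in> Q" using \<Omega> p by (auto simp: Q_def)
  qed
  moreover have "compact (Z \<times> {x0})" using Z by (simp add: compact_Times)
  ultimately obtain r1 where r1: "r1 > 0" "(\<Union>p\<in>Z \<times> {x0}. cball p r1) \<subseteq> Q"
    using compact_subset_open_imp_cball_epsilon_subset[OF _ oQ] by metis
  obtain r2 where r2: "r2 > 0" "cball x0 r2 \<subseteq> \<Omega>" using \<Omega> by (meson open_contains_cball)
  define r where "r = min r1 r2"
  have r: "r > 0" "cball x0 r \<subseteq> \<Omega>" using r1 r2 by (auto simp: r_def)
  have grad: "\<exists>b\<in>Basis. partial_deriv (0, b) S (\<omega>, x) \<noteq> 0" if "\<omega> \<in> Z" "x \<in> cball x0 r" for \<omega> x
  proof -
    have "(\<omega>, x) \<in> cball (\<omega>, x0) r1" using that by (auto simp: dist_Pair_Pair r_def)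
    then have "G (\<omega>, x) \<noteq> 0" using r1 that by (fastforce simp: Q_def)
    then show ?thesis unfolding G_def by (auto intro: sum.neutral)
  qed
  show thesis
  proof (rule that[OF D(2) r \<delta>(1,2)])
    fix \<theta> :: "'a \<Rightarrow> complex" and l
    assume \<theta>: "\<And>k. Ck k UNIV \<theta>" "\<And>x. x \<notin> cball x0 r \<Longrightarrow> \<theta> x = 0"
    \<comment> \<open>The order is \<open>2 * l\<close> because the weight in the conclusion is the
      \<open>l\<close>-th power of a squared norm.\<close>
    obtain C where C: "\<And>\<omega> s. \<omega> \<in> Z \<Longrightarrow> s > 0 \<Longrightarrow>
        s ^ (2 * l) * norm (LINT x|lborel. exp (\<i> * of_real (s * S (\<omega>, x))) * \<theta> x) \<le> C"
      using nonstationary_phase[OF \<Omega>(1) compact_cball r(2) Z CS grad \<theta>, of "2 * l"] by blast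
    have i\<theta>: "integrable lborel \<theta>"
      by (rule integrable_compact_support[OF Ck_continuous_on[OF \<theta>(1)] compact_cball \<theta>(2)])
    let ?B = "LINT x|lborel. norm (\<theta> x)"
    have "(1 + ((norm \<xi>)\<^sup>2 + (norm \<eta>)\<^sup>2)) ^ l * norm (osc \<kappa> \<theta> \<xi> \<eta>) \<le> 2 ^ l * (?B + C)"
      if \<xi>: "\<xi> \<in> D - {0}" and \<eta>: "\<eta> \<notin> \<Gamma> \<or> norm \<eta> \<le> \<delta> * norm \<xi>" for \<xi> \<eta>
    proof -
      define s where "s = norm (\<xi>, \<eta>)"
      have "(\<xi>, \<eta>) \<noteq> 0" using \<xi> by (simp add: zero_prod_def)
      then have "s > 0" unfolding s_def zero_less_norm_iff .
      moreover have "s\<^sup>2 = (norm \<xi>)\<^sup>2 + (norm \<eta>)\<^sup>2" by (simp add: s_def norm_Pair)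
      ultimately have s: "s > 0" "s\<^sup>2 = (norm \<xi>)\<^sup>2 + (norm \<eta>)\<^sup>2" by auto
      define \<omega> where "\<omega> = (1 / s) *\<^sub>R (\<xi>, \<eta>)"
      have s\<omega>: "s *\<^sub>R \<omega> = (\<xi>, \<eta>)" using s by (simp add: \<omega>_def)
      have "\<omega> \<in> Z"
        unfolding Z_def
      proof (intro IntI CollectI conjI)
        have "norm \<omega> = \<bar>1 / s\<bar> * s" unfolding \<omega>_def norm_scaleR s_def[symmetric] ..
        then show "\<omega> \<in> sphere 0 1" using s(1) by simp
        show "fst \<omega> \<in> D" using D(3)[of \<xi> "1 / s"] \<xi> s by (simp add: \<omega>_def)
        show "snd \<omega> \<in> - interior \<Gamma> \<or> norm (snd \<omega>) \<le> \<delta> * norm (fst \<omega>)"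
          using \<eta>
        proof
          assume "\<eta> \<notin> \<Gamma>"
          have "snd \<omega> \<notin> interior \<Gamma>"
          proof
            assume "snd \<omega> \<in> interior \<Gamma>"
            then have "s *\<^sub>R snd \<omega> \<in> \<Gamma>" using s \<eta>0(4) interior_subset by blast
            then show False using \<open>\<eta> \<notin> \<Gamma>\<close> s\<omega> by (metis snd_conv snd_scaleR)
          qed
          then show ?thesis by simp
        next
          assume "norm \<eta> \<le> \<delta> * norm \<xi>"
          then show ?thesis using s by (simp add: \<omega>_def divide_right_mono)
        qed
      qed
      from C[OF this s(1)] have C': "s ^ (2 * l) * norm (LINT x|lborel. exp (\<i> * of_real (s * S (\<omega>, x))) * \<theta> x) \<le> C" .
      have "s * S (\<omega>, x) = \<kappa> x \<bullet> \<eta> - x \<bullet> \<xi>" for x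
      proof -
        have "s * S (\<omega>, x) = \<kappa> x \<bullet> snd (s *\<^sub>R \<omega>) - x \<bullet> fst (s *\<^sub>R \<omega>)"
          by (simp add: S_def right_diff_distrib)
        then show ?thesis by (simp add: s\<omega>)
      qed
      with C' have C'': "s ^ (2 * l) * norm (osc \<kappa> \<theta> \<xi> \<eta>) \<le> C" by (simp add: osc_def)
      have "(1 + ((norm \<xi>)\<^sup>2 + (norm \<eta>)\<^sup>2)) ^ l * norm (osc \<kappa> \<theta> \<xi> \<eta>) \<le> 2 ^ l * (1 + (s\<^sup>2) ^ l) * norm (osc \<kappa> \<theta> \<xi> \<eta>)"
        unfolding s(2)[symmetric] by (intro mult_right_mono one_plus_power_le) auto
      also have "\<dots> = 2 ^ l * (norm (osc \<kappa> \<theta> \<xi> \<eta>) + s ^ (2 * l) * norm (osc \<kappa> \<theta> \<xi> \<eta>))"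
        by (simp add: algebra_simps flip: power_mult)
      also have "\<dots> \<le> 2 ^ l * (?B + C)"
        using norm_osc_le[OF i\<theta>] C'' by (intro mult_left_mono add_mono) auto
      finally show ?thesis .
    qed
    then show "\<exists>C. \<forall>\<xi>\<in>D - {0}. \<forall>\<eta>. \<eta> \<notin> \<Gamma> \<or> norm \<eta> \<le> \<delta> * norm \<xi> \<longrightarrow>
        (1 + ((norm \<xi>)\<^sup>2 + (norm \<eta>)\<^sup>2)) ^ l * norm (osc \<kappa> \<theta> \<xi> \<eta>) \<le> C" by blast
  qed
qed

section \<open>Decay of the transform of a pullback\<close>

lemma fourier_pullback:
  fixes \<kappa> :: "'a::euclidean_space \<Rightarrow> 'a"
  assumes \<Omega>: "open \<Omega>" and \<kappa>: "continuous_on \<Omega> \<kappa>"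
    and \<theta>: "integrable lborel \<theta>" "\<And>x. x \<notin> \<Omega> \<Longrightarrow> \<theta> x = 0"
    and v: "\<And>k. Ck k UNIV v" and K: "compact K" and v0: "\<And>x. x \<notin> K \<Longrightarrow> v x = 0"
  shows "of_real (2 * pi) ^ DIM('a) * fourier (\<lambda>x. \<theta> x * v (\<kappa> x)) \<xi> = (LINT \<eta>|lborel. fourier v \<eta> * osc \<kappa> \<theta> \<xi> \<eta>)"
proof -
  \<comment> \<open>\<open>\<kappa>\<close> has meaningful values only on \<open>\<Omega>\<close>.
    The cut-off version is Borel measurable on the whole space and agrees with it wherever
    \<open>\<theta>\<close> is nonzero.\<close>
  define \<kappa>' where "\<kappa>' x = indicat_real \<Omega> x *\<^sub>R \<kappa> x" for x
  have [measurable]: "\<kappa>' \<in> borel_measurable borel"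
    unfolding \<kappa>'_def using borel_measurable_continuous_on_indicator[OF _ \<kappa>] \<Omega> by simp
  have eq: "\<theta> x * F (\<kappa>' x) = \<theta> x * F (\<kappa> x)" for x and F :: "'a \<Rightarrow> complex"
    using \<theta>(2)[of x] by (cases "x \<in> \<Omega>") (auto simp: \<kappa>'_def)
  let ?k = "\<lambda>(x, \<eta>). exp (\<i> * of_real (\<kappa>' x \<bullet> \<eta> - x \<bullet> \<xi>))"
  have "of_real (2 * pi) ^ DIM('a) * fourier (\<lambda>x. \<theta> x * v (\<kappa> x)) \<xi>
     = (LINT x|lborel. exp (- \<i> * complex_of_real (x \<bullet> \<xi>)) * (\<theta> x * (of_real (2 * pi) ^ DIM('a) * v (\<kappa>' x))))"
    unfolding fourier_def eq[of _ "\<lambda>y. of_real (2 * pi) ^ DIM('a) * v y"]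
    by (subst integral_mult_right_zero[symmetric]) (simp add: mult_ac)
  also have "\<dots> = (LINT x|lborel. \<theta> x * (LINT \<eta>|lborel. fourier v \<eta> * ?k (x, \<eta>)))"
  proof (rule Bochner_Integration.integral_cong[OF refl])
    fix x
    have inv: "(LINT \<eta>|lborel. fourier v \<eta> * exp (\<i> * of_real (\<kappa>' x \<bullet> \<eta>))) = of_real (2 * pi) ^ DIM('a) * v (\<kappa>' x)"
      by (rule fourier_inversion[OF v K v0])
    have "exp (- \<i> * complex_of_real (x \<bullet> \<xi>)) * (LINT \<eta>|lborel. fourier v \<eta> * exp (\<i> * of_real (\<kappa>' x \<bullet> \<eta>)))
        = (LINT \<eta>|lborel. exp (- \<i> * complex_of_real (x \<bullet> \<xi>)) * (fourier v \<eta> * exp (\<i> * of_real (\<kappa>' x \<bullet> \<eta>))))"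
      by simp
    also have "\<dots> = (LINT \<eta>|lborel. fourier v \<eta> * ?k (x, \<eta>))"
      by (rule Bochner_Integration.integral_cong[OF refl])
        (simp add: right_diff_distrib exp_diff exp_minus field_simps)
    finally have "exp (- \<i> * complex_of_real (x \<bullet> \<xi>)) * (of_real (2 * pi) ^ DIM('a) * v (\<kappa>' x))
        = (LINT \<eta>|lborel. fourier v \<eta> * ?k (x, \<eta>))"
      using inv by (simp only:)
    then show "exp (- \<i> * complex_of_real (x \<bullet> \<xi>)) * (\<theta> x * (of_real (2 * pi) ^ DIM('a) * v (\<kappa>' x)))
        = \<theta> x * (LINT \<eta>|lborel. fourier v \<eta> * ?k (x, \<eta>))"
      by (simp only: mult.left_commute[of _ "\<theta> x"])
  qed
  also have "\<dots> = (LINT \<eta>|lborel. fourier v \<eta> * (LINT x|lborel. \<theta> x * ?k (x, \<eta>)))"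
  proof (rule Fubini_bounded_kernel[OF \<theta>(1) integrable_fourier[OF v K v0]])
    show "?k \<in> borel_measurable (borel \<Otimes>\<^sub>M borel)" by measurable
    show "norm (?k (x, y)) \<le> 1" for x y by simp
  qed
  also have "\<dots> = (LINT \<eta>|lborel. fourier v \<eta> * osc \<kappa> \<theta> \<xi> \<eta>)"
  proof (rule Bochner_Integration.integral_cong[OF refl])
    fix \<eta>
    have "(LINT x|lborel. \<theta> x * ?k (x, \<eta>)) = osc \<kappa> \<theta> \<xi> \<eta>"
      unfolding osc_def
    proof (rule Bochner_Integration.integral_cong[OF refl])
      fix x
      show "\<theta> x * ?k (x, \<eta>) = exp (\<i> * of_real (\<kappa> x \<bullet> \<eta> - x \<bullet> \<xi>)) * \<theta> x"
        using eq[of x "\<lambda>y. exp (\<i> * of_real (y \<bullet> \<eta> - x \<bullet> \<xi>))"] by (simp add: mult.commute)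
    qed
    then show "fourier v \<eta> * (LINT x|lborel. \<theta> x * ?k (x, \<eta>)) = fourier v \<eta> * osc \<kappa> \<theta> \<xi> \<eta>" by simp
  qed
  finally show ?thesis .
qed

text \<open>Here \<open>x = |\<xi>|\<close>, \<open>y = |\<eta>|\<close>, \<open>a = |Fv(\<eta>)|\<close> and \<open>c = |osc \<kappa> \<theta> \<xi> \<eta>|\<close>. The case \<open>P\<close> is that of
  \<open>\<eta>\<close> outside the cone of decay of \<open>Fv\<close> or small compared with \<open>\<xi>\<close>, where \<open>c\<close> decays.\<close>

lemma pullback_weight_bound:
  fixes x y \<delta> :: real
  assumes b: "0 \<le> x" "0 \<le> y" "0 < \<delta>" "\<delta> \<le> 1" "0 \<le> a" "0 \<le> c" "0 \<le> C" "0 \<le> A" "0 \<le> D" "0 \<le> B"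
    and "a \<le> D" "c \<le> B"
    and case1: "P \<Longrightarrow> (1 + (x\<^sup>2 + y\<^sup>2)) ^ (l + n) * c \<le> C"
    and case2: "\<not> P \<Longrightarrow> \<delta> * x \<le> y" "\<not> P \<Longrightarrow> (1 + y\<^sup>2) ^ (l + n) * a \<le> A"
  shows "(1 + x\<^sup>2) ^ l * (a * c) \<le> (C + B / \<delta> ^ (2 * l)) * (A + D) * inverse ((1 + y\<^sup>2) ^ n)"
proof -
  have pos: "(1 + y\<^sup>2) ^ n > 0" by (intro zero_less_power) (smt (verit) zero_le_power2)
  have x1: "1 + x\<^sup>2 \<ge> 1" "1 + y\<^sup>2 \<ge> 1" by auto
  have "(1 + x\<^sup>2) ^ l * (1 + y\<^sup>2) ^ n * (a * c) \<le> C * D + B / \<delta> ^ (2 * l) * A"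
  proof (cases P)
    case True
    have "(1 + x\<^sup>2) ^ l * (1 + y\<^sup>2) ^ n \<le> (1 + (x\<^sup>2 + y\<^sup>2)) ^ l * (1 + (x\<^sup>2 + y\<^sup>2)) ^ n"
      by (intro mult_mono power_mono) auto
    then have "(1 + x\<^sup>2) ^ l * (1 + y\<^sup>2) ^ n * (a * c) \<le> (1 + (x\<^sup>2 + y\<^sup>2)) ^ (l + n) * (a * c)"
      using b by (intro mult_right_mono) (auto simp: power_add)
    also have "\<dots> = a * ((1 + (x\<^sup>2 + y\<^sup>2)) ^ (l + n) * c)" by (simp only: mult_ac)
    also have "\<dots> \<le> D * C" using case1[OF True] \<open>a \<le> D\<close> b by (intro mult_mono) auto
    also have "\<dots> \<le> C * D + B / \<delta> ^ (2 * l) * A" using b by (simp add: mult.commute)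
    finally show ?thesis .
  next
    case False
    have "(\<delta> * x)\<^sup>2 \<le> y\<^sup>2" using case2(1)[OF False] b by (intro power_mono) auto
    moreover have "\<delta>\<^sup>2 \<le> 1" using b by (simp add: power_le_one)
    ultimately have "\<delta>\<^sup>2 * (1 + x\<^sup>2) \<le> 1 + y\<^sup>2" by (simp add: algebra_simps power_mult_distrib)
    then have "1 + x\<^sup>2 \<le> (1 + y\<^sup>2) / \<delta>\<^sup>2" using b by (simp add: field_simps)
    then have "(1 + x\<^sup>2) ^ l \<le> ((1 + y\<^sup>2) / \<delta>\<^sup>2) ^ l" by (intro power_mono) auto
    also have "\<dots> = (1 + y\<^sup>2) ^ l / \<delta> ^ (2 * l)" by (simp add: power_divide power_mult)
    finally have "(1 + x\<^sup>2) ^ l * (1 + y\<^sup>2) ^ n * (a * c) \<le> (1 + y\<^sup>2) ^ l / \<delta> ^ (2 * l) * (1 + y\<^sup>2) ^ n * (a * c)"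
      using b pos by (intro mult_right_mono) auto
    also have "\<dots> = c / \<delta> ^ (2 * l) * ((1 + y\<^sup>2) ^ (l + n) * a)" by (simp add: power_add)
    also have "\<dots> \<le> B / \<delta> ^ (2 * l) * A"
      using case2(2)[OF False] \<open>c \<le> B\<close> b by (intro mult_mono divide_right_mono) auto
    also have "\<dots> \<le> C * D + B / \<delta> ^ (2 * l) * A" using b by simp
    finally show ?thesis .
  qed
  also have "\<dots> \<le> (C + B / \<delta> ^ (2 * l)) * (A + D)"
  proof -
    have "C * D + q * A \<le> (C + q) * (A + D)" if "q \<ge> 0" for q
      using b mult_nonneg_nonneg[OF \<open>0 \<le> C\<close> \<open>0 \<le> A\<close>] mult_nonneg_nonneg[OF that \<open>0 \<le> D\<close>]
      by (simp add: algebra_simps)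
    from this[of "B / \<delta> ^ (2 * l)"] show ?thesis using b by simp
  qed
  finally have "(1 + x\<^sup>2) ^ l * (a * c) * (1 + y\<^sup>2) ^ n \<le> (C + B / \<delta> ^ (2 * l)) * (A + D)" by (simp only: mult_ac)
  then show ?thesis using pos by (simp add: field_simps)
qed

text \<open>\<open>C\<close> is chosen before \<open>v\<close>, \<open>K\<close>, \<open>A\<close>
  and \<open>D\<close>, so that one constant serves all members of a net. The \<open>DIM('a)\<close>
  additional powers in the hypothesis on \<open>\<Gamma>\<close> pay for the integration over
  \<open>\<eta>\<close>.\<close>

lemma pullback_decay:
  fixes \<kappa> :: "'a::euclidean_space \<Rightarrow> 'a"
  assumes \<Omega>: "open \<Omega>" "x0 \<in> \<Omega>" and \<kappa>: "\<And>k. Ck k \<Omega> \<kappa>"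
    and T: "linear T" "inj T" "\<And>h \<eta>. frechet_derivative \<kappa> (at x0) h \<bullet> \<eta> = h \<bullet> T \<eta>"
    and \<Gamma>: "conic_neighborhood \<Gamma> \<eta>0"
  obtains \<Gamma>' r where "conic_neighborhood \<Gamma>' (T \<eta>0)" "r > 0" "cball x0 r \<subseteq> \<Omega>"
    "\<And>\<theta> l. (\<And>k. Ck k UNIV \<theta>) \<Longrightarrow> (\<And>x. x \<notin> cball x0 r \<Longrightarrow> \<theta> x = 0) \<Longrightarrow>
      \<exists>C\<ge>0. \<forall>v K A D. (\<forall>k. Ck k UNIV v) \<longrightarrow> compact K \<longrightarrow> (\<forall>x. x \<notin> K \<longrightarrow> v x = 0) \<longrightarrow>
        (\<forall>\<eta>\<in>\<Gamma>. (1 + (norm \<eta>)\<^sup>2) ^ (l + DIM('a)) * norm (fourier v \<eta>) \<le> A) \<longrightarrow>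
        (\<forall>\<eta>. norm (fourier v \<eta>) \<le> D) \<longrightarrow>
        (\<forall>\<xi>\<in>\<Gamma>'. (1 + (norm \<xi>)\<^sup>2) ^ l * norm (fourier (\<lambda>x. \<theta> x * v (\<kappa> x)) \<xi>) \<le> C * (A + D))"
proof -
  obtain \<Gamma>' r \<delta> where *: "conic_neighborhood \<Gamma>' (T \<eta>0)" "r > 0" "cball x0 r \<subseteq> \<Omega>" "0 < \<delta>" "\<delta> \<le> 1"
    and **: "\<And>\<theta> l. (\<And>k. Ck k UNIV \<theta>) \<Longrightarrow> (\<And>x. x \<notin> cball x0 r \<Longrightarrow> \<theta> x = 0) \<Longrightarrow>
      \<exists>C. \<forall>\<xi>\<in>\<Gamma>'. \<forall>\<eta>. \<eta> \<notin> \<Gamma> \<or> norm \<eta> \<le> \<delta> * norm \<xi> \<longrightarrow>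
        (1 + ((norm \<xi>)\<^sup>2 + (norm \<eta>)\<^sup>2)) ^ l * norm (osc \<kappa> \<theta> \<xi> \<eta>) \<le> C"
    using osc_decay[OF \<Omega> \<kappa> T \<Gamma>] by metis
  show thesis
  proof (rule that[OF *(1-3)])
    fix \<theta> :: "'a \<Rightarrow> complex" and l :: nat
    assume \<theta>: "\<And>k. Ck k UNIV \<theta>" "\<And>x. x \<notin> cball x0 r \<Longrightarrow> \<theta> x = 0"
    let ?n = "DIM('a)"
    obtain C where C: "\<And>\<xi> \<eta>. \<xi> \<in> \<Gamma>' \<Longrightarrow> \<eta> \<notin> \<Gamma> \<or> norm \<eta> \<le> \<delta> * norm \<xi> \<Longrightarrow>
        (1 + ((norm \<xi>)\<^sup>2 + (norm \<eta>)\<^sup>2)) ^ (l + ?n) * norm (osc \<kappa> \<theta> \<xi> \<eta>) \<le> C"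
      using **[OF \<theta>, of "l + ?n"] by blast
    have i\<theta>: "integrable lborel \<theta>"
      by (rule integrable_compact_support[OF Ck_continuous_on[OF \<theta>(1)] compact_cball \<theta>(2)])
    define B where "B = (LINT x|lborel. norm (\<theta> x))"
    have B: "B \<ge> 0" "\<And>\<xi> \<eta>. norm (osc \<kappa> \<theta> \<xi> \<eta>) \<le> B"
      using norm_osc_le[OF i\<theta>] by (auto simp: B_def)
    define I where "I = (LINT \<xi>|lborel. inverse ((1 + (norm (\<xi>::'a))\<^sup>2) ^ ?n))"
    have I: "I \<ge> 0" unfolding I_def by (intro integral_nonneg_AE AE_I2) auto
    define C' where "C' = (max 0 C + B / \<delta> ^ (2 * l)) * I / (2 * pi) ^ ?n"
    have "C' \<ge> 0" unfolding C'_def using B I *(4) by auto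
    moreover have "(1 + (norm \<xi>)\<^sup>2) ^ l * norm (fourier (\<lambda>x. \<theta> x * v (\<kappa> x)) \<xi>) \<le> C' * (A + D)"
      if v: "\<forall>k. Ck k UNIV v" and K: "compact K" and v0: "\<forall>x. x \<notin> K \<longrightarrow> v x = 0"
        and A: "\<forall>\<eta>\<in>\<Gamma>. (1 + (norm \<eta>)\<^sup>2) ^ (l + ?n) * norm (fourier v \<eta>) \<le> A"
        and D: "\<forall>\<eta>. norm (fourier v \<eta>) \<le> D" and \<xi>: "\<xi> \<in> \<Gamma>'" for v K A D \<xi>
    proof -
      \<comment> \<open>The cone is nonempty, which makes any admissible \<open>A\<close>
        nonnegative.\<close>
      have "\<eta>0 \<in> \<Gamma>" using \<Gamma> interior_subset by (auto simp: conic_neighborhood_def)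
      then have A0: "A \<ge> 0" using A by (smt (verit) mult_nonneg_nonneg norm_ge_zero zero_le_power zero_le_power2)
      have D0: "D \<ge> 0" using D norm_ge_zero order.trans by blast
      have bound: "(1 + (norm \<xi>)\<^sup>2) ^ l * (norm (fourier v \<eta>) * norm (osc \<kappa> \<theta> \<xi> \<eta>))
        \<le> (max 0 C + B / \<delta> ^ (2 * l)) * (A + D) * inverse ((1 + (norm \<eta>)\<^sup>2) ^ ?n)" for \<eta>
      proof (rule pullback_weight_bound[where P="\<eta> \<notin> \<Gamma> \<or> norm \<eta> \<le> \<delta> * norm \<xi>"])
        show "(1 + ((norm \<xi>)\<^sup>2 + (norm \<eta>)\<^sup>2)) ^ (l + ?n) * norm (osc \<kappa> \<theta> \<xi> \<eta>) \<le> max 0 C"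
          if "\<eta> \<notin> \<Gamma> \<or> norm \<eta> \<le> \<delta> * norm \<xi>"
          using C[OF \<xi> that] by simp
      qed (use A D A0 D0 B * in auto)
      have iK: "(2 * pi) ^ ?n * norm (fourier (\<lambda>x. \<theta> x * v (\<kappa> x)) \<xi>)
          = norm (LINT \<eta>|lborel. fourier v \<eta> * osc \<kappa> \<theta> \<xi> \<eta>)"
      proof -
        have "of_real (2 * pi) ^ ?n * fourier (\<lambda>x. \<theta> x * v (\<kappa> x)) \<xi> = (LINT \<eta>|lborel. fourier v \<eta> * osc \<kappa> \<theta> \<xi> \<eta>)"
          by (rule fourier_pullback[OF \<Omega>(1) Ck_continuous_on[OF \<kappa>] i\<theta> _ _ K])
            (use \<theta>(2) *(3) v v0 in \<open>auto simp del: mem_cball\<close>)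
        moreover have "norm (of_real (2 * pi) ^ ?n * fourier (\<lambda>x. \<theta> x * v (\<kappa> x)) \<xi>)
          = (2 * pi) ^ ?n * norm (fourier (\<lambda>x. \<theta> x * v (\<kappa> x)) \<xi>)"
          unfolding norm_mult norm_power norm_of_real by simp
        ultimately show ?thesis by simp
      qed
      have "(1 + (norm \<xi>)\<^sup>2) ^ l * norm (LINT \<eta>|lborel. fourier v \<eta> * osc \<kappa> \<theta> \<xi> \<eta>)
          \<le> (1 + (norm \<xi>)\<^sup>2) ^ l * (LINT \<eta>|lborel. norm (fourier v \<eta> * osc \<kappa> \<theta> \<xi> \<eta>))"
        by (intro mult_left_mono integral_norm_bound) auto
      also have "\<dots> = (LINT \<eta>|lborel. (1 + (norm \<xi>)\<^sup>2) ^ l * (norm (fourier v \<eta>) * norm (osc \<kappa> \<theta> \<xi> \<eta>)))"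
        by (simp add: norm_mult)
      also have "\<dots> \<le> (LINT \<eta>|lborel. (max 0 C + B / \<delta> ^ (2 * l)) * (A + D) * inverse ((1 + (norm (\<eta>::'a))\<^sup>2) ^ ?n))"
      proof (rule integral_mono')
        show "integrable lborel (\<lambda>\<eta>::'a. (max 0 C + B / \<delta> ^ (2 * l)) * (A + D) * inverse ((1 + (norm \<eta>)\<^sup>2) ^ ?n))"
          using integrable_inverse_power_norm[where 'a='a] by simp
        show "0 \<le> (max 0 C + B / \<delta> ^ (2 * l)) * (A + D) * inverse ((1 + (norm \<eta>)\<^sup>2) ^ ?n)" for \<eta> :: 'a
          using B(1) *(4) A0 D0 by (intro mult_nonneg_nonneg) auto
      qed (rule bound)
      also have "\<dots> = (max 0 C + B / \<delta> ^ (2 * l)) * (A + D) * I" by (simp add: I_def)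
      finally have "(1 + (norm \<xi>)\<^sup>2) ^ l * ((2 * pi) ^ ?n * norm (fourier (\<lambda>x. \<theta> x * v (\<kappa> x)) \<xi>))
          \<le> (max 0 C + B / \<delta> ^ (2 * l)) * (A + D) * I" by (simp only: iK)
      then show ?thesis by (simp add: C'_def field_simps)
    qed
    ultimately show "\<exists>C\<ge>0. \<forall>v K A D. (\<forall>k. Ck k UNIV v) \<longrightarrow> compact K \<longrightarrow> (\<forall>x. x \<notin> K \<longrightarrow> v x = 0) \<longrightarrow>
        (\<forall>\<eta>\<in>\<Gamma>. (1 + (norm \<eta>)\<^sup>2) ^ (l + DIM('a)) * norm (fourier v \<eta>) \<le> A) \<longrightarrow>
        (\<forall>\<eta>. norm (fourier v \<eta>) \<le> D) \<longrightarrow>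
        (\<forall>\<xi>\<in>\<Gamma>'. (1 + (norm \<xi>)\<^sup>2) ^ l * norm (fourier (\<lambda>x. \<theta> x * v (\<kappa> x)) \<xi>) \<le> C * (A + D))"
      by (intro exI[of _ C']) blast
  qed
qed

section \<open>Moderate and negligible nets\<close>

definition smooth_net :: "'a::euclidean_space set \<Rightarrow> 'a net \<Rightarrow> bool" where
  "smooth_net S u \<longleftrightarrow> (\<forall>\<epsilon>\<in>{0<..1}. \<forall>k. Ck k S (u \<epsilon>))"

text \<open>A pointwise estimate with one constant replaces suprema and Landau symbols, so that
  sums, products and substitutions are elementary; \<open>net_bound_iff_bigo\<close> translates
  back.\<close>

definition net_bound :: "'a::euclidean_space set \<Rightarrow> 'a net \<Rightarrow> real \<Rightarrow> bool" where
  "net_bound K u p \<longleftrightarrow> (\<exists>C\<ge>0. \<forall>\<^sub>F \<epsilon> in at_right 0. \<forall>x\<in>K. norm (u \<epsilon> x) \<le> C * \<epsilon> powr p)"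

text \<open>Recursive in the order, in parallel to \<open>Ck\<close>, so that the Leibniz and chain
  rules can be used in inductions.\<close>

primrec moderate_upto :: "nat \<Rightarrow> 'a::euclidean_space set \<Rightarrow> 'a net \<Rightarrow> bool" where
  "moderate_upto 0 S u \<longleftrightarrow> (\<forall>K. compact K \<and> K \<subseteq> S \<longrightarrow> (\<exists>p. net_bound K u (- p)))"
| "moderate_upto (Suc k) S u \<longleftrightarrow> (\<forall>K. compact K \<and> K \<subseteq> S \<longrightarrow> (\<exists>p. net_bound K u (- p))) \<and> (\<forall>b\<in>Basis. moderate_upto k S (\<lambda>\<epsilon>. partial_deriv b (u \<epsilon>)))"

text \<open>Only the values are estimated, as in \<open>negligible_nets\<close>; moderateness of the
  derivatives is tracked separately.\<close>

definition negligible0 :: "'a::euclidean_space set \<Rightarrow> 'a net \<Rightarrow> bool" where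
  "negligible0 S u \<longleftrightarrow> (\<forall>K q. compact K \<and> K \<subseteq> S \<longrightarrow> net_bound K u q)"

lemma eventually_unit_interval: "\<forall>\<^sub>F \<epsilon> in at_right (0::real). \<epsilon> \<in> {0<..1}"
  unfolding eventually_at_right_field by (auto intro!: exI[of _ 1])

lemma smooth_netD: "smooth_net S u \<Longrightarrow> \<epsilon> \<in> {0<..1} \<Longrightarrow> Ck k S (u \<epsilon>)"
  unfolding smooth_net_def by blast

lemma smooth_net_differentiable:
  "smooth_net S u \<Longrightarrow> \<epsilon> \<in> {0<..1} \<Longrightarrow> x \<in> S \<Longrightarrow> u \<epsilon> differentiable at x"
  using smooth_netD[of S u \<epsilon> 1] by auto

lemma smooth_net_partial_deriv:
  assumes "smooth_net S u" "b \<in> Basis"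
  shows "smooth_net S (\<lambda>\<epsilon>. partial_deriv b (u \<epsilon>))"
  unfolding smooth_net_def
  by (intro ballI allI) (rule Ck_partial_deriv[OF smooth_netD[OF assms(1)] assms(2)])

text \<open>Continuity on the compact set bounds the values for each \<open>\<epsilon>\<close>;
  otherwise the \<open>SUP\<close> in \<open>sup_norm_on\<close> would carry no information about
  them.\<close>

lemma net_bound_iff_bigo:
  assumes K: "compact K" and c: "\<And>\<epsilon>. \<epsilon> \<in> {0<..1} \<Longrightarrow> continuous_on K (u \<epsilon>)"
  shows "(\<lambda>\<epsilon>. sup_norm_on K (u \<epsilon>)) \<in> O[at_right 0](\<lambda>\<epsilon>. \<epsilon> powr p) \<longleftrightarrow> net_bound K u p"
proof
  assume "(\<lambda>\<epsilon>. sup_norm_on K (u \<epsilon>)) \<in> O[at_right 0](\<lambda>\<epsilon>. \<epsilon> powr p)"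
  then obtain C where C: "C > 0" "\<forall>\<^sub>F \<epsilon> in at_right 0. norm (sup_norm_on K (u \<epsilon>)) \<le> C * norm (\<epsilon> powr p)"
    by (elim landau_o.bigE)
  have "\<forall>\<^sub>F \<epsilon> in at_right 0. \<forall>x\<in>K. norm (u \<epsilon> x) \<le> C * \<epsilon> powr p"
    using C(2) eventually_unit_interval
  proof eventually_elim
    case (elim \<epsilon>)
    have bdd: "bdd_above ((\<lambda>x. norm (u \<epsilon> x)) ` K)"
      using K c[OF elim(2)] by (intro bounded_imp_bdd_above compact_imp_bounded compact_continuous_image continuous_on_norm)
    show ?case
    proof
      fix x assume x: "x \<in> K"
      then have "norm (u \<epsilon> x) \<le> sup_norm_on K (u \<epsilon>)"
        unfolding sup_norm_on_def using cSUP_upper[OF x bdd] by auto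
      also have "\<dots> \<le> C * \<epsilon> powr p" using elim(1) by simp
      finally show "norm (u \<epsilon> x) \<le> C * \<epsilon> powr p" .
    qed
  qed
  then show "net_bound K u p" unfolding net_bound_def using C(1) by (intro exI[of _ C]) auto
next
  assume "net_bound K u p"
  then obtain C where C: "C \<ge> 0" "\<forall>\<^sub>F \<epsilon> in at_right 0. \<forall>x\<in>K. norm (u \<epsilon> x) \<le> C * \<epsilon> powr p"
    unfolding net_bound_def by blast
  show "(\<lambda>\<epsilon>. sup_norm_on K (u \<epsilon>)) \<in> O[at_right 0](\<lambda>\<epsilon>. \<epsilon> powr p)"
  \<comment> \<open>The Landau rule asks for a positive constant, while \<open>C\<close> may be
    0.\<close>
  proof (rule landau_o.bigI[of "max C 1"])
    show "\<forall>\<^sub>F \<epsilon> in at_right 0. norm (sup_norm_on K (u \<epsilon>)) \<le> max C 1 * norm (\<epsilon> powr p)"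
      using C(2)
    proof eventually_elim
      case (elim \<epsilon>)
      show ?case
      proof (cases "K = {}")
        case False
        then obtain x where x: "x \<in> K" by blast
        have le: "norm (u \<epsilon> x) \<le> max C 1 * \<epsilon> powr p" if "x \<in> K" for x
          using elim that order.trans mult_right_mono[of C "max C 1" "\<epsilon> powr p"] by fastforce
        have "(SUP x\<in>K. norm (u \<epsilon> x)) \<le> max C 1 * \<epsilon> powr p"
          using le False by (intro cSUP_least)
        moreover have "0 \<le> (SUP x\<in>K. norm (u \<epsilon> x))"
          by (rule order.trans[OF norm_ge_zero cSUP_upper[OF x]]) (use le in \<open>auto intro!: bdd_aboveI2\<close>)
        ultimately show ?thesis using False by (simp add: sup_norm_on_def)
      qed (simp add: sup_norm_on_def)
    qed
  qed simp
qed

section \<open>Calculus of order estimates\<close>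

lemma net_bound_cong:
  assumes "\<And>\<epsilon> x. \<epsilon> \<in> {0<..1} \<Longrightarrow> x \<in> K \<Longrightarrow> u \<epsilon> x = w \<epsilon> x" "net_bound K u p"
  shows "net_bound K w p"
proof -
  obtain C where C: "C \<ge> 0" "\<forall>\<^sub>F \<epsilon> in at_right 0. \<forall>x\<in>K. norm (u \<epsilon> x) \<le> C * \<epsilon> powr p"
    using assms(2) unfolding net_bound_def by blast
  have "\<forall>\<^sub>F \<epsilon> in at_right 0. \<forall>x\<in>K. norm (w \<epsilon> x) \<le> C * \<epsilon> powr p"
    using C(2) eventually_unit_interval by eventually_elim (use assms(1) in auto)
  then show ?thesis using C(1) unfolding net_bound_def by blast
qed

lemma net_bound_mono:
  assumes "net_bound K u p" "q \<le> p"
  shows "net_bound K u q"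
proof -
  obtain C where C: "C \<ge> 0" "\<forall>\<^sub>F \<epsilon> in at_right 0. \<forall>x\<in>K. norm (u \<epsilon> x) \<le> C * \<epsilon> powr p"
    using assms(1) unfolding net_bound_def by blast
  have "\<forall>\<^sub>F \<epsilon> in at_right 0. \<forall>x\<in>K. norm (u \<epsilon> x) \<le> C * \<epsilon> powr q"
    using C(2) eventually_unit_interval
  proof eventually_elim
    case (elim \<epsilon>)
    then have "\<epsilon> powr p \<le> \<epsilon> powr q" using assms(2) by (intro powr_mono') auto
    then have "C * \<epsilon> powr p \<le> C * \<epsilon> powr q" using C(1) by (rule mult_left_mono)
    then show ?case using elim by force
  qed
  then show ?thesis using C(1) unfolding net_bound_def by blast
qed

lemma net_bound_add:
  assumes "net_bound K u p" "net_bound K w p"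
  shows "net_bound K (\<lambda>\<epsilon> x. u \<epsilon> x + w \<epsilon> x) p"
proof -
  obtain C where C: "C \<ge> 0" "\<forall>\<^sub>F \<epsilon> in at_right 0. \<forall>x\<in>K. norm (u \<epsilon> x) \<le> C * \<epsilon> powr p"
    using assms(1) unfolding net_bound_def by blast
  obtain D where D: "D \<ge> 0" "\<forall>\<^sub>F \<epsilon> in at_right 0. \<forall>x\<in>K. norm (w \<epsilon> x) \<le> D * \<epsilon> powr p"
    using assms(2) unfolding net_bound_def by blast
  have "\<forall>\<^sub>F \<epsilon> in at_right 0. \<forall>x\<in>K. norm (u \<epsilon> x + w \<epsilon> x) \<le> (C + D) * \<epsilon> powr p"
    using C(2) D(2)
    by eventually_elim (auto simp: distrib_right intro!: order.trans[OF norm_triangle_ineq add_mono])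
  then show ?thesis using C(1) D(1) unfolding net_bound_def by (intro exI[of _ "C + D"]) auto
qed

lemma net_bound_mult:
  assumes K: "compact K" and a: "continuous_on K a" and u: "net_bound K u p"
  shows "net_bound K (\<lambda>\<epsilon> x. a x * u \<epsilon> x) p"
proof -
  have "bounded (a ` K)" using K a by (intro compact_imp_bounded compact_continuous_image)
  then obtain B where B: "B > 0" "\<forall>x\<in>K. norm (a x) \<le> B" by (auto simp: bounded_pos)
  obtain C where C: "C \<ge> 0" "\<forall>\<^sub>F \<epsilon> in at_right 0. \<forall>x\<in>K. norm (u \<epsilon> x) \<le> C * \<epsilon> powr p"
    using u unfolding net_bound_def by blast
  have "\<forall>\<^sub>F \<epsilon> in at_right 0. \<forall>x\<in>K. norm (a x * u \<epsilon> x) \<le> (B * C) * \<epsilon> powr p"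
    using C(2)
  proof eventually_elim
    case (elim \<epsilon>)
    show ?case
    proof
      fix x assume "x \<in> K"
      then have "norm (a x) * norm (u \<epsilon> x) \<le> B * (C * \<epsilon> powr p)"
        using B elim by (intro mult_mono) auto
      then show "norm (a x * u \<epsilon> x) \<le> (B * C) * \<epsilon> powr p" by (simp add: norm_mult)
    qed
  qed
  then show ?thesis using C(1) B(1) unfolding net_bound_def by (intro exI[of _ "B * C"]) auto
qed

lemma net_bound_compose: "net_bound (\<kappa> ` K) u p \<Longrightarrow> net_bound K (\<lambda>\<epsilon> x. u \<epsilon> (\<kappa> x)) p"
  unfolding net_bound_def by simp

text \<open>The Leibniz and chain rules hold only at points of \<open>S\<close> and for
  \<open>\<epsilon>\<close> in the unit interval. This is how they enter the inductions
  below.\<close>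

lemma moderate_upto_cong:
  assumes "open S"
  shows "(\<And>\<epsilon> x. \<epsilon> \<in> {0<..1} \<Longrightarrow> x \<in> S \<Longrightarrow> u \<epsilon> x = w \<epsilon> x) \<Longrightarrow> moderate_upto k S u \<Longrightarrow> moderate_upto k S w"
proof (induction k arbitrary: u w)
  case 0
  then show ?case using net_bound_cong[of _ u w] by (auto simp: subset_iff) metis
next
  case (Suc k)
  have "moderate_upto 0 S w"
    using net_bound_cong[of _ u w] Suc.prems by (auto simp: subset_iff) metis
  moreover have "moderate_upto k S (\<lambda>\<epsilon>. partial_deriv b (w \<epsilon>))" if "b \<in> Basis" for b
  proof (rule Suc.IH)
    show "partial_deriv b (u \<epsilon>) x = partial_deriv b (w \<epsilon>) x" if "\<epsilon> \<in> {0<..1}" "x \<in> S" for \<epsilon> x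
      by (rule partial_deriv_cong[OF \<open>open S\<close>]) (use that Suc.prems(1) in auto)
  qed (use that Suc.prems in auto)
  ultimately show ?case by simp
qed

lemma moderate_upto_0D:
  "moderate_upto 0 S u \<Longrightarrow> compact K \<Longrightarrow> K \<subseteq> S \<Longrightarrow> \<exists>p. net_bound K u (- p)"
  by simp

lemma moderate_upto_0I: "moderate_upto k S u \<Longrightarrow> moderate_upto 0 S u"
  by (cases k) simp_all

lemma moderate_upto_SucD: "moderate_upto (Suc k) S u \<Longrightarrow> moderate_upto k S u"
proof (induction k arbitrary: u)
  case (Suc k)
  from Suc.prems have "moderate_upto k S (\<lambda>\<epsilon>. partial_deriv b (u \<epsilon>))" if "b \<in> Basis" for b
    using that by (intro Suc.IH) simp
  with Suc.prems show ?case by simp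
qed simp

lemma moderate_upto_add:
  assumes "open S"
  shows "smooth_net S u \<Longrightarrow> smooth_net S w \<Longrightarrow> moderate_upto k S u \<Longrightarrow> moderate_upto k S w \<Longrightarrow>
    moderate_upto k S (\<lambda>\<epsilon> x. u \<epsilon> x + w \<epsilon> x)"
proof (induction k arbitrary: u w)
  case 0
  have "\<exists>p. net_bound K (\<lambda>\<epsilon> x. u \<epsilon> x + w \<epsilon> x) (- p)" if K: "compact K" "K \<subseteq> S" for K
  proof -
    obtain p q where pq: "net_bound K u (- p)" "net_bound K w (- q)"
      using moderate_upto_0D[OF 0(3) K] moderate_upto_0D[OF 0(4) K] by blast
    have "net_bound K (\<lambda>\<epsilon> x. u \<epsilon> x + w \<epsilon> x) (- max p q)"
      by (intro net_bound_add net_bound_mono[OF pq(1)] net_bound_mono[OF pq(2)]) auto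
    then show ?thesis ..
  qed
  then show ?case by simp
next
  case (Suc k)
  have "moderate_upto k S (\<lambda>\<epsilon>. partial_deriv b (\<lambda>x. u \<epsilon> x + w \<epsilon> x))" if b: "b \<in> Basis" for b
  proof (rule moderate_upto_cong[OF \<open>open S\<close>])
    show "moderate_upto k S (\<lambda>\<epsilon> x. partial_deriv b (u \<epsilon>) x + partial_deriv b (w \<epsilon>) x)"
      using Suc b by (intro Suc.IH smooth_net_partial_deriv) auto
    show "partial_deriv b (u \<epsilon>) x + partial_deriv b (w \<epsilon>) x = partial_deriv b (\<lambda>x. u \<epsilon> x + w \<epsilon> x) x"
      if "\<epsilon> \<in> {0<..1}" "x \<in> S" for \<epsilon> x
    proof -
      have "((\<lambda>x. u \<epsilon> x + w \<epsilon> x) has_derivative (\<lambda>h. frechet_derivative (u \<epsilon>) (at x) h + frechet_derivative (w \<epsilon>) (at x) h)) (at x)"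
        using smooth_net_differentiable[OF Suc.prems(1) that] smooth_net_differentiable[OF Suc.prems(2) that]
        by (intro has_derivative_add) (auto simp: frechet_derivative_works)
      then show ?thesis by (simp add: partial_deriv_eq) (simp add: partial_deriv_def)
    qed
  qed
  moreover have "moderate_upto 0 S (\<lambda>\<epsilon> x. u \<epsilon> x + w \<epsilon> x)"
    using Suc.IH[OF Suc.prems(1,2) Suc.prems(3,4)[THEN moderate_upto_SucD]] by (rule moderate_upto_0I)
  ultimately show ?case by simp
qed

lemma smooth_net_add: "open S \<Longrightarrow> smooth_net S u \<Longrightarrow> smooth_net S w \<Longrightarrow> smooth_net S (\<lambda>\<epsilon> x. u \<epsilon> x + w \<epsilon> x)"
  unfolding smooth_net_def by (intro ballI allI) (rule Ck_add, auto)

lemma smooth_net_mult: "open S \<Longrightarrow> (\<And>k. Ck k S a) \<Longrightarrow> smooth_net S u \<Longrightarrow> smooth_net S (\<lambda>\<epsilon> x. a x * u \<epsilon> x)"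
  unfolding smooth_net_def by (intro ballI allI) (rule Ck_mult, auto)

lemma smooth_net_compose:
  assumes "open S" "open T" "\<And>x. x \<in> S \<Longrightarrow> \<kappa> x \<in> T" "\<And>k. Ck k S \<kappa>" "smooth_net T u"
  shows "smooth_net S (\<lambda>\<epsilon> x. u \<epsilon> (\<kappa> x))"
  unfolding smooth_net_def
  by (intro ballI allI) (rule Ck_compose[OF assms(1,2,3) smooth_netD[OF assms(5)] assms(4)])

lemma moderate_upto_mult:
  assumes "open S"
  shows "(\<And>k. Ck k S a) \<Longrightarrow> smooth_net S u \<Longrightarrow> moderate_upto k S u \<Longrightarrow>
    moderate_upto k S (\<lambda>\<epsilon> x. a x * u \<epsilon> x)"
proof (induction k arbitrary: a u)
  case 0
  have "\<exists>p. net_bound K (\<lambda>\<epsilon> x. a x * u \<epsilon> x) (- p)" if K: "compact K" "K \<subseteq> S" for K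
    using net_bound_mult[OF K(1) continuous_on_subset[OF Ck_continuous_on[OF 0(1)] K(2)]]
      moderate_upto_0D[OF 0(3) K] by blast
  then show ?case by simp
next
  case (Suc k)
  have "moderate_upto k S (\<lambda>\<epsilon>. partial_deriv b (\<lambda>x. a x * u \<epsilon> x))" if b: "b \<in> Basis" for b
  proof (rule moderate_upto_cong[OF \<open>open S\<close>])
    show "moderate_upto k S (\<lambda>\<epsilon> x. a x * partial_deriv b (u \<epsilon>) x + partial_deriv b a x * u \<epsilon> x)"
      using Suc.prems b Ck_partial_deriv[OF Suc.prems(1) b] moderate_upto_SucD[OF Suc.prems(3)]
      by (intro moderate_upto_add Suc.IH smooth_net_partial_deriv smooth_net_mult \<open>open S\<close>) auto
    show "a x * partial_deriv b (u \<epsilon>) x + partial_deriv b a x * u \<epsilon> x = partial_deriv b (\<lambda>x. a x * u \<epsilon> x) x"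
      if "\<epsilon> \<in> {0<..1}" "x \<in> S" for \<epsilon> x
      using smooth_net_differentiable[OF Suc.prems(2) that] Suc.prems(1)[of 1] that
      by (subst partial_deriv_mult) auto
  qed
  moreover have "moderate_upto 0 S (\<lambda>\<epsilon> x. a x * u \<epsilon> x)"
    using Suc.IH[OF Suc.prems(1,2) Suc.prems(3)[THEN moderate_upto_SucD]] by (rule moderate_upto_0I)
  ultimately show ?case by simp
qed

lemma moderate_upto_zero: "moderate_upto k S (\<lambda>\<epsilon> x. 0)"
proof (induction k)
  case 0
  show ?case by (auto simp: net_bound_def intro!: exI[of _ 0])
next
  case (Suc k)
  have "(\<lambda>\<epsilon>::real. partial_deriv b (\<lambda>x::'a. 0::complex)) = (\<lambda>\<epsilon> x. 0)" for b
    by (intro ext partial_deriv_const)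
  then show ?case using Suc moderate_upto_0I[OF Suc] by simp
qed

lemma smooth_net_zero: "open S \<Longrightarrow> smooth_net S (\<lambda>\<epsilon> x. 0)"
  unfolding smooth_net_def by (intro ballI allI) (rule Ck_const)

lemma smooth_moderate_sum:
  assumes "open S" "finite I" "\<And>i. i \<in> I \<Longrightarrow> smooth_net S (u i)" "\<And>i. i \<in> I \<Longrightarrow> moderate_upto k S (u i)"
  shows "smooth_net S (\<lambda>\<epsilon> x. \<Sum>i\<in>I. u i \<epsilon> x) \<and> moderate_upto k S (\<lambda>\<epsilon> x. \<Sum>i\<in>I. u i \<epsilon> x)"
  using assms(2-4)
proof (induction I rule: finite_induct)
  case empty
  then show ?case by (simp add: smooth_net_zero[OF assms(1)] moderate_upto_zero)
next
  case (insert i I)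
  then show ?case
    by (simp add: smooth_net_add[OF assms(1)] moderate_upto_add[OF assms(1)])
qed

text \<open>By the chain rule, a derivative of the composite is a finite sum of smooth functions
  times composites of derivatives of the net, to which the induction hypothesis applies.\<close>

lemma moderate_upto_compose:
  assumes S: "open S" "open T" and \<kappa>: "\<And>x. x \<in> S \<Longrightarrow> \<kappa> x \<in> T" "\<And>k. Ck k S \<kappa>"
  shows "smooth_net T u \<Longrightarrow> moderate_upto k T u \<Longrightarrow> moderate_upto k S (\<lambda>\<epsilon> x. u \<epsilon> (\<kappa> x))"
proof (induction k arbitrary: u)
  case 0
  have "\<exists>p. net_bound K (\<lambda>\<epsilon> x. u \<epsilon> (\<kappa> x)) (- p)" if K: "compact K" "K \<subseteq> S" for K
  proof -
    have "compact (\<kappa> ` K)" "\<kappa> ` K \<subseteq> T"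
      using K \<kappa>(1) continuous_on_subset[OF Ck_continuous_on[OF \<kappa>(2)] K(2)] by (auto intro: compact_continuous_image)
    then obtain p where "net_bound (\<kappa> ` K) u (- p)" using moderate_upto_0D[OF 0(2)] by blast
    then show ?thesis using net_bound_compose by blast
  qed
  then show ?case by simp
next
  case (Suc k)
  have "moderate_upto k S (\<lambda>\<epsilon>. partial_deriv b (\<lambda>x. u \<epsilon> (\<kappa> x)))" if b: "b \<in> Basis" for b
  proof (rule moderate_upto_cong[OF \<open>open S\<close>])
    have D\<kappa>: "Ck k S (\<lambda>x. complex_of_real (partial_deriv b \<kappa> x \<bullet> i))" for i k
      by (intro Ck_intros S Ck_partial_deriv[OF \<kappa>(2) b])
    show "moderate_upto k S (\<lambda>\<epsilon> x. \<Sum>i\<in>Basis. complex_of_real (partial_deriv b \<kappa> x \<bullet> i) * partial_deriv i (u \<epsilon>) (\<kappa> x))"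
      using Suc.prems
      by (intro conjunct2[OF smooth_moderate_sum] S smooth_net_mult moderate_upto_mult D\<kappa> Suc.IH
        smooth_net_compose[OF S] smooth_net_partial_deriv \<kappa>) auto
    show "(\<Sum>i\<in>Basis. complex_of_real (partial_deriv b \<kappa> x \<bullet> i) * partial_deriv i (u \<epsilon>) (\<kappa> x))
        = partial_deriv b (\<lambda>x. u \<epsilon> (\<kappa> x)) x"
      if "\<epsilon> \<in> {0<..1}" "x \<in> S" for \<epsilon> x
    proof -
      have "(\<kappa> has_derivative frechet_derivative \<kappa> (at x)) (at x)"
        using \<kappa>(2)[of 1] that by (auto simp: frechet_derivative_works)
      moreover have "(u \<epsilon> has_derivative (\<lambda>h. \<Sum>i\<in>Basis. (h \<bullet> i) *\<^sub>R partial_deriv i (u \<epsilon>) (\<kappa> x))) (at (\<kappa> x))"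
        by (rule has_derivative_partial_deriv[OF smooth_net_differentiable[OF Suc.prems(1) that(1) \<kappa>(1)[OF that(2)]]])
      ultimately have "((\<lambda>x. u \<epsilon> (\<kappa> x)) has_derivative
          (\<lambda>h. \<Sum>i\<in>Basis. (frechet_derivative \<kappa> (at x) h \<bullet> i) *\<^sub>R partial_deriv i (u \<epsilon>) (\<kappa> x))) (at x)"
        by (rule has_derivative_compose)
      from partial_deriv_eq[OF this, of b] show ?thesis
        by (simp add: partial_deriv_def[of b \<kappa>] scaleR_conv_of_real)
    qed
  qed
  moreover have "moderate_upto 0 S (\<lambda>\<epsilon> x. u \<epsilon> (\<kappa> x))"
    using Suc.IH[OF Suc.prems(1) Suc.prems(2)[THEN moderate_upto_SucD]] by (rule moderate_upto_0I)
  ultimately show ?case by simp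
qed

lemma moderate_nets_iff:
  "u \<in> moderate_nets S \<longleftrightarrow> smooth_net S u \<and> (\<forall>k. moderate_upto k S u)"
proof -
  \<comment> \<open>One direction strips the innermost derivative, the last entry of the list; the
    other adds the outermost one, its head.\<close>
  have iter: "(\<forall>vs. set vs \<subseteq> Basis \<longrightarrow> moderate_upto 0 S (\<lambda>\<epsilon>. iter_partial vs (u \<epsilon>))) \<longleftrightarrow> (\<forall>k. moderate_upto k S u)"
  proof
    have "moderate_upto k S u" if "\<forall>vs. set vs \<subseteq> Basis \<longrightarrow> moderate_upto 0 S (\<lambda>\<epsilon>. iter_partial vs (u \<epsilon>))" for k
      using that
    proof (induction k arbitrary: u)
      case 0
      from 0[rule_format, of "[]"] show ?case by simp
    next
      case (Suc k)
      have "moderate_upto 0 S u" using Suc.prems[rule_format, of "[]"] by simp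
      moreover have "moderate_upto k S (\<lambda>\<epsilon>. partial_deriv b (u \<epsilon>))" if "b \<in> Basis" for b
      proof (rule Suc.IH, intro allI impI)
        fix vs :: "'a list" assume "set vs \<subseteq> Basis"
        then show "moderate_upto 0 S (\<lambda>\<epsilon>. iter_partial vs (partial_deriv b (u \<epsilon>)))"
          using Suc.prems[rule_format, of "vs @ [b]"] that by (simp add: iter_partial_snoc del: moderate_upto.simps)
      qed
      ultimately show ?case by simp
    qed
    then show "\<forall>vs. set vs \<subseteq> Basis \<longrightarrow> moderate_upto 0 S (\<lambda>\<epsilon>. iter_partial vs (u \<epsilon>)) \<Longrightarrow> \<forall>k. moderate_upto k S u" by blast
  next
    assume *: "\<forall>k. moderate_upto k S u"
    have "\<forall>k. moderate_upto k S (\<lambda>\<epsilon>. iter_partial vs (u \<epsilon>))" if "set vs \<subseteq> Basis" for vs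
      using that
    proof (induction vs)
      case (Cons v vs)
      then have "moderate_upto (Suc k) S (\<lambda>\<epsilon>. iter_partial vs (u \<epsilon>))" for k by auto
      then show ?case using Cons.prems by auto
    qed (use * in simp)
    then show "\<forall>vs. set vs \<subseteq> Basis \<longrightarrow> moderate_upto 0 S (\<lambda>\<epsilon>. iter_partial vs (u \<epsilon>))" by blast
  qed
  have sm: "(\<forall>\<epsilon>\<in>{0<..1}. smooth_on S (u \<epsilon>)) \<longleftrightarrow> smooth_net S u"
    by (auto simp: smooth_net_def smooth_on_iff_Ck)
  have eq: "(\<exists>p::real. (\<lambda>\<epsilon>. sup_norm_on K (iter_partial vs (u \<epsilon>))) \<in> O[at_right 0](\<lambda>\<epsilon>. \<epsilon> powr (- p)))
      \<longleftrightarrow> (\<exists>p. net_bound K (\<lambda>\<epsilon>. iter_partial vs (u \<epsilon>)) (- p))"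
    if "smooth_net S u" "compact K" "K \<subseteq> S" "set vs \<subseteq> Basis" for K vs
  proof -
    have "smooth_net S (\<lambda>\<epsilon>. iter_partial vs (u \<epsilon>))"
      using that(4) by (induction vs) (use that(1) smooth_net_partial_deriv in auto)
    then have "continuous_on K (iter_partial vs (u \<epsilon>))" if "\<epsilon> \<in> {0<..1}" for \<epsilon>
      using Ck_continuous_on[OF smooth_netD[OF _ that]] continuous_on_subset[OF _ \<open>K \<subseteq> S\<close>] by blast
    from net_bound_iff_bigo[of K "\<lambda>\<epsilon>. iter_partial vs (u \<epsilon>)", OF \<open>compact K\<close> this] show ?thesis by simp
  qed
  have "(\<forall>K vs. compact K \<and> K \<subseteq> S \<and> set vs \<subseteq> Basis \<longrightarrow>
       (\<exists>p::real. (\<lambda>\<epsilon>. sup_norm_on K (iter_partial vs (u \<epsilon>))) \<in> O[at_right 0](\<lambda>\<epsilon>. \<epsilon> powr (- p))))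
      \<longleftrightarrow> (\<forall>vs. set vs \<subseteq> Basis \<longrightarrow> moderate_upto 0 S (\<lambda>\<epsilon>. iter_partial vs (u \<epsilon>)))" (is "?L \<longleftrightarrow> ?R")
    if "smooth_net S u"
  proof
    assume L: ?L
    show ?R
    proof (intro allI impI)
      fix vs :: "'a list" assume vs: "set vs \<subseteq> Basis"
      show "moderate_upto 0 S (\<lambda>\<epsilon>. iter_partial vs (u \<epsilon>))"
        unfolding moderate_upto.simps(1)
      proof (intro allI impI, elim conjE)
        fix K assume K: "compact K" "K \<subseteq> S"
        show "\<exists>p. net_bound K (\<lambda>\<epsilon>. iter_partial vs (u \<epsilon>)) (- p)"
          unfolding eq[OF that K vs, symmetric] using L K vs by simp
      qed
    qed
  next
    assume R: ?R
    show ?L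
    proof (intro allI impI, elim conjE)
      fix K and vs :: "'a list" assume K: "compact K" "K \<subseteq> S" and vs: "set vs \<subseteq> Basis"
      show "\<exists>p::real. (\<lambda>\<epsilon>. sup_norm_on K (iter_partial vs (u \<epsilon>))) \<in> O[at_right 0](\<lambda>\<epsilon>. \<epsilon> powr (- p))"
        unfolding eq[OF that K vs] using R K vs by simp
    qed
  qed
  then show ?thesis
    unfolding moderate_nets_def mem_Collect_eq sm iter[symmetric] by (cases "smooth_net S u") simp_all
qed

lemma negligible_nets_iff:
  "u \<in> negligible_nets S \<longleftrightarrow> u \<in> moderate_nets S \<and> negligible0 S u"
proof -
  have "(\<lambda>\<epsilon>. sup_norm_on K (u \<epsilon>)) \<in> O[at_right 0](\<lambda>\<epsilon>. \<epsilon> powr q) \<longleftrightarrow> net_bound K u q"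
    if "u \<in> moderate_nets S" "compact K" "K \<subseteq> S" for K q
  proof (rule net_bound_iff_bigo[OF that(2)])
    show "continuous_on K (u \<epsilon>)" if "\<epsilon> \<in> {0<..1}" for \<epsilon>
      using \<open>u \<in> moderate_nets S\<close> Ck_continuous_on[OF smooth_netD[OF _ that]] continuous_on_subset[OF _ \<open>K \<subseteq> S\<close>]
      by (auto simp: moderate_nets_iff)
  qed
  then show ?thesis unfolding negligible_nets_def negligible0_def by blast
qed

section \<open>Closure properties and the Colombeau equivalence relation\<close>

lemma moderate_nets_add:
  "open S \<Longrightarrow> u \<in> moderate_nets S \<Longrightarrow> w \<in> moderate_nets S \<Longrightarrow> (\<lambda>\<epsilon> x. u \<epsilon> x + w \<epsilon> x) \<in> moderate_nets S"
  unfolding moderate_nets_iff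
  by (intro conjI allI smooth_net_add moderate_upto_add) auto

lemma moderate_nets_mult:
  "open S \<Longrightarrow> (\<And>k. Ck k S a) \<Longrightarrow> u \<in> moderate_nets S \<Longrightarrow> (\<lambda>\<epsilon> x. a x * u \<epsilon> x) \<in> moderate_nets S"
  unfolding moderate_nets_iff
  by (intro conjI allI smooth_net_mult moderate_upto_mult) auto

lemma moderate_nets_compose:
  assumes "open S" "open T" "\<And>x. x \<in> S \<Longrightarrow> \<kappa> x \<in> T" "\<And>k. Ck k S \<kappa>" "u \<in> moderate_nets T"
  shows "(\<lambda>\<epsilon> x. u \<epsilon> (\<kappa> x)) \<in> moderate_nets S"
proof -
  have u: "smooth_net T u" "\<And>k. moderate_upto k T u" using assms(5) by (auto simp only: moderate_nets_iff)
  show ?thesis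
    unfolding moderate_nets_iff
    by (intro conjI allI smooth_net_compose[OF assms(1-4) u(1)] moderate_upto_compose[OF assms(1-4) u])
qed

lemma moderate_nets_sum:
  assumes "open S" "finite I" "\<And>i. i \<in> I \<Longrightarrow> u i \<in> moderate_nets S"
  shows "(\<lambda>\<epsilon> x. \<Sum>i\<in>I. u i \<epsilon> x) \<in> moderate_nets S"
proof -
  have u: "smooth_net S (u i)" "\<And>k. moderate_upto k S (u i)" if "i \<in> I" for i
    using assms(3)[OF that] by (auto simp only: moderate_nets_iff)
  show ?thesis
    unfolding moderate_nets_iff using smooth_moderate_sum[OF assms(1,2), of u] u by blast
qed

lemma moderate_nets_partial_deriv:
  "u \<in> moderate_nets S \<Longrightarrow> b \<in> Basis \<Longrightarrow> (\<lambda>\<epsilon>. partial_deriv b (u \<epsilon>)) \<in> moderate_nets S"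
proof -
  assume u: "u \<in> moderate_nets S" and b: "b \<in> Basis"
  have "moderate_upto k S (\<lambda>\<epsilon>. partial_deriv b (u \<epsilon>))" for k
  proof -
    have "moderate_upto (Suc k) S u" using u by (simp only: moderate_nets_iff)
    then show ?thesis using b by simp
  qed
  moreover have "smooth_net S u" using u by (simp only: moderate_nets_iff)
  ultimately show ?thesis unfolding moderate_nets_iff using smooth_net_partial_deriv[OF _ b] by blast
qed

lemma negligible0_add: "negligible0 S u \<Longrightarrow> negligible0 S w \<Longrightarrow> negligible0 S (\<lambda>\<epsilon> x. u \<epsilon> x + w \<epsilon> x)"
  unfolding negligible0_def by (simp add: net_bound_add)

lemma negligible0_mult:
  "continuous_on S a \<Longrightarrow> negligible0 S u \<Longrightarrow> negligible0 S (\<lambda>\<epsilon> x. a x * u \<epsilon> x)"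
  unfolding negligible0_def
proof (intro allI impI, elim conjE)
  fix K q
  assume "continuous_on S a" "compact K" "K \<subseteq> S" and u: "\<forall>K q. compact K \<and> K \<subseteq> S \<longrightarrow> net_bound K u q"
  then show "net_bound K (\<lambda>\<epsilon> x. a x * u \<epsilon> x) q"
    by (intro net_bound_mult) (auto elim: continuous_on_subset)
qed

lemma negligible0_compose:
  assumes "continuous_on S \<kappa>" "\<And>x. x \<in> S \<Longrightarrow> \<kappa> x \<in> T" "negligible0 T u"
  shows "negligible0 S (\<lambda>\<epsilon> x. u \<epsilon> (\<kappa> x))"
  unfolding negligible0_def
proof (intro allI impI, elim conjE)
  fix K q assume K: "compact K" "K \<subseteq> S"
  have "compact (\<kappa> ` K)"
    by (rule compact_continuous_image[OF continuous_on_subset[OF assms(1) K(2)] K(1)])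
  moreover have "\<kappa> ` K \<subseteq> T" using assms(2) K(2) by auto
  ultimately have "net_bound (\<kappa> ` K) u q" using assms(3) by (auto simp: negligible0_def)
  then show "net_bound K (\<lambda>\<epsilon> x. u \<epsilon> (\<kappa> x)) q" by (rule net_bound_compose)
qed

lemma colombeau_rel_iff:
  assumes "open S"
  shows "(u, w) \<in> colombeau_rel S \<longleftrightarrow>
    u \<in> moderate_nets S \<and> w \<in> moderate_nets S \<and> negligible0 S (\<lambda>\<epsilon> x. u \<epsilon> x - w \<epsilon> x)"
proof -
  have "(\<lambda>\<epsilon> x. u \<epsilon> x - w \<epsilon> x) \<in> moderate_nets S" if "u \<in> moderate_nets S" "w \<in> moderate_nets S"
    using moderate_nets_add[OF assms that(1) moderate_nets_mult[OF assms Ck_const[OF assms] that(2), of "- 1"]]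
    by simp
  then show ?thesis by (auto simp: colombeau_rel_def negligible_nets_iff)
qed

lemma colombeau_rel_refl: "open S \<Longrightarrow> u \<in> moderate_nets S \<Longrightarrow> (u, u) \<in> colombeau_rel S"
  by (auto simp: colombeau_rel_iff negligible0_def net_bound_def intro!: exI[of _ 0])

lemma colombeau_rel_sym:
  assumes "open S" "(u, w) \<in> colombeau_rel S"
  shows "(w, u) \<in> colombeau_rel S"
  using negligible0_mult[of S "\<lambda>_. - 1" "\<lambda>\<epsilon> x. u \<epsilon> x - w \<epsilon> x"] assms(2)
  unfolding colombeau_rel_iff[OF assms(1)] by simp

lemma colombeau_rel_trans:
  assumes "open S" "(u, v) \<in> colombeau_rel S" "(v, w) \<in> colombeau_rel S"
  shows "(u, w) \<in> colombeau_rel S"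
  using negligible0_add[of S "\<lambda>\<epsilon> x. u \<epsilon> x - v \<epsilon> x" "\<lambda>\<epsilon> x. v \<epsilon> x - w \<epsilon> x"] assms(2,3)
  unfolding colombeau_rel_iff[OF assms(1)] by simp

lemma colombeau_rel_mult:
  assumes "open S" "\<And>k. Ck k S a" "(u, w) \<in> colombeau_rel S"
  shows "(\<lambda>\<epsilon> x. a x * u \<epsilon> x, \<lambda>\<epsilon> x. a x * w \<epsilon> x) \<in> colombeau_rel S"
proof -
  have uw: "u \<in> moderate_nets S" "w \<in> moderate_nets S" "negligible0 S (\<lambda>\<epsilon> x. u \<epsilon> x - w \<epsilon> x)"
    using assms(3) unfolding colombeau_rel_iff[OF assms(1)] by auto
  show ?thesis
    unfolding colombeau_rel_iff[OF assms(1)] right_diff_distrib[symmetric]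
    by (intro conjI moderate_nets_mult[OF assms(1,2)] uw negligible0_mult[OF Ck_continuous_on[OF assms(2)]])
qed

lemma colombeau_rel_compose:
  assumes "open S" "open T" "\<And>x. x \<in> S \<Longrightarrow> \<kappa> x \<in> T" "\<And>k. Ck k S \<kappa>" "(u, w) \<in> colombeau_rel T"
  shows "(\<lambda>\<epsilon> x. u \<epsilon> (\<kappa> x), \<lambda>\<epsilon> x. w \<epsilon> (\<kappa> x)) \<in> colombeau_rel S"
proof -
  have uw: "u \<in> moderate_nets T" "w \<in> moderate_nets T" "negligible0 T (\<lambda>\<epsilon> x. u \<epsilon> x - w \<epsilon> x)"
    using assms(5) unfolding colombeau_rel_iff[OF assms(2)] by auto
  show ?thesis
    unfolding colombeau_rel_iff[OF assms(1)]
    by (intro conjI moderate_nets_compose[OF assms(1-4) uw(1)] moderate_nets_compose[OF assms(1-4) uw(2)]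
      negligible0_compose[OF Ck_continuous_on[OF assms(4)] assms(3) uw(3)])
qed

lemma colombeau_class_memberD:
  assumes "open S" "U \<in> colombeau S" "u \<in> U"
  shows "u \<in> moderate_nets S" "w \<in> U \<longleftrightarrow> (u, w) \<in> colombeau_rel S"
proof -
  obtain u0 where u0: "U = colombeau_rel S `` {u0}" using assms(2) by (auto simp: colombeau_def quotient_def)
  then have r: "(u0, u) \<in> colombeau_rel S" using assms(3) by auto
  then show "u \<in> moderate_nets S" by (simp add: colombeau_rel_iff[OF assms(1)])
  show "w \<in> U \<longleftrightarrow> (u, w) \<in> colombeau_rel S"
    unfolding u0 using r colombeau_rel_sym[OF assms(1)] colombeau_rel_trans[OF assms(1)] by blast
qed

lemma colombeau_nonempty:
  assumes "open S" "U \<in> colombeau S"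
  obtains u where "u \<in> U"
proof -
  obtain u0 where u0: "U = colombeau_rel S `` {u0}" "u0 \<in> moderate_nets S"
    using assms(2) by (auto simp: colombeau_def quotient_def)
  then have "u0 \<in> U" using colombeau_rel_refl[OF assms(1)] by auto
  then show thesis by (rule that)
qed

section \<open>Microlocal regularity of pullbacks\<close>

text \<open>Boundedness has to be supplied separately: the \<open>SUP\<close> of an unbounded family
  is an unspecified real, and a bound for it would say nothing about the members.\<close>

lemma bigo_SUP_D:
  fixes f :: "real \<Rightarrow> 'a \<Rightarrow> real"
  assumes "\<And>\<epsilon>. \<epsilon> \<in> {0<..1} \<Longrightarrow> bdd_above (f \<epsilon> ` \<Gamma>)"
    and "(\<lambda>\<epsilon>. SUP \<xi>\<in>\<Gamma>. f \<epsilon> \<xi>) \<in> O[at_right 0](\<lambda>\<epsilon>. \<epsilon> powr p)"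
  shows "\<exists>C>0. \<forall>\<^sub>F \<epsilon> in at_right 0. \<forall>\<xi>\<in>\<Gamma>. f \<epsilon> \<xi> \<le> C * \<epsilon> powr p"
proof -
  obtain C where C: "C > 0" "\<forall>\<^sub>F \<epsilon> in at_right 0. norm (SUP \<xi>\<in>\<Gamma>. f \<epsilon> \<xi>) \<le> C * norm (\<epsilon> powr p)"
    using assms(2) by (elim landau_o.bigE)
  have "\<forall>\<^sub>F \<epsilon> in at_right 0. \<forall>\<xi>\<in>\<Gamma>. f \<epsilon> \<xi> \<le> C * \<epsilon> powr p"
    using C(2) eventually_unit_interval
  proof eventually_elim
    case (elim \<epsilon>)
    show ?case
    proof
      fix \<xi> assume "\<xi> \<in> \<Gamma>"
      then have "f \<epsilon> \<xi> \<le> (SUP \<xi>\<in>\<Gamma>. f \<epsilon> \<xi>)" using assms(1)[OF elim(2)] by (rule cSUP_upper)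
      also have "\<dots> \<le> C * \<epsilon> powr p" using elim(1) by simp
      finally show "f \<epsilon> \<xi> \<le> C * \<epsilon> powr p" .
    qed
  qed
  then show ?thesis using C(1) by blast
qed

lemma bigo_SUP_I:
  fixes f :: "real \<Rightarrow> 'a \<Rightarrow> real"
  assumes "\<Gamma> \<noteq> {}" and f0: "\<And>\<epsilon> \<xi>. 0 \<le> f \<epsilon> \<xi>"
    and le: "\<forall>\<^sub>F \<epsilon> in at_right 0. \<forall>\<xi>\<in>\<Gamma>. f \<epsilon> \<xi> \<le> C * \<epsilon> powr p"
  shows "(\<lambda>\<epsilon>. SUP \<xi>\<in>\<Gamma>. f \<epsilon> \<xi>) \<in> O[at_right 0](\<lambda>\<epsilon>. \<epsilon> powr p)"
proof (rule bigoI)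
  show "\<forall>\<^sub>F \<epsilon> in at_right 0. norm (SUP \<xi>\<in>\<Gamma>. f \<epsilon> \<xi>) \<le> C * norm (\<epsilon> powr p)"
    using le
  proof eventually_elim
    case (elim \<epsilon>)
    obtain \<xi> where \<xi>: "\<xi> \<in> \<Gamma>" using assms(1) by blast
    have "bdd_above (f \<epsilon> ` \<Gamma>)" using elim by (auto intro: bdd_aboveI2)
    from order.trans[OF f0 cSUP_upper[OF \<xi> this]] have "0 \<le> (SUP \<xi>\<in>\<Gamma>. f \<epsilon> \<xi>)" .
    moreover have "(SUP \<xi>\<in>\<Gamma>. f \<epsilon> \<xi>) \<le> C * \<epsilon> powr p"
      using assms(1) elim by (intro cSUP_least) auto
    ultimately show ?case by simp
  qed
qed

text \<open>The estimates above carry powers of \<open>1 + (norm \<xi>)\<^sup>2\<close>. This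
  inequality converts them to the bracket in conclusions; the identity below, with doubled exponent,
  converts hypotheses.\<close>

lemma japanese_bracket_power_le: "japanese_bracket \<xi> ^ l \<le> (1 + (norm \<xi>)\<^sup>2) ^ l"
proof (rule power_mono)
  have "1 + (norm \<xi>)\<^sup>2 \<ge> 1" by simp
  then have "1 + (norm \<xi>)\<^sup>2 \<le> (1 + (norm \<xi>)\<^sup>2)\<^sup>2" by (rule self_le_power) simp
  then show "japanese_bracket \<xi> \<le> 1 + (norm \<xi>)\<^sup>2"
    unfolding japanese_bracket_def by (intro real_le_lsqrt) auto
qed (simp add: japanese_bracket_def)

lemma japanese_bracket_power_even: "japanese_bracket \<xi> ^ (2 * l) = (1 + (norm \<xi>)\<^sup>2) ^ l"
  by (simp add: japanese_bracket_def power_mult)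

lemma japanese_bracket_ge_1: "japanese_bracket \<xi> \<ge> 1"
  by (simp add: japanese_bracket_def)

text \<open>The last hypothesis speaks of every member of \<open>G\<close>, because regularity only
  provides some representative with decay, which is not known in advance.\<close>

lemma microlocally_regular_pullback:
  fixes \<kappa> :: "'a::euclidean_space \<Rightarrow> 'a"
  assumes \<Omega>: "open \<Omega>" "x0 \<in> \<Omega>"
    and \<kappa>: "\<And>k. Ck k \<Omega> \<kappa>" "\<And>x. x \<in> \<Omega> \<Longrightarrow> \<kappa> x \<in> \<Omega>"
    and T: "linear T" "inj T" "\<And>h \<eta>. frechet_derivative \<kappa> (at x0) h \<bullet> \<eta> = h \<bullet> T \<eta>"
    and M: "\<And>k. Ck k \<Omega> M"
    and G: "\<And>g. g \<in> G \<Longrightarrow> g \<in> moderate_nets \<Omega>"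
    and reg: "microlocally_regular \<Omega> G (\<kappa> x0, \<eta>0)"
    and W: "\<And>g. g \<in> G \<Longrightarrow> (\<lambda>\<epsilon> x. M x * g \<epsilon> (\<kappa> x)) \<in> W"
  shows "microlocally_regular \<Omega> W (x0, T \<eta>0)"
proof -
  obtain g \<phi> \<Gamma> and N :: nat where g: "g \<in> G" and \<phi>: "test_function \<Omega> \<phi>" "\<phi> (\<kappa> x0) = 1"
    and \<Gamma>: "conic_neighborhood \<Gamma> \<eta>0"
    and dec: "\<And>l::nat. (\<lambda>\<epsilon>. SUP \<xi>\<in>\<Gamma>. japanese_bracket \<xi> ^ l * norm (fourier (\<lambda>x. \<phi> x * g \<epsilon> x) \<xi>))
          \<in> O[at_right 0](\<lambda>\<epsilon>. \<epsilon> powr (- real N))"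
    using reg unfolding microlocally_regular_def by auto
  obtain \<Gamma>' r where \<Gamma>': "conic_neighborhood \<Gamma>' (T \<eta>0)" "r > 0" "cball x0 r \<subseteq> \<Omega>"
    and pull: "\<And>\<theta> l. (\<And>k. Ck k UNIV \<theta>) \<Longrightarrow> (\<And>x. x \<notin> cball x0 r \<Longrightarrow> \<theta> x = 0) \<Longrightarrow>
      \<exists>C\<ge>0. \<forall>v K A D. (\<forall>k. Ck k UNIV v) \<longrightarrow> compact K \<longrightarrow> (\<forall>x. x \<notin> K \<longrightarrow> v x = 0) \<longrightarrow>
        (\<forall>\<eta>\<in>\<Gamma>. (1 + (norm \<eta>)\<^sup>2) ^ (l + DIM('a)) * norm (fourier v \<eta>) \<le> A) \<longrightarrow>
        (\<forall>\<eta>. norm (fourier v \<eta>) \<le> D) \<longrightarrow>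
        (\<forall>\<xi>\<in>\<Gamma>'. (1 + (norm \<xi>)\<^sup>2) ^ l * norm (fourier (\<lambda>x. \<theta> x * v (\<kappa> x)) \<xi>) \<le> C * (A + D))"
  proof (rule pullback_decay[OF \<Omega> \<kappa>(1) T \<Gamma>], goal_cases)
    case (1 \<Gamma>' r)
    show thesis by (rule that) (fact 1)+
  qed
  define K where "K = closure {x. \<phi> x \<noteq> 0}"
  have K: "compact K" "K \<subseteq> \<Omega>" using \<phi> by (auto simp: test_function_def K_def)
  have \<phi>0: "\<phi> x = 0" if "x \<notin> K" for x using that closure_subset[of "{x. \<phi> x \<noteq> 0}"] by (auto simp: K_def)
  have C\<phi>: "Ck k UNIV \<phi>" for k using \<phi> by (simp add: test_function_def smooth_on_iff_Ck)
  have gm: "g \<in> moderate_nets \<Omega>" by (rule G[OF g])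
  define v where "v \<epsilon> x = \<phi> x * g \<epsilon> x" for \<epsilon> x
  have v0: "v \<epsilon> x = 0" if "x \<notin> K" for \<epsilon> x using \<phi>0[OF that] by (simp add: v_def)
  have vC: "Ck k UNIV (v \<epsilon>)" if "\<epsilon> \<in> {0<..1}" for \<epsilon> k
  proof -
    have oK: "open (- K)" using compact_imp_closed[OF K(1)] by (simp add: open_Compl)
    have "smooth_net \<Omega> g" using gm by (simp only: moderate_nets_iff)
    then have "Ck k \<Omega> (v \<epsilon>)" unfolding v_def
      by (intro Ck_mult \<Omega> Ck_subset[OF C\<phi>] smooth_netD[OF _ that]) auto
    then have "Ck k (\<Omega> \<union> - K) (v \<epsilon>)" by (rule Ck_Un_zero[OF \<Omega>(1) oK]) (simp add: v0)
    moreover have "\<Omega> \<union> - K = UNIV" using K by blast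
    ultimately show ?thesis by simp
  qed
  have bdd: "bdd_above ((\<lambda>\<xi>. japanese_bracket \<xi> ^ l * norm (fourier (v \<epsilon>) \<xi>)) ` \<Gamma>)" if \<epsilon>: "\<epsilon> \<in> {0<..1}" for \<epsilon> l
  proof -
    obtain C where C: "\<And>\<xi>. (1 + (norm \<xi>)\<^sup>2) ^ l * norm (fourier (v \<epsilon>) \<xi>) \<le> C"
      using fourier_decay[OF vC[OF \<epsilon>] K(1) v0, of l] by blast
    have "japanese_bracket \<xi> ^ l * norm (fourier (v \<epsilon>) \<xi>) \<le> C" for \<xi>
      by (rule order.trans[OF mult_right_mono[OF japanese_bracket_power_le] C]) simp
    then show ?thesis by (rule bdd_aboveI2)
  qed
  obtain p where "net_bound K g (- p)"
    using gm K moderate_upto_0D[of \<Omega> g K] unfolding moderate_nets_iff by blast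
  then obtain B where B: "B \<ge> 0" "\<forall>\<^sub>F \<epsilon> in at_right 0. \<forall>x\<in>K. norm (g \<epsilon> x) \<le> B * \<epsilon> powr (- p)"
    unfolding net_bound_def by blast
  \<comment> \<open>\<open>N\<close> is the order of the transform on the cone and \<open>p\<close>
    that of its supremum; both are independent of \<open>l\<close>.\<close>
  define N' where "N' = max N (nat \<lceil>p\<rceil>)"
  have N': "real N \<le> real N'" "p \<le> real N'" unfolding N'_def by linarith+
  have i\<phi>: "integrable lborel \<phi>" by (rule integrable_compact_support[OF Ck_continuous_on[OF C\<phi>] K(1) \<phi>0])
  define D where "D = B * (LINT x|lborel. norm (\<phi> x))"
  have D0: "D \<ge> 0" unfolding D_def using B(1) by simp
  have Dbound: "\<forall>\<^sub>F \<epsilon> in at_right 0. \<forall>\<eta>. norm (fourier (v \<epsilon>) \<eta>) \<le> D * \<epsilon> powr (- p)"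
    using B(2) eventually_unit_interval
  proof eventually_elim
    case (elim \<epsilon>)
    have iv: "integrable lborel (v \<epsilon>)"
      by (rule integrable_compact_support[OF Ck_continuous_on[OF vC[OF elim(2)]] K(1) v0])
    have "(LINT x|lborel. norm (v \<epsilon> x)) \<le> (LINT x|lborel. B * \<epsilon> powr (- p) * norm (\<phi> x))"
    proof (rule integral_mono')
      show "integrable lborel (\<lambda>x. B * \<epsilon> powr (- p) * norm (\<phi> x))" using i\<phi> by simp
      show "norm (v \<epsilon> x) \<le> B * \<epsilon> powr (- p) * norm (\<phi> x)" for x
      proof (cases "x \<in> K")
        case True
        then have "norm (\<phi> x) * norm (g \<epsilon> x) \<le> norm (\<phi> x) * (B * \<epsilon> powr (- p))"
          using elim by (intro mult_left_mono) auto
        then show ?thesis by (simp add: v_def norm_mult mult_ac)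
      qed (simp add: v0 B)
    qed (simp add: B)
    also have "\<dots> = D * \<epsilon> powr (- p)" by (simp add: D_def)
    finally show ?case using norm_fourier_le[OF iv] order.trans by blast
  qed
  obtain L where L: "L > 0" "K \<subseteq> cball (\<kappa> x0) L"
    using compact_imp_bounded[OF K(1)] bounded_subset_cball
    by (metis bounded_subset_ballD ball_subset_cball subset_trans)
  have c\<phi>\<kappa>: "continuous_on \<Omega> (\<lambda>x. \<phi> (\<kappa> x))"
    by (rule continuous_on_compose2[OF Ck_continuous_on[OF C\<phi>] Ck_continuous_on[OF \<kappa>(1)]]) auto
  define V where "V = {x \<in> \<Omega>. \<phi> (\<kappa> x) \<noteq> 0}"
  have oV: "open V"
  proof -
    have "open ((\<lambda>x. \<phi> (\<kappa> x)) -` (- {0}) \<inter> \<Omega>)"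
      by (rule continuous_on_open_vimage[THEN iffD1, rule_format, OF \<Omega>(1) c\<phi>\<kappa>]) auto
    also have "(\<lambda>x. \<phi> (\<kappa> x)) -` (- {0}) \<inter> \<Omega> = V" by (auto simp: V_def)
    finally show ?thesis .
  qed
  have "x0 \<in> V" using \<Omega> \<phi>(2) by (simp add: V_def)
  then obtain r1 where r1: "r1 > 0" "cball x0 r1 \<subseteq> V" using oV open_contains_cball by blast
  define s where "s = min r r1"
  have s: "s > 0" "cball x0 s \<subseteq> cball x0 r" "cball x0 s \<subseteq> V" using r1 \<Gamma>'(2) by (auto simp: s_def)
  \<comment> \<open>A cutoff with support near \<open>x0\<close> is obtained by rescaling the given test function \<open>\<phi>\<close>.\<close>
  define \<psi> where "\<psi> x = \<phi> (\<kappa> x0 + (L / s) *\<^sub>R (x - x0))" for x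
  have C\<psi>: "Ck k UNIV \<psi>" for k unfolding \<psi>_def
    by (rule Ck_compose[OF open_UNIV open_UNIV UNIV_I C\<phi>]) (intro Ck_intros open_UNIV)
  have \<psi>0: "\<psi> x = 0" if "x \<notin> cball x0 s" for x
  proof -
    have "norm (x - x0) > s" using that by (simp add: dist_norm norm_minus_commute)
    then have "(L / s) * norm (x - x0) > L" using s L by (simp add: field_simps)
    then have "\<kappa> x0 + (L / s) *\<^sub>R (x - x0) \<notin> cball (\<kappa> x0) L" using s L by (simp add: dist_norm)
    then show ?thesis unfolding \<psi>_def using L \<phi>0 by blast
  qed
  have sub: "{x. \<psi> x \<noteq> 0} \<subseteq> cball x0 s" using \<psi>0 by blast
  then have supp: "closure {x. \<psi> x \<noteq> 0} \<subseteq> cball x0 s" by (rule closure_minimal) simp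
  have test: "test_function \<Omega> \<psi>"
    unfolding test_function_def smooth_on_iff_Ck
  proof (intro conjI allI C\<psi>)
    show "compact (closure {x. \<psi> x \<noteq> 0})"
      unfolding compact_closure by (rule bounded_subset[OF bounded_cball sub])
    show "closure {x. \<psi> x \<noteq> 0} \<subseteq> \<Omega>" using supp s(2) \<Gamma>'(3) by blast
  qed
  \<comment> \<open>Division by \<open>\<phi> (\<kappa> x)\<close>, which is nonzero on the ball
    containing the support of \<open>\<psi>\<close>, allows \<open>g\<close> to be replaced by the
    compactly supported \<open>v = \<phi> g\<close>, to which Fourier inversion applies. The factor
    \<open>M\<close> is absorbed as well.\<close>
  define \<theta> where "\<theta> x = \<psi> x * (M x / \<phi> (\<kappa> x))" for x
  have \<theta>0: "\<theta> x = 0" if "x \<notin> cball x0 s" for x using \<psi>0[OF that] by (simp add: \<theta>_def)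
  have C\<theta>: "Ck k UNIV \<theta>" for k
  proof -
    have V\<Omega>: "V \<subseteq> \<Omega>" by (auto simp: V_def)
    have "Ck k V (\<lambda>x. \<phi> (\<kappa> x))"
      by (rule Ck_compose[OF oV open_UNIV UNIV_I C\<phi> Ck_subset[OF \<kappa>(1) V\<Omega>]])
    then have "Ck k V \<theta>" unfolding \<theta>_def
      by (intro Ck_mult Ck_divide oV Ck_subset[OF C\<psi>] Ck_subset[OF M V\<Omega>]) (auto simp: V_def)
    then have "Ck k (V \<union> - cball x0 s) \<theta>"
      by (rule Ck_Un_zero[OF oV open_Compl[OF closed_cball]]) (rule \<theta>0, simp)
    moreover have "V \<union> - cball x0 s = UNIV" using s(3) by blast
    ultimately show ?thesis by simp
  qed
  have eq: "\<psi> x * (M x * g \<epsilon> (\<kappa> x)) = \<theta> x * v \<epsilon> (\<kappa> x)" for \<epsilon> x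
  proof (cases "x \<in> cball x0 s")
    case True
    then have "\<phi> (\<kappa> x) \<noteq> 0" using s(3) by (auto simp: V_def)
    then show ?thesis by (simp add: \<theta>_def v_def)
  qed (simp add: \<psi>0 \<theta>0)
  have fin: "(\<lambda>\<epsilon>. SUP \<xi>\<in>\<Gamma>'. japanese_bracket \<xi> ^ l * norm (fourier (\<lambda>x. \<psi> x * (M x * g \<epsilon> (\<kappa> x))) \<xi>))
          \<in> O[at_right 0](\<lambda>\<epsilon>. \<epsilon> powr (- real N'))" for l
  proof -
    have \<theta>r: "\<theta> x = 0" if "x \<notin> cball x0 r" for x by (rule \<theta>0) (use that s(2) in blast)
    have "\<exists>C\<ge>0. \<forall>v K A D. (\<forall>k. Ck k UNIV v) \<longrightarrow> compact K \<longrightarrow> (\<forall>x. x \<notin> K \<longrightarrow> v x = 0) \<longrightarrow>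
        (\<forall>\<eta>\<in>\<Gamma>. (1 + (norm \<eta>)\<^sup>2) ^ (l + DIM('a)) * norm (fourier v \<eta>) \<le> A) \<longrightarrow>
        (\<forall>\<eta>. norm (fourier v \<eta>) \<le> D) \<longrightarrow>
        (\<forall>\<xi>\<in>\<Gamma>'. (1 + (norm \<xi>)\<^sup>2) ^ l * norm (fourier (\<lambda>x. \<theta> x * v (\<kappa> x)) \<xi>) \<le> C * (A + D))"
      by (rule pull[OF C\<theta> \<theta>r])
    then obtain C where C: "C \<ge> 0" and Cb: "\<forall>v K A D. (\<forall>k. Ck k UNIV v) \<longrightarrow> compact K \<longrightarrow> (\<forall>x. x \<notin> K \<longrightarrow> v x = 0) \<longrightarrow>
        (\<forall>\<eta>\<in>\<Gamma>. (1 + (norm \<eta>)\<^sup>2) ^ (l + DIM('a)) * norm (fourier v \<eta>) \<le> A) \<longrightarrow>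
        (\<forall>\<eta>. norm (fourier v \<eta>) \<le> D) \<longrightarrow>
        (\<forall>\<xi>\<in>\<Gamma>'. (1 + (norm \<xi>)\<^sup>2) ^ l * norm (fourier (\<lambda>x. \<theta> x * v (\<kappa> x)) \<xi>) \<le> C * (A + D))"
      by (elim exE conjE) (rule that)
    obtain A where A: "A > 0" "\<forall>\<^sub>F \<epsilon> in at_right 0. \<forall>\<xi>\<in>\<Gamma>.
        japanese_bracket \<xi> ^ (2 * (l + DIM('a))) * norm (fourier (v \<epsilon>) \<xi>) \<le> A * \<epsilon> powr (- real N)"
      using bigo_SUP_D[of "\<lambda>\<epsilon> \<xi>. japanese_bracket \<xi> ^ (2 * (l + DIM('a))) * norm (fourier (v \<epsilon>) \<xi>)" \<Gamma> "- real N", OF bdd]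
        dec[of "2 * (l + DIM('a))"] unfolding v_def by blast
    have main: "\<forall>\<^sub>F \<epsilon> in at_right 0. \<forall>\<xi>\<in>\<Gamma>'. japanese_bracket \<xi> ^ l * norm (fourier (\<lambda>x. \<psi> x * (M x * g \<epsilon> (\<kappa> x))) \<xi>)
        \<le> (C * (A + D)) * \<epsilon> powr (- real N')"
      using A(2) Dbound eventually_unit_interval
    proof eventually_elim
      case (elim \<epsilon>)
      show ?case
      proof
        fix \<xi> assume \<xi>: "\<xi> \<in> \<Gamma>'"
        have "(1 + (norm \<xi>)\<^sup>2) ^ l * norm (fourier (\<lambda>x. \<theta> x * v \<epsilon> (\<kappa> x)) \<xi>) \<le> C * (A * \<epsilon> powr (- real N) + D * \<epsilon> powr (- p))"
        proof (rule Cb[rule_format, OF _ K(1) _ _ _ \<xi>])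
          show "Ck k UNIV (v \<epsilon>)" for k by (rule vC[OF elim(3)])
          show "v \<epsilon> x = 0" if "x \<notin> K" for x by (rule v0[OF that])
          show "(1 + (norm \<eta>)\<^sup>2) ^ (l + DIM('a)) * norm (fourier (v \<epsilon>) \<eta>) \<le> A * \<epsilon> powr (- real N)"
            if "\<eta> \<in> \<Gamma>" for \<eta>
            using elim(1) that by (simp only: japanese_bracket_power_even)
          show "norm (fourier (v \<epsilon>) \<eta>) \<le> D * \<epsilon> powr (- p)" for \<eta> using elim(2) by blast
        qed
        also have "\<dots> \<le> C * (A * \<epsilon> powr (- real N') + D * \<epsilon> powr (- real N'))"
          using C A(1) D0 N' elim(3) by (intro mult_left_mono add_mono powr_mono') auto
        also have "\<dots> = (C * (A + D)) * \<epsilon> powr (- real N')" by (simp add: algebra_simps)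
        finally show "japanese_bracket \<xi> ^ l * norm (fourier (\<lambda>x. \<psi> x * (M x * g \<epsilon> (\<kappa> x))) \<xi>) \<le> (C * (A + D)) * \<epsilon> powr (- real N')"
          unfolding eq by (rule order.trans[OF mult_right_mono[OF japanese_bracket_power_le norm_ge_zero]])
      qed
    qed
    have "\<Gamma>' \<noteq> {}" using \<Gamma>'(1) interior_subset by (auto simp: conic_neighborhood_def)
    moreover have "0 \<le> japanese_bracket \<xi> ^ l * norm (fourier w \<xi>)" for \<xi> :: 'a and w
      using japanese_bracket_ge_1[of \<xi>] by simp
    ultimately show ?thesis using main by (rule bigo_SUP_I)
  qed
  have "\<psi> x0 = 1" using \<phi>(2) by (simp add: \<psi>_def)
  then show ?thesis
    unfolding microlocally_regular_def prod.case
    by (intro bexI[OF _ W[OF g]] exI[of _ \<psi>] exI[of _ \<Gamma>'] exI[of _ N'] conjI allI test \<Gamma>'(1) fin)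
qed

section \<open>Dependence of flows on initial values\<close>

text \<open>\<open>exp (- 2 * L * t) * (d t \<bullet> d t)\<close> decreases and
  \<open>exp (2 * L * t) * (d t \<bullet> d t)\<close> increases. The bound on \<open>d'\<close> is
  asked for on the open interval only, since \<open>exit_time_bound\<close> has it just before the
  exit time.\<close>

lemma gronwall:
  fixes d :: "real \<Rightarrow> 'a::real_inner"
  assumes "0 \<le> T" and D: "\<And>t. t \<in> {0..T} \<Longrightarrow> (d has_vector_derivative d' t) (at t)"
    and L: "\<And>t. t \<in> {0<..<T} \<Longrightarrow> norm (d' t) \<le> L * norm (d t)"
  shows "norm (d T) \<le> exp (L * T) * norm (d 0)" "norm (d 0) \<le> exp (L * T) * norm (d T)"
proof -
  have DD: "((\<lambda>t. exp (c * t) * (d t \<bullet> d t)) has_real_derivative exp (c * t) * (c * (d t \<bullet> d t) + 2 * (d' t \<bullet> d t))) (at t)"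
    if "t \<in> {0..T}" for c t
  proof -
    have "(d has_derivative (\<lambda>h. h *\<^sub>R d' t)) (at t)" using D[OF that] by (simp add: has_vector_derivative_def)
    then have "((\<lambda>t. d t \<bullet> d t) has_derivative (\<lambda>h. d t \<bullet> (h *\<^sub>R d' t) + (h *\<^sub>R d' t) \<bullet> d t)) (at t)"
      by (intro has_derivative_inner)
    then have "((\<lambda>t. d t \<bullet> d t) has_real_derivative 2 * (d' t \<bullet> d t)) (at t)"
      unfolding has_field_derivative_def
      by (rule has_derivative_eq_rhs) (auto simp: fun_eq_iff inner_commute)
    then show ?thesis by (auto intro!: derivative_eq_intros simp: algebra_simps)
  qed
  have cont: "continuous_on {0..T} (\<lambda>t. exp (c * t) * (d t \<bullet> d t))" for c
    by (rule continuous_at_imp_continuous_on) (use DD DERIV_isCont in blast)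
  have inner: "\<bar>d' t \<bullet> d t\<bar> \<le> L * (d t \<bullet> d t)" if "t \<in> {0<..<T}" for t
  proof -
    have "\<bar>d' t \<bullet> d t\<bar> \<le> norm (d' t) * norm (d t)" by (rule Cauchy_Schwarz_ineq2)
    also have "\<dots> \<le> L * norm (d t) * norm (d t)" using L[OF that] by (rule mult_right_mono) simp
    finally show ?thesis by (simp add: dot_square_norm power2_eq_square)
  qed
  have sq: "norm x \<le> exp (L * T) * norm y" if "x \<bullet> x \<le> exp (2 * L * T) * (y \<bullet> y)" for x y :: 'a
  proof (rule power2_le_imp_le)
    have "exp (2 * L * T) = (exp (L * T))\<^sup>2" by (simp add: power2_eq_square flip: exp_add)
    then show "(norm x)\<^sup>2 \<le> (exp (L * T) * norm y)\<^sup>2"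
      using that by (simp add: power_mult_distrib power2_norm_eq_inner)
  qed simp
  have "exp (- 2 * L * T) * (d T \<bullet> d T) \<le> exp (- 2 * L * 0) * (d 0 \<bullet> d 0)"
  proof (rule DERIV_nonpos_imp_decreasing_open[OF \<open>0 \<le> T\<close> _ cont])
    fix t assume t: "0 < t" "t < T"
    then have "exp (- 2 * L * t) * (- 2 * L * (d t \<bullet> d t) + 2 * (d' t \<bullet> d t)) \<le> 0"
      using inner[of t] by (intro mult_nonneg_nonpos) auto
    then show "\<exists>y. ((\<lambda>t. exp (- 2 * L * t) * (d t \<bullet> d t)) has_real_derivative y) (at t) \<and> y \<le> 0"
      using DD[of t "- 2 * L"] t by auto
  qed
  then have "d T \<bullet> d T \<le> exp (2 * L * T) * (d 0 \<bullet> d 0)"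
    by (simp add: exp_minus field_simps)
  then show "norm (d T) \<le> exp (L * T) * norm (d 0)" by (rule sq)
  have "exp (2 * L * 0) * (d 0 \<bullet> d 0) \<le> exp (2 * L * T) * (d T \<bullet> d T)"
  proof (rule DERIV_nonneg_imp_increasing_open[OF \<open>0 \<le> T\<close> _ cont])
    fix t assume t: "0 < t" "t < T"
    then have "exp (2 * L * t) * (2 * L * (d t \<bullet> d t) + 2 * (d' t \<bullet> d t)) \<ge> 0"
      using inner[of t] by (intro mult_nonneg_nonneg) auto
    then show "\<exists>y. ((\<lambda>t. exp (2 * L * t) * (d t \<bullet> d t)) has_real_derivative y) (at t) \<and> y \<ge> 0"
      using DD[of t "2 * L"] t by auto
  qed
  then show "norm (d 0) \<le> exp (L * T) * norm (d T)" by (intro sq) simp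
qed

lemma has_vector_derivative_reflect:
  assumes "(d has_vector_derivative d') (at (- t))"
  shows "((\<lambda>t. d (- t)) has_vector_derivative - d') (at t)"
proof -
  have "(uminus has_vector_derivative - 1) (at t)" by (auto intro!: derivative_eq_intros)
  from vector_diff_chain_at[OF this assms] show ?thesis by (simp add: o_def)
qed

lemma gronwall_abs:
  fixes d :: "real \<Rightarrow> 'a::real_inner"
  assumes D: "\<And>s. \<bar>s\<bar> \<le> T \<Longrightarrow> (d has_vector_derivative d' s) (at s)"
    and L: "\<And>s. \<bar>s\<bar> \<le> T \<Longrightarrow> norm (d' s) \<le> L * norm (d s)" and "0 \<le> L" "\<bar>t\<bar> \<le> T"
  shows "norm (d t) \<le> exp (L * T) * norm (d 0)" "norm (d 0) \<le> exp (L * T) * norm (d t)"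
proof -
  have *: "norm (d t) \<le> exp (L * \<bar>t\<bar>) * norm (d 0) \<and> norm (d 0) \<le> exp (L * \<bar>t\<bar>) * norm (d t)"
  proof (cases "t \<ge> 0")
    case True
    show ?thesis using gronwall[of "\<bar>t\<bar>" d d' L] assms True by auto
  next
    case False
    have "((\<lambda>s. d (- s)) has_vector_derivative - d' (- s)) (at s)" if "s \<in> {0..\<bar>t\<bar>}" for s
      by (rule has_vector_derivative_reflect) (use D that \<open>\<bar>t\<bar> \<le> T\<close> in auto)
    from gronwall[of "\<bar>t\<bar>" "\<lambda>s. d (- s)" "\<lambda>s. - d' (- s)" L, OF _ this] show ?thesis
      using L \<open>\<bar>t\<bar> \<le> T\<close> False by auto
  qed
  have "exp (L * \<bar>t\<bar>) \<le> exp (L * T)" using assms(3,4) by (simp add: mult_left_mono)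
  then show "norm (d t) \<le> exp (L * T) * norm (d 0)" "norm (d 0) \<le> exp (L * T) * norm (d t)"
    using * by (meson mult_right_mono norm_ge_zero order.trans)+
qed

section \<open>Uniform estimates and differentiability in time and space\<close>

lemma Ck_has_derivative_space:
  fixes H :: "real \<times> 'e::euclidean_space \<Rightarrow> 'b::real_normed_vector"
  assumes "Ck (Suc k) (UNIV \<times> \<Omega>) H" "x \<in> \<Omega>"
  shows "((\<lambda>x. H (s, x)) has_derivative (\<lambda>h. \<Sum>b\<in>Basis. (h \<bullet> b) *\<^sub>R partial_deriv (0, b) H (s, x))) (at x)"
proof -
  have "(H has_derivative frechet_derivative H (at (s, x))) (at (s, x))"
    using assms by (auto simp: frechet_derivative_works)
  moreover have "((\<lambda>x. (s, x)) has_derivative (\<lambda>h. (0, h))) (at x)"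
    by (auto intro!: derivative_eq_intros)
  ultimately have *: "((\<lambda>x. H (s, x)) has_derivative (\<lambda>h. frechet_derivative H (at (s, x)) (0, h))) (at x)"
    by (metis has_derivative_compose)
  then have "(\<lambda>x. H (s, x)) differentiable at x" by (auto simp: differentiable_def)
  from has_derivative_partial_deriv[OF this] show ?thesis
    by (simp add: partial_deriv_eq[OF *] partial_deriv_def[of "(0, _)"])
qed

text \<open>The mean value inequality needs convexity, which \<open>K\<close> may lack. Hence the
  quantification over convex subsets \<open>S\<close> with one common constant; in the applications
  these are balls about the points of a trajectory.\<close>

lemma Ck_compact_lipschitz:
  fixes H :: "real \<times> 'e::euclidean_space \<Rightarrow> 'b::real_normed_vector"
  assumes H: "Ck (Suc k) (UNIV \<times> \<Omega>) H" and K: "compact K" "K \<subseteq> \<Omega>"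
  shows "\<exists>C\<ge>0. \<forall>s x y S. \<bar>s\<bar> \<le> T \<longrightarrow> convex S \<longrightarrow> S \<subseteq> K \<longrightarrow> x \<in> S \<longrightarrow> y \<in> S \<longrightarrow>
    norm (H (s, x) - H (s, y)) \<le> C * norm (x - y)"
proof -
  have "\<exists>B. \<forall>p\<in>{- T..T} \<times> K. norm (partial_deriv (0, b) H p) \<le> B" if "b \<in> Basis" for b
  proof -
    have "Ck k (UNIV \<times> \<Omega>) (partial_deriv (0, b) H)"
      using Ck_partial_deriv[OF H, of "(0, b)"] that by (simp add: Basis_prod_def)
    then have "continuous_on ({- T..T} \<times> K) (partial_deriv (0, b) H)"
      using K by (auto intro: continuous_on_subset dest!: Ck_continuous_on)
    then have "bounded (partial_deriv (0, b) H ` ({- T..T} \<times> K))"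
      using K by (intro compact_imp_bounded compact_continuous_image compact_Times compact_Icc)
    then show ?thesis by (auto simp: bounded_iff)
  qed
  then obtain B where B: "\<And>b p. b \<in> Basis \<Longrightarrow> p \<in> {- T..T} \<times> K \<Longrightarrow> norm (partial_deriv (0, b) H p) \<le> B b"
    by metis
  define C where "C = (\<Sum>b\<in>Basis. \<bar>B b\<bar>)"
  have "norm (H (s, x) - H (s, y)) \<le> C * norm (x - y)"
    if s: "\<bar>s\<bar> \<le> T" and S: "convex S" "S \<subseteq> K" and xy: "x \<in> S" "y \<in> S" for s x y S
  proof (rule differentiable_bound[OF S(1) _ _ xy])
    fix z assume z: "z \<in> S"
    then have "z \<in> \<Omega>" using S K by blast
    from Ck_has_derivative_space[OF H this]
    show "((\<lambda>x. H (s, x)) has_derivative (\<lambda>h. \<Sum>b\<in>Basis. (h \<bullet> b) *\<^sub>R partial_deriv (0, b) H (s, z))) (at z within S)"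
      by (rule has_derivative_at_withinI)
    show "onorm (\<lambda>h. \<Sum>b\<in>Basis. (h \<bullet> b) *\<^sub>R partial_deriv (0, b) H (s, z)) \<le> C"
    proof (rule onorm_le)
      fix h :: 'e
      have "norm (\<Sum>b\<in>Basis. (h \<bullet> b) *\<^sub>R partial_deriv (0, b) H (s, z)) \<le> (\<Sum>b\<in>Basis. norm h * \<bar>B b\<bar>)"
      proof (rule sum_norm_le)
        fix b :: 'e assume b: "b \<in> Basis"
        have "(s, z) \<in> {- T..T} \<times> K" using s z S by auto
        then have "norm (partial_deriv (0, b) H (s, z)) \<le> \<bar>B b\<bar>" by (rule order.trans[OF B[OF b] abs_ge_self])
        then show "norm ((h \<bullet> b) *\<^sub>R partial_deriv (0, b) H (s, z)) \<le> norm h * \<bar>B b\<bar>"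
          using Basis_le_norm[OF b, of h] by (simp add: mult_mono)
      qed
      then show "norm (\<Sum>b\<in>Basis. (h \<bullet> b) *\<^sub>R partial_deriv (0, b) H (s, z)) \<le> C * norm h"
        by (simp add: C_def sum_distrib_left[symmetric] mult.commute)
    qed
  qed
  moreover have "C \<ge> 0" by (simp add: C_def sum_nonneg)
  ultimately show ?thesis by blast
qed

text \<open>Along the segment from \<open>y\<close> to \<open>x\<close> the first derivatives differ
  from those at \<open>y\<close> by at most a Lipschitz constant times the length of the
  segment.\<close>

lemma Ck_compact_taylor:
  fixes H :: "real \<times> 'e::euclidean_space \<Rightarrow> 'b::real_normed_vector"
  assumes H: "Ck (Suc (Suc k)) (UNIV \<times> \<Omega>) H" and K: "compact K" "K \<subseteq> \<Omega>"
  shows "\<exists>C\<ge>0. \<forall>s x y S. \<bar>s\<bar> \<le> T \<longrightarrow> convex S \<longrightarrow> S \<subseteq> K \<longrightarrow> x \<in> S \<longrightarrow> y \<in> S \<longrightarrow>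
    norm (H (s, x) - H (s, y) - (\<Sum>b\<in>Basis. ((x - y) \<bullet> b) *\<^sub>R partial_deriv (0, b) H (s, y))) \<le> C * (norm (x - y))\<^sup>2"
proof -
  have "\<exists>B\<ge>0. \<forall>s x y S. \<bar>s\<bar> \<le> T \<longrightarrow> convex S \<longrightarrow> S \<subseteq> K \<longrightarrow> x \<in> S \<longrightarrow> y \<in> S \<longrightarrow>
    norm (partial_deriv (0, b) H (s, x) - partial_deriv (0, b) H (s, y)) \<le> B * norm (x - y)" if "b \<in> Basis" for b
    by (rule Ck_compact_lipschitz[OF Ck_partial_deriv[OF H] K]) (use that in \<open>simp add: Basis_prod_def\<close>)
  then obtain B where B: "\<And>b. b \<in> Basis \<Longrightarrow> B b \<ge> 0" "\<And>b s x y S. b \<in> Basis \<Longrightarrow> \<bar>s\<bar> \<le> T \<Longrightarrow> convex S \<Longrightarrow> S \<subseteq> K \<Longrightarrow> x \<in> S \<Longrightarrow> y \<in> S \<Longrightarrow>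
    norm (partial_deriv (0, b) H (s, x) - partial_deriv (0, b) H (s, y)) \<le> B b * norm (x - y)"
    by metis
  define C where "C = (\<Sum>b\<in>Basis. B b)"
  have C0: "C \<ge> 0" by (simp add: C_def sum_nonneg B(1))
  have "norm (H (s, x) - H (s, y) - (\<Sum>b\<in>Basis. ((x - y) \<bullet> b) *\<^sub>R partial_deriv (0, b) H (s, y))) \<le> C * (norm (x - y))\<^sup>2"
    if s: "\<bar>s\<bar> \<le> T" and S: "convex S" "S \<subseteq> K" and xy: "x \<in> S" "y \<in> S" for s x y S
  proof -
    let ?S = "closed_segment y x"
    let ?f' = "\<lambda>z h. \<Sum>b\<in>Basis. (h \<bullet> b) *\<^sub>R partial_deriv (0, b) H (s, z)"
    have sub: "?S \<subseteq> S" using xy S by (simp add: closed_segment_subset)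
    have "norm (H (s, x) - H (s, y) - ?f' y (x - y)) \<le> norm (x - y) * (C * norm (x - y))"
    proof (rule differentiable_bound_linearization[where S="?S"])
      show "y + t *\<^sub>R (x - y) \<in> ?S" if "t \<in> {0..1}" for t
        using that by (auto simp: closed_segment_def algebra_simps intro!: exI[of _ t])
      fix z assume z: "z \<in> ?S"
      then have "z \<in> \<Omega>" using S K sub by blast
      from Ck_has_derivative_space[OF H this]
      show "((\<lambda>x. H (s, x)) has_derivative ?f' z) (at z within ?S)"
        by (rule has_derivative_at_withinI)
      show "onorm (?f' z - ?f' y) \<le> C * norm (x - y)"
      proof (rule onorm_le)
        fix h :: 'e
        have "norm ((?f' z - ?f' y) h) = norm (\<Sum>b\<in>Basis. (h \<bullet> b) *\<^sub>R (partial_deriv (0, b) H (s, z) - partial_deriv (0, b) H (s, y)))"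
          by (simp add: sum_subtractf scaleR_diff_right)
        also have "\<dots> \<le> (\<Sum>b\<in>Basis. norm h * (B b * norm (x - y)))"
        proof (rule sum_norm_le)
          fix b :: 'e assume b: "b \<in> Basis"
          have "norm (partial_deriv (0, b) H (s, z) - partial_deriv (0, b) H (s, y)) \<le> B b * norm (z - y)"
            by (rule B(2)[OF b s S _ xy(2)]) (use z sub in blast)
          also have "\<dots> \<le> B b * norm (x - y)"
            using z B(1)[OF b] by (intro mult_left_mono) (auto dest: segment_bound)
          finally show "norm ((h \<bullet> b) *\<^sub>R (partial_deriv (0, b) H (s, z) - partial_deriv (0, b) H (s, y))) \<le> norm h * (B b * norm (x - y))"
            using Basis_le_norm[OF b, of h] by (simp add: mult_mono)
        qed
        also have "\<dots> = C * norm (x - y) * norm h"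
          by (simp add: C_def sum_distrib_left[symmetric] sum_distrib_right[symmetric] mult_ac)
        finally show "norm ((?f' z - ?f' y) h) \<le> C * norm (x - y) * norm h" .
      qed
    qed auto
    then show ?thesis by (simp add: power2_eq_square mult_ac)
  qed
  with C0 show ?thesis by blast
qed

text \<open>Joint differentiability follows from the partial ones if one of them is continuous. Here
  it is the time derivative, known from a differential equation; the variables are swapped because
  \<open>has_derivative_partialsI\<close> expects the continuous one in second place.\<close>

lemma has_derivative_time_space:
  fixes f :: "real \<times> 'e::euclidean_space \<Rightarrow> 'b::real_normed_vector"
  assumes \<Omega>: "open \<Omega>" "y0 \<in> \<Omega>"
    and t: "\<And>t y. y \<in> \<Omega> \<Longrightarrow> ((\<lambda>t. f (t, y)) has_vector_derivative g (t, y)) (at t)"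
    and g: "continuous_on (UNIV \<times> \<Omega>) g"
    and y: "((\<lambda>y. f (t0, y)) has_derivative D) (at y0)"
  shows "(f has_derivative (\<lambda>(\<tau>, h). \<tau> *\<^sub>R g (t0, y0) + D h)) (at (t0, y0))"
proof -
  have opn: "open (\<Omega> \<times> (UNIV::real set))" using \<Omega> by (simp add: open_Times)
  have "((\<lambda>(y, t). f (t, y)) has_derivative (\<lambda>(h, \<tau>). D h + blinfun_scaleR_left (g (t0, y0)) \<tau>)) (at (y0, t0) within \<Omega> \<times> UNIV)"
  proof (rule has_derivative_partialsI)
    show "((\<lambda>x. f (t0, x)) has_derivative D) (at y0 within \<Omega>)" using y by (rule has_derivative_at_withinI)
    show "((\<lambda>y. f (y, x)) has_derivative blinfun_apply (blinfun_scaleR_left (g (y, x)))) (at y within UNIV)"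
      if "x \<in> \<Omega>" for x y
      using t[OF that, of y] by (simp add: has_vector_derivative_def)
    have "continuous_on (\<Omega> \<times> UNIV) (\<lambda>(x, y). g (y, x))"
      using continuous_on_compose2[OF g, of "\<Omega> \<times> UNIV" "\<lambda>p. (snd p, fst p)"]
      by (force intro!: continuous_intros simp: split_beta)
    then have "continuous (at (y0, t0) within \<Omega> \<times> UNIV) (\<lambda>(x, y). g (y, x))"
      using \<Omega> by (simp add: continuous_on_eq_continuous_within)
    then have "continuous (at (y0, t0) within \<Omega> \<times> UNIV) (\<lambda>p. blinfun_scaleR_left ((\<lambda>(x, y). g (y, x)) p))"
      by (rule bounded_linear.continuous[OF bounded_linear_blinfun_scaleR_left])
    then show "continuous (at (y0, t0) within \<Omega> \<times> UNIV) (\<lambda>(x, y). blinfun_scaleR_left (g (y, x)))"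
      by (simp add: case_prod_unfold)
  qed auto
  then have F: "((\<lambda>(y, t). f (t, y)) has_derivative (\<lambda>(h, \<tau>). D h + \<tau> *\<^sub>R g (t0, y0))) (at (y0, t0))"
    using \<Omega> by (simp add: at_within_open[OF _ opn])
  have "((\<lambda>p. (snd p, fst p)) has_derivative (\<lambda>p. (snd p, fst p))) (at (t0, y0))"
    by (auto intro!: derivative_eq_intros)
  moreover have "((\<lambda>(y, t). f (t, y)) has_derivative (\<lambda>(h, \<tau>). D h + \<tau> *\<^sub>R g (t0, y0))) (at (snd (t0, y0), fst (t0, y0)))"
    using F by simp
  ultimately have "((\<lambda>p. (\<lambda>(y, t). f (t, y)) (snd p, fst p)) has_derivative
      (\<lambda>p. (\<lambda>(h, \<tau>). D h + \<tau> *\<^sub>R g (t0, y0)) (snd p, fst p))) (at (t0, y0))"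
    by (rule has_derivative_compose)
  then show ?thesis by (simp add: case_prod_unfold add.commute)
qed

text \<open>Differentiability in the initial value is obtained from this by exhibiting an explicit
  \<open>G\<close> whose increments approximate those of \<open>F\<close> to second order.\<close>

lemma has_derivative_quadratic_remainder:
  fixes F G :: "'e::real_normed_vector \<Rightarrow> 'b::real_normed_vector"
  assumes G: "(G has_derivative G') (at y0)" and "r > 0"
    and le: "\<And>y. y \<in> cball y0 r \<Longrightarrow> norm (F y - F y0 - (G y - G y0)) \<le> C * (norm (y - y0))\<^sup>2"
  shows "(F has_derivative G') (at y0)"
proof -
  define e where "e y = F y - F y0 - (G y - G y0)" for y
  have "((\<lambda>y. norm (e y) / norm (y - y0)) \<longlongrightarrow> 0) (at y0)"
  proof (rule Lim_null_comparison)
    have "norm (norm (e y) / norm (y - y0)) \<le> C * norm (y - y0)" if "y \<in> cball y0 r" "y \<noteq> y0" for y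
      using le[OF that(1)] that(2) by (simp add: e_def divide_le_eq power2_eq_square mult_ac)
    moreover have "\<forall>\<^sub>F y in at y0. y \<in> cball y0 r \<and> y \<noteq> y0"
      using \<open>r > 0\<close> by (auto simp: eventually_at dist_commute intro!: exI[of _ r])
    ultimately show "\<forall>\<^sub>F y in at y0. norm (norm (e y) / norm (y - y0)) \<le> C * norm (y - y0)"
      by (auto elim: eventually_mono)
    have "((\<lambda>y. C * norm (y - y0)) \<longlongrightarrow> C * norm (y0 - y0)) (at y0)" by (intro tendsto_intros)
    then show "((\<lambda>y. C * norm (y - y0)) \<longlongrightarrow> 0) (at y0)" by simp
  qed
  then have "(e has_derivative (\<lambda>h. 0)) (at y0)"
    by (simp add: has_derivative_iff_norm e_def)
  from has_derivative_add[OF has_derivative_add[OF this has_derivative_const[of "F y0 - G y0"]] G]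
  show ?thesis by (simp add: e_def)
qed

lemma norm_diff_le_mvt:
  fixes P :: "real \<Rightarrow> 'b::real_normed_vector"
  assumes P: "\<And>s. \<bar>s\<bar> \<le> T \<Longrightarrow> (P has_vector_derivative P' s) (at s)"
    and B: "\<And>s. \<bar>s\<bar> \<le> T \<Longrightarrow> norm (P' s) \<le> B" and t: "\<bar>t\<bar> \<le> T"
  shows "norm (P t - P 0) \<le> B * \<bar>t\<bar>"
proof -
  have "norm (P t - P 0) \<le> B * norm (t - 0)"
  proof (rule differentiable_bound[of "{- T..T}"])
    fix s assume "s \<in> {- T..T}"
    then have s: "\<bar>s\<bar> \<le> T" by auto
    show "(P has_derivative (\<lambda>h. h *\<^sub>R P' s)) (at s within {- T..T})"
      using P[OF s] unfolding has_vector_derivative_def by (rule has_derivative_at_withinI)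
    show "onorm (\<lambda>h. h *\<^sub>R P' s) \<le> B"
    proof (rule onorm_le)
      show "norm (h *\<^sub>R P' s) \<le> B * norm h" for h
        using mult_left_mono[OF B[OF s], of "\<bar>h\<bar>"] by (simp add: mult.commute)
    qed
  qed (use t in auto)
  then show ?thesis by simp
qed

text \<open>The estimate of \<open>d'\<close> is available only while \<open>d\<close> is smaller
  than \<open>\<rho>\<close>. At a first time with \<open>norm (d s) \<ge> \<rho>\<close> the
  Gronwall bound up to that time would still give a value below \<open>\<rho>\<close>.\<close>

lemma exit_time_bound:
  fixes d :: "real \<Rightarrow> 'a::real_inner"
  assumes D: "\<And>s. s \<in> {0..1} \<Longrightarrow> (d has_vector_derivative d' s) (at s)"
    and L: "\<And>s. s \<in> {0..1} \<Longrightarrow> norm (d s) < \<rho> \<Longrightarrow> norm (d' s) \<le> L * norm (d s)"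
    and "0 \<le> L" and small: "exp L * norm (d 0) < \<rho>" and t: "t \<in> {0..1}"
  shows "norm (d t) \<le> exp L * norm (d 0)"
proof -
  have bound: "norm (d s) \<le> exp L * norm (d 0)" if s: "s \<in> {0..1}" and lt: "\<And>u. u \<in> {0<..<s} \<Longrightarrow> norm (d u) < \<rho>" for s
  proof -
    have "norm (d s) \<le> exp (L * s) * norm (d 0)"
      by (rule gronwall[of s d d']) (use s lt D L in auto)
    also have "\<dots> \<le> exp L * norm (d 0)" using s \<open>0 \<le> L\<close> by (intro mult_right_mono) (auto simp: mult_left_le)
    finally show ?thesis .
  qed
  have lt: "norm (d s) < \<rho>" if "s \<in> {0..1}" for s
  proof (rule ccontr)
    assume "\<not> norm (d s) < \<rho>"
    define S where "S = {s \<in> {0..1}. \<rho> \<le> norm (d s)}"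
    have "continuous_on {0..1} d"
      by (rule continuous_at_imp_continuous_on) (use D has_vector_derivative_continuous in blast)
    then have "closed S" unfolding S_def by (intro continuous_closed_preimage_constant continuous_on_closed_Collect_le continuous_intros) auto
    then have "compact S" by (rule compact_eq_bounded_closed[THEN iffD2, OF conjI, rotated]) (auto simp: S_def intro: bounded_subset[OF bounded_closed_interval, of _ 0 1])
    moreover have "S \<noteq> {}" using that \<open>\<not> norm (d s) < \<rho>\<close> by (auto simp: S_def)
    ultimately obtain m where m: "m \<in> S" "\<And>u. u \<in> S \<Longrightarrow> m \<le> u" using compact_attains_inf[of S] by blast
    have "norm (d m) \<le> exp L * norm (d 0)"
    proof (rule bound)
      show "norm (d u) < \<rho>" if "u \<in> {0<..<m}" for u
        using m(2)[of u] m(1) that by (force simp: S_def)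
    qed (use m in \<open>auto simp: S_def\<close>)
    with small m(1) show False by (auto simp: S_def)
  qed
  show ?thesis by (rule bound[OF t]) (use t lt in auto)
qed

section \<open>Smooth matrix-valued functions\<close>

lemma bounded_bilinear_matrix_mult: "bounded_bilinear ((**) :: real^'n^'m \<Rightarrow> real^'k^'n \<Rightarrow> real^'k^'m)"
  unfolding bilinear_conv_bounded_bilinear[symmetric] bilinear_def
  by (auto intro!: linearI simp: vec_eq_iff matrix_matrix_mult_def algebra_simps sum.distrib sum_distrib_left)

lemma bounded_bilinear_matrix_vector_mult: "bounded_bilinear ((*v) :: real^'n^'m \<Rightarrow> real^'n \<Rightarrow> real^'m)"
  unfolding bilinear_conv_bounded_bilinear[symmetric] bilinear_def
  by (auto intro!: linearI simp: vec_eq_iff matrix_vector_mult_def algebra_simps sum.distrib sum_distrib_left)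

lemma bounded_bilinear_vector_matrix_mult: "bounded_bilinear ((v*) :: real^'m \<Rightarrow> real^'n^'m \<Rightarrow> real^'n)"
  unfolding bilinear_conv_bounded_bilinear[symmetric] bilinear_def
  by (auto intro!: linearI simp: vec_eq_iff vector_matrix_mult_def algebra_simps sum.distrib sum_distrib_left)

lemmas Ck_matrix_mult [Ck_intros] = Ck_bilinear[OF _ bounded_bilinear_matrix_mult]
lemmas Ck_matrix_vector_mult [Ck_intros] = Ck_bilinear[OF _ bounded_bilinear_matrix_vector_mult]

lemma Ck_prod [Ck_intros]:
  fixes f :: "'i \<Rightarrow> 'a::euclidean_space \<Rightarrow> 'b::real_normed_field"
  assumes "open S"
  shows "(\<And>i. i \<in> I \<Longrightarrow> Ck k S (f i)) \<Longrightarrow> Ck k S (\<lambda>x. \<Prod>i\<in>I. f i x)"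
proof (induction I rule: infinite_finite_induct)
  case (insert i I)
  then show ?case using Ck_mult[OF assms, of k "f i" "\<lambda>x. \<Prod>i\<in>I. f i x"] by simp
qed (use Ck_const[OF assms] in simp_all)

lemma Ck_det:
  fixes F :: "'a::euclidean_space \<Rightarrow> real^'n^'n"
  assumes "open S" "\<And>i j. Ck k S (\<lambda>x. F x $ i $ j)"
  shows "Ck k S (\<lambda>x. det (F x))"
  unfolding det_def by (intro Ck_intros assms)

lemma matrix_inv_invertible:
  fixes A :: "real^'n^'n"
  assumes "invertible A"
  shows "A ** matrix_inv A = mat 1" "matrix_inv A ** A = mat 1"
  using assms unfolding invertible_def matrix_inv_def by (metis (mono_tags, lifting) someI_ex)+

text \<open>By Cramer's rule the entries of the inverse are quotients of determinants.\<close>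

lemma Ck_matrix_inv:
  fixes X :: "'a::euclidean_space \<Rightarrow> real^'n^'n"
  assumes S: "open S" and X: "Ck k S X" and inv: "\<And>x. x \<in> S \<Longrightarrow> invertible (X x)"
  shows "Ck k S (\<lambda>x. matrix_inv (X x))"
proof -
  have det0: "det (X x) \<noteq> 0" if "x \<in> S" for x using inv[OF that] invertible_det_nz by blast
  \<comment> \<open>\<open>X x\<close> with its \<open>i\<close>-th column replaced by the
    \<open>j\<close>-th unit vector.\<close>
  define N where "N i j x = (\<chi> r c. if c = i then (if r = j then 1 else 0) else X x $ r $ c)" for i j x
  have eq: "(\<chi> i j. det (N i j x) / det (X x)) = matrix_inv (X x)" if "x \<in> S" for x
  proof -
    have "matrix_inv (X x) $ i $ j = det (N i j x) / det (X x)" for i j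
    proof -
      have "X x *v (matrix_inv (X x) *v axis j 1) = axis j 1"
        by (simp add: matrix_vector_mul_assoc matrix_inv_invertible[OF inv[OF that]])
      then have "matrix_inv (X x) *v axis j 1 = (\<chi> k. det (\<chi> r c. if c = k then axis j 1 $ r else X x $ r $ c) / det (X x))"
        using cramer[OF det0[OF that]] by blast
      moreover have "matrix_inv (X x) *v axis j 1 = column j (matrix_inv (X x))"
        by (rule matrix_vector_mult_basis)
      ultimately have "column j (matrix_inv (X x)) $ i = det (\<chi> r c. if c = i then axis j 1 $ r else X x $ r $ c) / det (X x)"
        by simp
      moreover have "(\<chi> r c. if c = i then axis j 1 $ r else X x $ r $ c) = N i j x"
        by (simp add: N_def vec_eq_iff axis_def)
      ultimately show ?thesis by (simp add: column_def)
    qed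
    then show ?thesis by (simp add: vec_eq_iff)
  qed
  have "Ck k S (\<lambda>x. \<chi> i j. det (N i j x) / det (X x))"
  proof (intro Ck_vec_lambda Ck_divide Ck_det S)
    show "Ck k S (\<lambda>x. N i j x $ r $ c)" for i j r c
    proof (cases "c = i")
      case True
      then show ?thesis by (simp add: N_def Ck_const[OF S])
    next
      case False
      then show ?thesis using Ck_vec_nth[OF S Ck_vec_nth[OF S X]] by (simp add: N_def)
    qed
    show "Ck k S (\<lambda>x. X x $ i $ j)" for i j by (intro Ck_intros S X)
  qed (rule det0)
  then show ?thesis
    using Ck_cong[OF S, of "\<lambda>x. \<chi> i j. det (N i j x) / det (X x)" "\<lambda>x. matrix_inv (X x)" k, OF eq] by simp
qed

lemma Ck1_vector_derivative:
  fixes f :: "real \<Rightarrow> 'b::real_normed_vector"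
  assumes "\<And>t. (f has_vector_derivative f' t) (at t)" "continuous_on UNIV f'"
  shows "Ck 1 UNIV f"
  unfolding One_nat_def
proof (rule Ck_SucI[OF open_UNIV])
  show "(f has_derivative (\<lambda>h. h *\<^sub>R f' t)) (at t)" for t
    using assms(1) by (simp add: has_vector_derivative_def)
  show "Ck 0 UNIV (\<lambda>t. b *\<^sub>R f' t)" for b :: real
    using assms(2) by (auto intro!: continuous_intros)
qed

text \<open>\<open>X\<close> is the fundamental matrix of the covector equation \<open>\<xi>' = - \<xi> v* B\<close>. Its inverse \<open>J\<close> satisfies
  \<open>J' = B ** J\<close>; for \<open>B\<close> the Jacobian of a vector field along its flow, \<open>J\<close> is the Jacobian of the flow.\<close>

locale linear_flow =
  fixes \<Omega> :: "(real^'n::finite) set" and B X :: "real \<times> (real^'n) \<Rightarrow> real^'n^'n"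
  assumes \<Omega>: "open \<Omega>"
    and X_0: "\<And>y. y \<in> \<Omega> \<Longrightarrow> X (0, y) = mat 1"
    and X_deriv: "\<And>t y. y \<in> \<Omega> \<Longrightarrow> ((\<lambda>t. X (t, y)) has_vector_derivative - (X (t, y) ** B (t, y))) (at t)"
    and B_cont: "continuous_on (UNIV \<times> \<Omega>) B"
begin

sublocale mm: bounded_bilinear "(**) :: real^'n^'n \<Rightarrow> real^'n^'n \<Rightarrow> real^'n^'n"
  by (rule bounded_bilinear_matrix_mult)

definition J :: "real \<times> (real^'n) \<Rightarrow> real^'n^'n" where "J p = matrix_inv (X p)"

lemma slice_continuous: "continuous_on (UNIV \<times> \<Omega>) f \<Longrightarrow> y \<in> \<Omega> \<Longrightarrow> continuous_on S (\<lambda>t. f (t, y))"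
  by (rule continuous_on_compose2[where t="UNIV \<times> \<Omega>"]) (auto intro!: continuous_intros)

lemma B_time_cont: "y \<in> \<Omega> \<Longrightarrow> continuous_on S (\<lambda>t. B (t, y))"
  by (rule slice_continuous[OF B_cont])

lemma X_time_cont: "y \<in> \<Omega> \<Longrightarrow> continuous_on S (\<lambda>t. X (t, y))"
  by (intro continuous_at_imp_continuous_on ballI has_vector_derivative_continuous[OF X_deriv])

lemma B_bound:
  assumes "compact K" "K \<subseteq> \<Omega>"
  obtains L where "L \<ge> 0" "\<And>s y. \<bar>s\<bar> \<le> T \<Longrightarrow> y \<in> K \<Longrightarrow> norm (B (s, y)) \<le> L"
proof -
  have "bounded (B ` ({- T..T} \<times> K))"
    using assms by (intro compact_imp_bounded compact_continuous_image compact_Times compact_Icc continuous_on_subset[OF B_cont]) auto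
  then obtain L where L: "\<And>p. p \<in> {- T..T} \<times> K \<Longrightarrow> norm (B p) \<le> L" by (auto simp: bounded_iff)
  then have "norm (B (s, y)) \<le> \<bar>L\<bar>" if "\<bar>s\<bar> \<le> T" "y \<in> K" for s y
  proof -
    have "(s, y) \<in> {- T..T} \<times> K" using that by auto
    then show ?thesis by (rule order.trans[OF L abs_ge_self])
  qed
  then show thesis using that[of "\<bar>L\<bar>"] by simp
qed

text \<open>If \<open>u v* X (t, y) = 0\<close>, then the solution \<open>u v* X (s, y)\<close> of
  the covector equation vanishes at time \<open>t\<close>. By the backward Gronwall estimate it
  vanishes at time 0, where it equals \<open>u\<close>.\<close>

lemma X_invertible:
  assumes y: "y \<in> \<Omega>"
  shows "invertible (X (t, y))"
proof -
  obtain K where K: "K > 0" "\<And>(v::real^'n) (A::real^'n^'n). norm (v v* A) \<le> norm v * norm A * K"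
    using bounded_bilinear.pos_bounded[OF bounded_bilinear_vector_matrix_mult] by metis
  obtain L where L: "L \<ge> 0" "\<And>s. \<bar>s\<bar> \<le> \<bar>t\<bar> \<Longrightarrow> norm (B (s, y)) \<le> L"
    using B_bound[of "{y}" "\<bar>t\<bar>"] y by (metis compact_sing empty_subsetI insert_subset singletonI)
  have inj: "u = 0" if u: "u v* X (t, y) = 0" for u
  proof -
    have D: "((\<lambda>s. u v* X (s, y)) has_vector_derivative - ((u v* X (s, y)) v* B (s, y))) (at s)" for s
    proof -
      have "((\<lambda>s. u v* X (s, y)) has_vector_derivative u v* (- (X (s, y) ** B (s, y)))) (at s)"
        by (rule bounded_linear.has_vector_derivative[OF bounded_bilinear.bounded_linear_right[OF bounded_bilinear_vector_matrix_mult] X_deriv[OF y]])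
      then show ?thesis
        by (simp add: vector_matrix_mul_assoc bounded_bilinear.minus_right[OF bounded_bilinear_vector_matrix_mult])
    qed
    have "norm (u v* X (0, y)) \<le> exp (L * K * \<bar>t\<bar>) * norm (u v* X (t, y))"
    proof (rule gronwall_abs(2)[OF D])
      show "norm (- ((u v* X (s, y)) v* B (s, y))) \<le> L * K * norm (u v* X (s, y))" if "\<bar>s\<bar> \<le> \<bar>t\<bar>" for s
      proof -
        have "norm ((u v* X (s, y)) v* B (s, y)) \<le> norm (u v* X (s, y)) * norm (B (s, y)) * K" by (rule K)
        also have "\<dots> \<le> norm (u v* X (s, y)) * L * K"
          using L(2)[OF that] K(1) by (intro mult_right_mono mult_left_mono) auto
        finally show ?thesis by (simp add: mult_ac)
      qed
    qed (use L K in auto)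
    then show "u = 0" using u X_0[OF y] by simp
  qed
  have "\<exists>A. A ** transpose (X (t, y)) = mat 1"
    unfolding matrix_left_invertible_ker using inj by simp
  then have "invertible (transpose (X (t, y)))" unfolding invertible_left_inverse .
  then show ?thesis by (simp add: invertible_det_nz)
qed

lemma XJ: "y \<in> \<Omega> \<Longrightarrow> X (t, y) ** J (t, y) = mat 1" "y \<in> \<Omega> \<Longrightarrow> J (t, y) ** X (t, y) = mat 1"
  unfolding J_def by (rule matrix_inv_invertible[OF X_invertible]; assumption)+

text \<open>Matrix inversion is smooth, so \<open>J\<close> has some derivative in time;
  differentiating \<open>X ** J = mat 1\<close> determines it.\<close>

lemma J_deriv:
  assumes y: "y \<in> \<Omega>"
  shows "((\<lambda>t. J (t, y)) has_vector_derivative (B (t, y) ** J (t, y))) (at t)"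
proof -
  have "Ck 1 UNIV (\<lambda>t. X (t, y))"
    by (rule Ck1_vector_derivative[OF X_deriv[OF y]])
      (intro continuous_on_minus mm.continuous_on X_time_cont B_time_cont y)
  then have "Ck 1 UNIV (\<lambda>t. J (t, y))"
    unfolding J_def by (intro Ck_matrix_inv open_UNIV X_invertible y)
  then have "(\<lambda>t. J (t, y)) differentiable at t" by auto
  then obtain J' where J': "((\<lambda>t. J (t, y)) has_vector_derivative J') (at t)"
    using differentiableI_vector vector_derivative_works by blast
  have "((\<lambda>t. X (t, y) ** J (t, y)) has_vector_derivative (X (t, y) ** J' + - (X (t, y) ** B (t, y)) ** J (t, y))) (at t)"
    by (rule mm.has_vector_derivative[OF X_deriv[OF y] J'])
  then have "((\<lambda>t. mat 1) has_vector_derivative (X (t, y) ** J' + - (X (t, y) ** B (t, y)) ** J (t, y))) (at t)"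
    by (simp add: XJ[OF y])
  then have "X (t, y) ** J' + - (X (t, y) ** B (t, y)) ** J (t, y) = 0"
    using vector_derivative_unique_at has_vector_derivative_const by blast
  then have "X (t, y) ** J' = X (t, y) ** B (t, y) ** J (t, y)"
    by (simp add: mm.minus_left)
  then have "J (t, y) ** (X (t, y) ** J') = J (t, y) ** (X (t, y) ** (B (t, y) ** J (t, y)))"
    by (simp add: matrix_mul_assoc)
  then have "J' = B (t, y) ** J (t, y)"
    unfolding matrix_mul_assoc XJ[OF y] by simp
  with J' show ?thesis by simp
qed

lemma J_time_cont: "y \<in> \<Omega> \<Longrightarrow> continuous_on S (\<lambda>t. J (t, y))"
  by (intro continuous_at_imp_continuous_on ballI has_vector_derivative_continuous[OF J_deriv])

text \<open>Variation of constants: the derivative of \<open>X (s, y) ** J (s, y0)\<close> contains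
  only the difference of the coefficients. It is integrated from 0 to \<open>t\<close>, rescaled to
  the unit interval so that negative \<open>t\<close> are included.\<close>

lemma X_diff_formula:
  assumes y: "y \<in> \<Omega>" "y0 \<in> \<Omega>"
  shows "X (t, y) - X (t, y0) = - ((t *\<^sub>R integral {0..1} (\<lambda>\<sigma>. X (t * \<sigma>, y) ** (B (t * \<sigma>, y) - B (t * \<sigma>, y0)) ** J (t * \<sigma>, y0))) ** X (t, y0))"
proof -
  let ?I = "\<lambda>s. X (s, y) ** (B (s, y) - B (s, y0)) ** J (s, y0)"
  have "((\<lambda>s. X (s, y) ** J (s, y0)) has_vector_derivative (X (s, y) ** (B (s, y0) ** J (s, y0)) + - (X (s, y) ** B (s, y)) ** J (s, y0))) (at s)" for s
    by (rule mm.has_vector_derivative[OF X_deriv[OF y(1)] J_deriv[OF y(2)]])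
  then have D: "((\<lambda>s. X (s, y) ** J (s, y0)) has_vector_derivative - ?I s) (at s)" for s
    by (simp add: mm.minus_left mm.diff_left mm.diff_right matrix_mul_assoc)
  have "((\<lambda>\<sigma>. X (t * \<sigma>, y) ** J (t * \<sigma>, y0)) has_vector_derivative t *\<^sub>R (- ?I (t * \<sigma>))) (at \<sigma> within {0..1})" for \<sigma>
  proof -
    have "((\<lambda>\<sigma>. t * \<sigma>) has_vector_derivative t) (at \<sigma>)"
      by (auto intro!: derivative_eq_intros)
    from vector_diff_chain_at[OF this D] show ?thesis
      by (auto simp: o_def intro: has_vector_derivative_at_within)
  qed
  then have "((\<lambda>\<sigma>. t *\<^sub>R (- ?I (t * \<sigma>))) has_integral (X (t * 1, y) ** J (t * 1, y0) - X (t * 0, y) ** J (t * 0, y0))) {0..1}"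
    by (intro fundamental_theorem_of_calculus) auto
  from integral_unique[OF this]
  have "integral {0..1} (\<lambda>\<sigma>. t *\<^sub>R (- ?I (t * \<sigma>))) = X (t, y) ** J (t, y0) - X (0, y) ** J (0, y0)"
    by simp
  moreover have "X (0, y) ** J (0, y0) = mat 1"
    using X_0[OF y(1)] X_0[OF y(2)] XJ(1)[OF y(2), of 0] by simp
  ultimately have E: "X (t, y) ** J (t, y0) - mat 1 = - (t *\<^sub>R integral {0..1} (\<lambda>\<sigma>. ?I (t * \<sigma>)))"
    by simp
  have "X (t, y) - X (t, y0) = (X (t, y) ** J (t, y0) - mat 1) ** X (t, y0)"
    by (simp add: mm.diff_left matrix_mul_assoc[symmetric] XJ[OF y(2)])
  then show ?thesis unfolding E by (simp add: mm.minus_left)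
qed

text \<open>\<open>X_diff_formula\<close> involves \<open>X\<close> at \<open>y\<close> and at
  \<open>y0\<close> but \<open>J\<close> only at \<open>y0\<close>; these are the bounds it
  requires.\<close>

lemma bounds:
  assumes y0: "y0 \<in> \<Omega>" and "T \<ge> 0"
  obtains r C where "r > 0" "cball y0 r \<subseteq> \<Omega>" "C \<ge> 0"
    "\<And>s y. \<bar>s\<bar> \<le> T \<Longrightarrow> y \<in> cball y0 r \<Longrightarrow> norm (X (s, y)) \<le> C"
    "\<And>s. \<bar>s\<bar> \<le> T \<Longrightarrow> norm (J (s, y0)) \<le> C"
proof -
  obtain r where r: "r > 0" "cball y0 r \<subseteq> \<Omega>" using \<Omega> y0 open_contains_cball by blast
  obtain K where K: "K > 0" "\<And>(A::real^'n^'n) (A'::real^'n^'n). norm (A ** A') \<le> norm A * norm A' * K"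
    using mm.pos_bounded by metis
  obtain L where L: "L \<ge> 0" "\<And>s y. \<bar>s\<bar> \<le> T \<Longrightarrow> y \<in> cball y0 r \<Longrightarrow> norm (B (s, y)) \<le> L"
    using B_bound[OF compact_cball r(2), of T] by blast
  have X: "norm (X (s, y)) \<le> exp (L * K * T) * norm (mat 1 :: real^'n^'n)" if s: "\<bar>s\<bar> \<le> T" and y: "y \<in> cball y0 r" for s y
  proof -
    have y\<Omega>: "y \<in> \<Omega>" using y r by blast
    have "norm (X (s, y)) \<le> exp (L * K * T) * norm (X (0, y))"
    proof (rule gronwall_abs(1)[OF X_deriv[OF y\<Omega>]])
      show "norm (- (X (s, y) ** B (s, y))) \<le> L * K * norm (X (s, y))" if "\<bar>s\<bar> \<le> T" for s
      proof -
        have "norm (X (s, y) ** B (s, y)) \<le> norm (X (s, y)) * norm (B (s, y)) * K" by (rule K)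
        also have "\<dots> \<le> norm (X (s, y)) * L * K"
          using L(2)[OF that y] K(1) by (intro mult_right_mono mult_left_mono) auto
        finally show ?thesis by (simp add: mult_ac)
      qed
    qed (use L K s in auto)
    then show ?thesis by (simp add: X_0[OF y\<Omega>])
  qed
  have "bounded ((\<lambda>s. J (s, y0)) ` {- T..T})"
    by (intro compact_imp_bounded compact_continuous_image J_time_cont y0 compact_Icc)
  then obtain C where C: "\<And>s. s \<in> {- T..T} \<Longrightarrow> norm (J (s, y0)) \<le> C" unfolding bounded_iff by blast
  show thesis
  proof (rule that[OF r])
    let ?C = "max \<bar>C\<bar> (exp (L * K * T) * norm (mat 1 :: real^'n^'n))"
    show "norm (X (s, y)) \<le> ?C" if "\<bar>s\<bar> \<le> T" "y \<in> cball y0 r" for s y using X[OF that] by simp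
    show "norm (J (s, y0)) \<le> ?C" if "\<bar>s\<bar> \<le> T" for s
    proof -
      have "norm (J (s, y0)) \<le> C" by (rule C) (use that in \<open>simp add: abs_le_iff\<close>)
      then show ?thesis by linarith
    qed
  qed simp
qed

lemma integrand_cont:
  fixes F :: "real \<Rightarrow> real^'n^'n"
  assumes "y \<in> \<Omega>" "y0 \<in> \<Omega>" "continuous_on UNIV F"
  shows "continuous_on S (\<lambda>\<sigma>. F (t * \<sigma>) ** (B (t * \<sigma>, y) - B (t * \<sigma>, y0)) ** J (t * \<sigma>, y0))"
proof -
  have "continuous_on UNIV (\<lambda>s. F s ** (B (s, y) - B (s, y0)) ** J (s, y0))"
    by (intro mm.continuous_on continuous_on_diff B_time_cont J_time_cont assms)
  then show ?thesis by (rule continuous_on_compose2) (auto intro!: continuous_intros)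
qed

text \<open>\<open>F\<close> is general because it will be \<open>X\<close> at a nearby point for
  the Lipschitz bound, and a difference of two values of \<open>X\<close> for the second-order
  bound.\<close>

lemma norm_triple_integral_le:
  fixes F :: "real \<Rightarrow> real^'n^'n"
  assumes y: "y \<in> \<Omega>" "y0 \<in> \<Omega>" and F: "continuous_on UNIV F" and t: "\<bar>t\<bar> \<le> T"
    and K: "K > 0" "\<And>(A::real^'n^'n) (A'::real^'n^'n). norm (A ** A') \<le> norm A * norm A' * K"
    and b: "\<And>s. \<bar>s\<bar> \<le> T \<Longrightarrow> norm (F s) \<le> f" "\<And>s. \<bar>s\<bar> \<le> T \<Longrightarrow> norm (B (s, y) - B (s, y0)) \<le> \<beta>"
      "\<And>s. \<bar>s\<bar> \<le> T \<Longrightarrow> norm (J (s, y0)) \<le> C"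
  shows "norm ((t *\<^sub>R integral {0..1} (\<lambda>\<sigma>. F (t * \<sigma>) ** (B (t * \<sigma>, y) - B (t * \<sigma>, y0)) ** J (t * \<sigma>, y0))) ** X (t, y0))
    \<le> T * (f * \<beta> * K * C * K) * norm (X (t, y0)) * K"
proof -
  have T0: "T \<ge> 0" using t by linarith
  have nn: "f \<ge> 0" "\<beta> \<ge> 0" "C \<ge> 0" using b[of 0] T0 norm_ge_zero order.trans by (metis abs_zero)+
  have "norm (integral {0..1} (\<lambda>\<sigma>. F (t * \<sigma>) ** (B (t * \<sigma>, y) - B (t * \<sigma>, y0)) ** J (t * \<sigma>, y0))) \<le> (f * \<beta> * K * C * K) * (1 - 0)"
  proof (rule integral_bound)
    fix \<sigma> :: real assume \<sigma>: "\<sigma> \<in> {0..1}"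
    have s: "\<bar>t * \<sigma>\<bar> \<le> T" using t \<sigma> mult_mono[of "\<bar>t\<bar>" T "\<bar>\<sigma>\<bar>" 1] T0 by (auto simp: abs_mult)
    have "norm (F (t * \<sigma>) ** (B (t * \<sigma>, y) - B (t * \<sigma>, y0)) ** J (t * \<sigma>, y0))
      \<le> norm (F (t * \<sigma>) ** (B (t * \<sigma>, y) - B (t * \<sigma>, y0))) * norm (J (t * \<sigma>, y0)) * K" by (rule K)
    also have "\<dots> \<le> (norm (F (t * \<sigma>)) * norm (B (t * \<sigma>, y) - B (t * \<sigma>, y0)) * K) * norm (J (t * \<sigma>, y0)) * K"
      using K by (intro mult_right_mono) auto
    also have "\<dots> \<le> (f * \<beta> * K) * C * K"
      using b[OF s] K(1) nn by (intro mult_mono mult_nonneg_nonneg) auto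
    finally show "norm (F (t * \<sigma>) ** (B (t * \<sigma>, y) - B (t * \<sigma>, y0)) ** J (t * \<sigma>, y0)) \<le> f * \<beta> * K * C * K" .
  qed (auto intro!: integrand_cont y F)
  then have "norm (t *\<^sub>R integral {0..1} (\<lambda>\<sigma>. F (t * \<sigma>) ** (B (t * \<sigma>, y) - B (t * \<sigma>, y0)) ** J (t * \<sigma>, y0))) \<le> T * (f * \<beta> * K * C * K)"
    using t T0 by (simp add: mult_mono)
  then show ?thesis
    using K(1) by (intro order.trans[OF K(2)] mult_right_mono) auto
qed

text \<open>The second estimate is the first-order expansion of \<open>X\<close> in the initial value, in terms of that of \<open>B\<close>.\<close>

lemma X_lipschitz:
  assumes y0: "y0 \<in> \<Omega>" and T: "T \<ge> 0"
  obtains r C where "r > 0" "cball y0 r \<subseteq> \<Omega>" "C \<ge> 0"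
    "\<And>t y \<beta>. \<bar>t\<bar> \<le> T \<Longrightarrow> y \<in> cball y0 r \<Longrightarrow> (\<And>s. \<bar>s\<bar> \<le> T \<Longrightarrow> norm (B (s, y) - B (s, y0)) \<le> \<beta>) \<Longrightarrow>
      norm (X (t, y) - X (t, y0)) \<le> C * \<beta>"
    "\<And>t y \<beta>. \<bar>t\<bar> \<le> T \<Longrightarrow> y \<in> cball y0 r \<Longrightarrow> (\<And>s. \<bar>s\<bar> \<le> T \<Longrightarrow> norm (B (s, y) - B (s, y0)) \<le> \<beta>) \<Longrightarrow>
      norm (X (t, y) - X (t, y0) + (t *\<^sub>R integral {0..1} (\<lambda>\<sigma>. X (t * \<sigma>, y0) ** (B (t * \<sigma>, y) - B (t * \<sigma>, y0)) ** J (t * \<sigma>, y0))) ** X (t, y0)) \<le> C * \<beta>\<^sup>2"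
proof -
  obtain r C where r: "r > 0" "cball y0 r \<subseteq> \<Omega>" "C \<ge> 0"
    and X: "\<And>s y. \<bar>s\<bar> \<le> T \<Longrightarrow> y \<in> cball y0 r \<Longrightarrow> norm (X (s, y)) \<le> C"
    and J: "\<And>s. \<bar>s\<bar> \<le> T \<Longrightarrow> norm (J (s, y0)) \<le> C"
    using bounds[OF y0 T] by metis
  obtain K where K: "K > 0" "\<And>(A::real^'n^'n) (A'::real^'n^'n). norm (A ** A') \<le> norm A * norm A' * K"
    using mm.pos_bounded by metis
  define C1 where "C1 = T * (C * K * C * K) * C * K"
  define C2 where "C2 = T * (C1 * K * C * K) * C * K"
  have C12: "C1 \<ge> 0" "C2 \<ge> 0" using r K T by (auto simp: C1_def C2_def)
  have y0r: "y0 \<in> cball y0 r" using r by simp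
  have 1: "norm (X (t, y) - X (t, y0)) \<le> C1 * \<beta>"
    if t: "\<bar>t\<bar> \<le> T" and y: "y \<in> cball y0 r" and \<beta>: "\<And>s. \<bar>s\<bar> \<le> T \<Longrightarrow> norm (B (s, y) - B (s, y0)) \<le> \<beta>" for t y \<beta>
  proof -
    have y\<Omega>: "y \<in> \<Omega>" using y r by blast
    have "\<beta> \<ge> 0" using \<beta>[of 0] T norm_ge_zero order.trans by (metis abs_zero)
    have "norm (X (t, y) - X (t, y0)) \<le> T * (C * \<beta> * K * C * K) * norm (X (t, y0)) * K"
      unfolding X_diff_formula[OF y\<Omega> y0, of t] norm_minus_cancel
      by (rule norm_triple_integral_le[OF y\<Omega> y0 X_time_cont[OF y\<Omega>] t K X[OF _ y] \<beta> J])
    also have "\<dots> \<le> T * (C * \<beta> * K * C * K) * C * K"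
      using X[OF t y0r] T r K \<open>\<beta> \<ge> 0\<close> by (intro mult_right_mono mult_left_mono mult_nonneg_nonneg) auto
    finally show ?thesis by (simp add: C1_def mult_ac)
  qed
  have 2: "norm (X (t, y) - X (t, y0) + (t *\<^sub>R integral {0..1} (\<lambda>\<sigma>. X (t * \<sigma>, y0) ** (B (t * \<sigma>, y) - B (t * \<sigma>, y0)) ** J (t * \<sigma>, y0))) ** X (t, y0)) \<le> C2 * \<beta>\<^sup>2"
    if t: "\<bar>t\<bar> \<le> T" and y: "y \<in> cball y0 r" and \<beta>: "\<And>s. \<bar>s\<bar> \<le> T \<Longrightarrow> norm (B (s, y) - B (s, y0)) \<le> \<beta>" for t y \<beta>
  proof -
    have y\<Omega>: "y \<in> \<Omega>" using y r by blast
    have b0: "\<beta> \<ge> 0" using \<beta>[of 0] T norm_ge_zero order.trans by (metis abs_zero)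
    let ?I = "\<lambda>F. integral {0..1} (\<lambda>\<sigma>. F (t * \<sigma>) ** (B (t * \<sigma>, y) - B (t * \<sigma>, y0)) ** J (t * \<sigma>, y0))"
    have int: "(\<lambda>\<sigma>. F (t * \<sigma>) ** (B (t * \<sigma>, y) - B (t * \<sigma>, y0)) ** J (t * \<sigma>, y0)) integrable_on {0..1}"
      if "continuous_on UNIV F" for F :: "real \<Rightarrow> real^'n^'n"
      by (rule integrable_continuous_interval[OF integrand_cont[OF y\<Omega> y0 that]])
    \<comment> \<open>Replacing \<open>X (s, y)\<close> by \<open>X (s, y0)\<close> in
      \<open>X_diff_formula\<close> leaves an error with two small factors, hence the square of
      \<open>\<beta>\<close>.\<close>
    have "?I (\<lambda>s. X (s, y) - X (s, y0)) = ?I (\<lambda>s. X (s, y)) - ?I (\<lambda>s. X (s, y0))"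
      using Henstock_Kurzweil_Integration.integral_diff[OF int[OF X_time_cont[OF y\<Omega>]] int[OF X_time_cont[OF y0]]]
      by (simp add: mm.diff_left)
    then have eq: "X (t, y) - X (t, y0) + (t *\<^sub>R ?I (\<lambda>s. X (s, y0))) ** X (t, y0) = - ((t *\<^sub>R ?I (\<lambda>s. X (s, y) - X (s, y0))) ** X (t, y0))"
      unfolding X_diff_formula[OF y\<Omega> y0, of t] by (simp add: scaleR_diff_right mm.diff_left)
    have "norm ((t *\<^sub>R ?I (\<lambda>s. X (s, y) - X (s, y0))) ** X (t, y0)) \<le> T * ((C1 * \<beta>) * \<beta> * K * C * K) * norm (X (t, y0)) * K"
    proof (rule norm_triple_integral_le[OF y\<Omega> y0 _ t K _ \<beta> J])
      show "continuous_on UNIV (\<lambda>s. X (s, y) - X (s, y0))" by (intro continuous_on_diff X_time_cont y\<Omega> y0)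
      show "norm (X (s, y) - X (s, y0)) \<le> C1 * \<beta>" if "\<bar>s\<bar> \<le> T" for s by (rule 1[OF that y \<beta>])
    qed
    also have "\<dots> \<le> T * ((C1 * \<beta>) * \<beta> * K * C * K) * C * K"
      using X[OF t y0r] T r K b0 C12 by (intro mult_right_mono mult_left_mono mult_nonneg_nonneg) auto
    also have "\<dots> = C2 * \<beta>\<^sup>2" by (simp add: C2_def power2_eq_square mult_ac)
    finally show ?thesis unfolding eq by simp
  qed
  show thesis
  proof (rule that[OF r(1,2), of "max C1 C2"])
    show "norm (X (t, y) - X (t, y0)) \<le> max C1 C2 * \<beta>"
      if t: "\<bar>t\<bar> \<le> T" and y: "y \<in> cball y0 r" and \<beta>: "\<And>s. \<bar>s\<bar> \<le> T \<Longrightarrow> norm (B (s, y) - B (s, y0)) \<le> \<beta>" for t y \<beta>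
    proof -
      have "\<beta> \<ge> 0" using \<beta>[of 0] T norm_ge_zero order.trans by (metis abs_zero)
      then show ?thesis using 1[OF t y \<beta>] by (meson max.cobounded1 mult_right_mono order.trans)
    qed
    show "norm (X (t, y) - X (t, y0) + (t *\<^sub>R integral {0..1} (\<lambda>\<sigma>. X (t * \<sigma>, y0) ** (B (t * \<sigma>, y) - B (t * \<sigma>, y0)) ** J (t * \<sigma>, y0))) ** X (t, y0)) \<le> max C1 C2 * \<beta>\<^sup>2"
      if t: "\<bar>t\<bar> \<le> T" and y: "y \<in> cball y0 r" and \<beta>: "\<And>s. \<bar>s\<bar> \<le> T \<Longrightarrow> norm (B (s, y) - B (s, y0)) \<le> \<beta>" for t y \<beta>
      using 2[OF t y \<beta>] by (meson max.cobounded2 mult_right_mono order.trans zero_le_power2)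
  qed (use C12 in simp)
qed

text \<open>Uniform continuity of \<open>B\<close> on a compact cylinder makes the difference of the
  coefficients small for all times at once, as \<open>X_lipschitz\<close> requires.\<close>

lemma X_continuous: "continuous_on (UNIV \<times> \<Omega>) X"
proof (rule continuous_at_imp_continuous_on, rule ballI)
  fix p :: "real \<times> (real^'n)" assume "p \<in> UNIV \<times> \<Omega>"
  then obtain t0 y0 where p: "p = (t0, y0)" "y0 \<in> \<Omega>" by auto
  define T where "T = \<bar>t0\<bar> + 1"
  have T: "T \<ge> 0" by (simp add: T_def)
  obtain r C where r: "r > 0" "cball y0 r \<subseteq> \<Omega>" "C \<ge> 0"
    and X: "\<And>t y \<beta>. \<bar>t\<bar> \<le> T \<Longrightarrow> y \<in> cball y0 r \<Longrightarrow> (\<And>s. \<bar>s\<bar> \<le> T \<Longrightarrow> norm (B (s, y) - B (s, y0)) \<le> \<beta>) \<Longrightarrow>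
      norm (X (t, y) - X (t, y0)) \<le> C * \<beta>"
    by (rule X_lipschitz[OF p(2) T]) blast
  have uc: "uniformly_continuous_on ({- T..T} \<times> cball y0 r) B"
    by (intro compact_uniformly_continuous compact_Times continuous_on_subset[OF B_cont]) (use r in auto)
  show "isCont X p"
    unfolding continuous_at_eps_delta p
  proof (intro allI impI)
    fix e :: real assume e: "e > 0"
    define \<beta> where "\<beta> = e / (2 * (C + 1))"
    have \<beta>: "\<beta> > 0" "C * \<beta> < e / 2" using e r by (auto simp: \<beta>_def field_simps)
    obtain d1 where d1: "d1 > 0" "\<And>q q'. q \<in> {- T..T} \<times> cball y0 r \<Longrightarrow> q' \<in> {- T..T} \<times> cball y0 r \<Longrightarrow> dist q' q < d1 \<Longrightarrow> dist (B q') (B q) < \<beta>"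
      using uc \<beta>(1) unfolding uniformly_continuous_on_def by metis
    have "isCont (\<lambda>t. X (t, y0)) t0"
      using X_time_cont[OF p(2), of UNIV] by (simp add: continuous_on_eq_continuous_at)
    then obtain d2 where d2: "d2 > 0" "\<And>t. dist t t0 < d2 \<Longrightarrow> dist (X (t, y0)) (X (t0, y0)) < e / 2"
      using e unfolding continuous_at_eps_delta by (metis half_gt_zero)
    show "\<exists>d>0. \<forall>x'. dist x' (t0, y0) < d \<longrightarrow> dist (X x') (X (t0, y0)) < e"
    proof (intro exI[of _ "Min {d1, d2, r, 1}"] conjI allI impI)
      show "Min {d1, d2, r, 1} > 0" using d1 d2 r by simp
      fix q assume q: "dist q (t0, y0) < Min {d1, d2, r, 1}"
      obtain t y where ty: "q = (t, y)" by (cases q)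
      have dt: "dist t t0 < d2" "dist t t0 < 1" and dy: "dist y y0 < d1" "dist y y0 < r"
        using q dist_fst_le[of q "(t0, y0)"] dist_snd_le[of q "(t0, y0)"] by (auto simp: ty)
      have tT: "\<bar>t\<bar> \<le> T" using dt(2) by (auto simp: T_def dist_real_def)
      have yr: "y \<in> cball y0 r" using dy by (simp add: dist_commute)
      have "norm (X (t, y) - X (t, y0)) \<le> C * \<beta>"
      proof (rule X[OF tT yr])
        fix s assume s: "\<bar>s\<bar> \<le> T"
        have "dist (s, y) (s, y0) < d1" using dy by (simp add: dist_Pair_Pair)
        then have "dist (B (s, y)) (B (s, y0)) < \<beta>"
          by (intro d1(2)) (use s yr r in \<open>auto simp: abs_le_iff\<close>)
        then show "norm (B (s, y) - B (s, y0)) \<le> \<beta>" by (simp add: dist_norm)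
      qed
      then have "dist (X (t, y)) (X (t, y0)) < e / 2" using \<beta> by (simp add: dist_norm)
      then show "dist (X q) (X (t0, y0)) < e"
        using d2(2)[OF dt(1)] dist_triangle[of "X (t, y)" "X (t0, y0)" "X (t, y0)"] unfolding ty by linarith
    qed
  qed
qed

lemma X_Ck: "Ck k (UNIV \<times> \<Omega>) B \<Longrightarrow> Ck k (UNIV \<times> \<Omega>) X"
proof (induction k)
  case 0
  then show ?case by (simp add: X_continuous)
next
  case (Suc k)
  have o: "open (UNIV \<times> \<Omega> :: (real \<times> (real^'n)) set)" using \<Omega> by (simp add: open_Times)
  have CX: "Ck k (UNIV \<times> \<Omega>) X" by (rule Suc.IH[OF Ck_SucD[OF Suc.prems]])
  have CJ: "Ck k (UNIV \<times> \<Omega>) J" unfolding J_def by (rule Ck_matrix_inv[OF o CX]) (auto intro: X_invertible)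
  have CB: "Ck k (UNIV \<times> \<Omega>) (partial_deriv (0, b) B)" if "b \<in> Basis" for b
    by (rule Ck_partial_deriv[OF Suc.prems]) (use that in \<open>simp add: Basis_prod_def\<close>)
  define DB where "DB h p = (\<Sum>b\<in>Basis. (h \<bullet> b) *\<^sub>R partial_deriv (0, b) B p)" for h p
  have CDB: "Ck k (UNIV \<times> \<Omega>) (DB h)" for h unfolding DB_def by (intro Ck_intros o CB)
  \<comment> \<open>The spatial derivative of \<open>X\<close> is an expression in \<open>X\<close>, \<open>J\<close> and the derivative of \<open>B\<close> only.\<close>
  define D where "D p h = - ((fst p *\<^sub>R integral {0..1} (\<lambda>\<sigma>. X (fst p * \<sigma>, snd p) ** DB h (fst p * \<sigma>, snd p) ** J (fst p * \<sigma>, snd p))) ** X p)" for p h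
  have yD: "((\<lambda>y. X (t, y)) has_derivative D (t, y0)) (at y0)" if y0: "y0 \<in> \<Omega>" for t y0
  proof -
    define T where "T = \<bar>t\<bar>"
    have T: "T \<ge> 0" "\<bar>t\<bar> \<le> T" by (auto simp: T_def)
    obtain r C where r: "r > 0" "cball y0 r \<subseteq> \<Omega>" "C \<ge> 0"
      and X: "\<And>t y \<beta>. \<bar>t\<bar> \<le> T \<Longrightarrow> y \<in> cball y0 r \<Longrightarrow> (\<And>s. \<bar>s\<bar> \<le> T \<Longrightarrow> norm (B (s, y) - B (s, y0)) \<le> \<beta>) \<Longrightarrow>
        norm (X (t, y) - X (t, y0) + (t *\<^sub>R integral {0..1} (\<lambda>\<sigma>. X (t * \<sigma>, y0) ** (B (t * \<sigma>, y) - B (t * \<sigma>, y0)) ** J (t * \<sigma>, y0))) ** X (t, y0)) \<le> C * \<beta>\<^sup>2"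
      by (rule X_lipschitz[OF y0 T(1)]) blast
    obtain L where L: "L \<ge> 0" "\<And>s x y S. \<bar>s\<bar> \<le> T \<Longrightarrow> convex S \<Longrightarrow> S \<subseteq> cball y0 r \<Longrightarrow> x \<in> S \<Longrightarrow> y \<in> S \<Longrightarrow>
      norm (B (s, x) - B (s, y)) \<le> L * norm (x - y)"
      using Ck_compact_lipschitz[OF Suc.prems compact_cball r(2), of T] by blast
    let ?H = "\<lambda>y \<sigma>. X (t * \<sigma>, y0) ** (B (t * \<sigma>, y) - B (t * \<sigma>, y0)) ** J (t * \<sigma>, y0)"
    let ?H' = "\<lambda>y \<sigma> h. X (t * \<sigma>, y0) ** DB h (t * \<sigma>, y) ** J (t * \<sigma>, y0)"
    have sc: "continuous_on (\<Omega> \<times> {0..1}) (\<lambda>p. f (t * snd p, g p))"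
      if "continuous_on (UNIV \<times> \<Omega>) f" "continuous_on (\<Omega> \<times> {0..1::real}) g" "\<And>p. p \<in> \<Omega> \<times> {0..1} \<Longrightarrow> g p \<in> \<Omega>"
      for f :: "real \<times> (real^'n) \<Rightarrow> real^'n^'n" and g
      by (rule continuous_on_compose2[OF that(1)]) (auto intro!: continuous_intros that)
    have cJ: "continuous_on (UNIV \<times> \<Omega>) J" by (rule Ck_continuous_on[OF CJ])
    have Q: "((\<lambda>y. integral {0..1} (?H y)) has_derivative (\<lambda>h. integral {0..1} (\<lambda>\<sigma>. ?H' y0 \<sigma> h))) (at y0)"
    proof (rule has_derivative_integral_param[where H="?H" and H'="?H'", OF \<Omega> y0])
      show "((\<lambda>y. ?H y \<sigma>) has_derivative ?H' y \<sigma>) (at y)" if "y \<in> \<Omega>" for y \<sigma>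
      proof -
        have "((\<lambda>y. B (t * \<sigma>, y) - B (t * \<sigma>, y0)) has_derivative (\<lambda>h. DB h (t * \<sigma>, y) - 0)) (at y)"
          unfolding DB_def by (intro has_derivative_diff has_derivative_const Ck_has_derivative_space[OF Suc.prems that])
        then have "((\<lambda>y. B (t * \<sigma>, y) - B (t * \<sigma>, y0)) has_derivative (\<lambda>h. DB h (t * \<sigma>, y))) (at y)" by simp
        then have "((\<lambda>y. X (t * \<sigma>, y0) ** (B (t * \<sigma>, y) - B (t * \<sigma>, y0))) has_derivative (\<lambda>h. X (t * \<sigma>, y0) ** DB h (t * \<sigma>, y))) (at y)"
          by (rule bounded_linear.has_derivative[OF mm.bounded_linear_right])
        then show ?thesis by (rule bounded_linear.has_derivative[OF mm.bounded_linear_left])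
      qed
      show "continuous_on (\<Omega> \<times> {0..1}) (\<lambda>(y, \<sigma>). ?H y \<sigma>)"
        unfolding case_prod_unfold
        by (intro mm.continuous_on continuous_on_diff sc X_continuous B_cont cJ continuous_intros) (auto simp: y0)
      show "continuous_on (\<Omega> \<times> {0..1}) (\<lambda>(y, \<sigma>). ?H' y \<sigma> b)" for b
        unfolding case_prod_unfold
        by (intro mm.continuous_on sc X_continuous Ck_continuous_on[OF CDB] cJ continuous_intros) (auto simp: y0)
    qed
    \<comment> \<open>The first-order approximation of the increment of \<open>X\<close> from
      \<open>X_lipschitz\<close>. It vanishes at \<open>y0\<close>, its derivative there is
      \<open>D\<close>, and its error is quadratic because \<open>B\<close> is Lipschitz on the
      ball.\<close>
    let ?G = "\<lambda>y. - ((t *\<^sub>R integral {0..1} (?H y)) ** X (t, y0))"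
    have "(?G has_derivative (\<lambda>h. - ((t *\<^sub>R integral {0..1} (\<lambda>\<sigma>. ?H' y0 \<sigma> h)) ** X (t, y0)))) (at y0)"
      by (intro has_derivative_minus bounded_linear.has_derivative[OF mm.bounded_linear_left] has_derivative_scaleR_right Q)
    then have G: "(?G has_derivative D (t, y0)) (at y0)" by (simp add: D_def[abs_def])
    show ?thesis
    proof (rule has_derivative_quadratic_remainder[OF G r(1)])
      fix y assume y: "y \<in> cball y0 r"
      have "norm (B (s, y) - B (s, y0)) \<le> L * norm (y - y0)" if "\<bar>s\<bar> \<le> T" for s
        by (rule L(2)[OF that, of "cball y0 r"]) (use y r in auto)
      from X[OF T(2) y this] have "norm (X (t, y) - X (t, y0) + (t *\<^sub>R integral {0..1} (?H y)) ** X (t, y0)) \<le> C * (L * norm (y - y0))\<^sup>2" .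
      moreover have "?G y0 = 0" by simp
      ultimately show "norm (X (t, y) - X (t, y0) - (?G y - ?G y0)) \<le> (C * L\<^sup>2) * (norm (y - y0))\<^sup>2"
        by (simp add: power_mult_distrib)
    qed
  qed
  show ?case
  proof (rule Ck_SucI[OF o])
    fix p :: "real \<times> (real^'n)" assume "p \<in> UNIV \<times> \<Omega>"
    then obtain t y where p: "p = (t, y)" "y \<in> \<Omega>" by auto
    have "continuous_on (UNIV \<times> \<Omega>) (\<lambda>p. - (X p ** B p))"
      by (intro continuous_intros mm.continuous_on X_continuous B_cont)
    from has_derivative_time_space[OF \<Omega> p(2) X_deriv this yD[OF p(2)]]
    show "(X has_derivative (\<lambda>(\<tau>, h). \<tau> *\<^sub>R - (X p ** B p) + D p h)) (at p)" by (simp add: p(1))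
  next
    fix b :: "real \<times> (real^'n)" assume "b \<in> Basis"
    obtain \<tau> h where b: "b = (\<tau>, h)" by (cases b)
    have oo: "open ((UNIV \<times> \<Omega>) \<times> UNIV :: ((real \<times> (real^'n)) \<times> real) set)" using o by (simp add: open_Times)
    have comp: "Ck k ((UNIV \<times> \<Omega>) \<times> UNIV) (\<lambda>q. f (fst (fst q) * snd q, snd (fst q)))"
      if "Ck k (UNIV \<times> \<Omega>) f" for f :: "real \<times> (real^'n) \<Rightarrow> real^'n^'n"
      by (rule Ck_compose[OF oo o _ that]) (auto intro!: Ck_intros oo)
    have "Ck k (UNIV \<times> \<Omega>) (\<lambda>p. integral {0..1} (\<lambda>\<sigma>. X (fst p * \<sigma>, snd p) ** DB h (fst p * \<sigma>, snd p) ** J (fst p * \<sigma>, snd p)))"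
      using Ck_integral_param[OF o Ck_matrix_mult[OF oo Ck_matrix_mult[OF oo comp[OF CX] comp[OF CDB]] comp[OF CJ]], of h] by simp
    then have "Ck k (UNIV \<times> \<Omega>) (\<lambda>p. D p h)" unfolding D_def by (intro Ck_intros o CX)
    moreover have "Ck k (UNIV \<times> \<Omega>) B" by (rule Ck_SucD[OF Suc.prems])
    ultimately have "Ck k (UNIV \<times> \<Omega>) (\<lambda>p. \<tau> *\<^sub>R - (X p ** B p) + D p h)"
      by (intro Ck_intros o CX)
    then show "Ck k (UNIV \<times> \<Omega>) (\<lambda>p. case b of (\<tau>, h) \<Rightarrow> \<tau> *\<^sub>R - (X p ** B p) + D p h)" by (simp add: b)
  qed
qed

end

section \<open>Integral curves of a vector field\<close>

definition spatial_jacobian :: "(real \<times> (real^'n::finite) \<Rightarrow> real^'n) \<Rightarrow> real \<times> (real^'n) \<Rightarrow> real^'n^'n" where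
  "spatial_jacobian \<alpha> p = (\<chi> i j. partial_deriv (0, axis j 1) \<alpha> p $ i)"

lemma sum_Basis_vec: "(\<Sum>b\<in>(Basis :: (real^'n::finite) set). f b) = (\<Sum>j\<in>UNIV. f (axis j 1))"
proof -
  have "(\<Sum>b\<in>(Basis :: (real^'n) set). f b) = (\<Sum>b\<in>range (\<lambda>j::'n. axis j 1). f b)"
    by (rule sum.cong) (auto simp: Basis_vec_def)
  also have "\<dots> = (\<Sum>j\<in>UNIV. f (axis j 1))"
    by (subst sum.reindex) (auto simp: inj_def axis_eq_axis)
  finally show ?thesis .
qed

lemma spatial_jacobian_mult:
  "spatial_jacobian \<alpha> p *v h = (\<Sum>b\<in>Basis. (h \<bullet> b) *\<^sub>R partial_deriv (0, b) \<alpha> p)"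
  by (simp add: sum_Basis_vec vec_eq_iff matrix_vector_mult_def spatial_jacobian_def inner_axis mult.commute)

lemma compact_neighbourhood:
  fixes K :: "'a::euclidean_space set"
  assumes "compact K" "open \<Omega>" "K \<subseteq> \<Omega>"
  obtains \<rho> K' where "\<rho> > 0" "compact K'" "K' \<subseteq> \<Omega>" "\<And>x. x \<in> K \<Longrightarrow> cball x \<rho> \<subseteq> K'"
proof -
  obtain \<rho> where \<rho>: "\<rho> > 0" "(\<Union>x\<in>K. cball x \<rho>) \<subseteq> \<Omega>"
    using compact_subset_open_imp_cball_epsilon_subset[OF assms] by metis
  \<comment> \<open>The union of the balls is written as a sum of two compact sets to see that it is
    compact.\<close>
  define K' where "K' = {x + z |x z. x \<in> K \<and> z \<in> cball 0 \<rho>}"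
  have eq: "K' = (\<Union>x\<in>K. cball x \<rho>)"
  proof (intro set_eqI iffI)
    fix w assume "w \<in> (\<Union>x\<in>K. cball x \<rho>)"
    then obtain x where x: "x \<in> K" "dist x w \<le> \<rho>" by auto
    then have "w = x + (w - x)" "w - x \<in> cball 0 \<rho>" by (auto simp: dist_norm norm_minus_commute)
    then show "w \<in> K'" unfolding K'_def using x(1) by blast
  next
    fix w assume "w \<in> K'"
    then obtain x z where "w = x + z" "x \<in> K" "norm z \<le> \<rho>" by (auto simp: K'_def)
    then have "w \<in> cball x \<rho>" by (simp add: dist_norm)
    then show "w \<in> (\<Union>x\<in>K. cball x \<rho>)" using \<open>x \<in> K\<close> by blast
  qed
  show thesis
  proof (rule that[OF \<rho>(1)])
    show "compact K'" unfolding K'_def by (rule compact_sums[OF assms(1) compact_cball])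
    show "K' \<subseteq> \<Omega>" unfolding eq by (rule \<rho>(2))
    show "cball x \<rho> \<subseteq> K'" if "x \<in> K" for x unfolding eq using that by blast
  qed
qed

locale vector_field =
  fixes \<Omega> :: "(real^'n::finite) set" and \<alpha> :: "real \<times> (real^'n) \<Rightarrow> real^'n"
  assumes \<Omega>: "open \<Omega>" and \<alpha>: "\<And>k. Ck k (UNIV \<times> \<Omega>) \<alpha>"
begin

text \<open>Time is \<open>p + k * \<sigma>\<close> with signed \<open>k\<close>, so that one
  statement covers both directions of time and any starting time. Only \<open>c'\<close> is assumed
  to stay well inside \<open>K\<close>; \<open>exit_time_bound\<close> keeps \<open>c\<close> near
  it.\<close>

lemma curves_close:
  assumes c: "\<And>\<sigma>. \<sigma> \<in> {0..1} \<Longrightarrow> (c has_vector_derivative k *\<^sub>R \<alpha> (p + k * \<sigma>, c \<sigma>)) (at \<sigma>)"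
      "\<And>\<sigma>. \<sigma> \<in> {0..1} \<Longrightarrow> (c' has_vector_derivative k *\<^sub>R \<alpha> (p + k * \<sigma>, c' \<sigma>)) (at \<sigma>)"
    and K: "\<And>\<sigma>. \<sigma> \<in> {0..1} \<Longrightarrow> cball (c' \<sigma>) \<rho> \<subseteq> K"
    and L: "0 \<le> L" "\<And>s x y S. \<bar>s\<bar> \<le> T \<Longrightarrow> convex S \<Longrightarrow> S \<subseteq> K \<Longrightarrow> x \<in> S \<Longrightarrow> y \<in> S \<Longrightarrow>
      norm (\<alpha> (s, x) - \<alpha> (s, y)) \<le> L * norm (x - y)"
    and T: "\<bar>p\<bar> \<le> T" "\<bar>p + k\<bar> \<le> T" "\<bar>k\<bar> \<le> k'" and small: "exp (k' * L) * norm (c 0 - c' 0) < \<rho>"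
  shows "norm (c 1 - c' 1) \<le> exp (k' * L) * norm (c 0 - c' 0)"
proof -
  let ?d' = "\<lambda>\<sigma>. k *\<^sub>R \<alpha> (p + k * \<sigma>, c \<sigma>) - k *\<^sub>R \<alpha> (p + k * \<sigma>, c' \<sigma>)"
  have "norm ((\<lambda>\<sigma>. c \<sigma> - c' \<sigma>) 1) \<le> exp (k' * L) * norm ((\<lambda>\<sigma>. c \<sigma> - c' \<sigma>) 0)"
  proof (rule exit_time_bound[where d'="?d'"])
    show "((\<lambda>\<sigma>. c \<sigma> - c' \<sigma>) has_vector_derivative ?d' \<sigma>) (at \<sigma>)" if "\<sigma> \<in> {0..1}" for \<sigma>
      by (rule has_vector_derivative_diff[OF c(1)[OF that] c(2)[OF that]])
    show "norm (?d' \<sigma>) \<le> k' * L * norm (c \<sigma> - c' \<sigma>)" if \<sigma>: "\<sigma> \<in> {0..1}" and lt: "norm (c \<sigma> - c' \<sigma>) < \<rho>" for \<sigma>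
    proof -
      have "p + k * \<sigma> = (1 - \<sigma>) * p + \<sigma> * (p + k)" by (simp add: algebra_simps)
      also have "\<bar>\<dots>\<bar> \<le> (1 - \<sigma>) * \<bar>p\<bar> + \<sigma> * \<bar>p + k\<bar>"
        using \<sigma> by (intro order.trans[OF abs_triangle_ineq]) (auto simp: abs_mult)
      also have "\<dots> \<le> (1 - \<sigma>) * T + \<sigma> * T"
        using \<sigma> T by (intro add_mono mult_left_mono) auto
      finally have s: "\<bar>p + k * \<sigma>\<bar> \<le> T" by (simp add: algebra_simps)
      have "norm (?d' \<sigma>) = \<bar>k\<bar> * norm (\<alpha> (p + k * \<sigma>, c \<sigma>) - \<alpha> (p + k * \<sigma>, c' \<sigma>))"
        by (simp flip: scaleR_diff_right)
      also have "\<dots> \<le> k' * (L * norm (c \<sigma> - c' \<sigma>))"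
      proof (rule mult_mono[OF T(3)])
        show "norm (\<alpha> (p + k * \<sigma>, c \<sigma>) - \<alpha> (p + k * \<sigma>, c' \<sigma>)) \<le> L * norm (c \<sigma> - c' \<sigma>)"
        proof (rule L(2)[OF s convex_cball K[OF \<sigma>]])
          show "c \<sigma> \<in> cball (c' \<sigma>) \<rho>" using lt by (simp add: dist_norm norm_minus_commute)
          show "c' \<sigma> \<in> cball (c' \<sigma>) \<rho>" using le_less_trans[OF norm_ge_zero lt] by simp
        qed
      qed (use T in auto)
      finally show ?thesis by (simp add: mult_ac)
    qed
  qed (use L T small in auto)
  then show ?thesis by simp
qed

lemma curves_unique:
  assumes c: "\<And>\<sigma>. \<sigma> \<in> {0..1} \<Longrightarrow> (c has_vector_derivative k *\<^sub>R \<alpha> (p + k * \<sigma>, c \<sigma>)) (at \<sigma>)"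
      "\<And>\<sigma>. \<sigma> \<in> {0..1} \<Longrightarrow> (c' has_vector_derivative k *\<^sub>R \<alpha> (p + k * \<sigma>, c' \<sigma>)) (at \<sigma>)"
    and in_\<Omega>: "\<And>\<sigma>. \<sigma> \<in> {0..1} \<Longrightarrow> c' \<sigma> \<in> \<Omega>" and eq: "c 0 = c' 0"
  shows "c 1 = c' 1"
proof -
  have "continuous_on {0..1} c'"
    by (intro continuous_at_imp_continuous_on ballI has_vector_derivative_continuous[OF c(2)])
  then have "compact (c' ` {0..1})" by (rule compact_continuous_image) simp
  moreover have "c' ` {0..1} \<subseteq> \<Omega>" using in_\<Omega> by blast
  ultimately obtain \<rho> K where K: "\<rho> > 0" "compact K" "K \<subseteq> \<Omega>" "\<And>x. x \<in> c' ` {0..1} \<Longrightarrow> cball x \<rho> \<subseteq> K"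
    using compact_neighbourhood[OF _ \<Omega>] by metis
  obtain L where L: "0 \<le> L" "\<And>s x y S. \<bar>s\<bar> \<le> \<bar>p\<bar> + \<bar>k\<bar> \<Longrightarrow> convex S \<Longrightarrow> S \<subseteq> K \<Longrightarrow> x \<in> S \<Longrightarrow> y \<in> S \<Longrightarrow>
      norm (\<alpha> (s, x) - \<alpha> (s, y)) \<le> L * norm (x - y)"
    using Ck_compact_lipschitz[OF \<alpha> K(2,3), of "\<bar>p\<bar> + \<bar>k\<bar>"] by blast
  have "norm (c 1 - c' 1) \<le> exp (\<bar>k\<bar> * L) * norm (c 0 - c' 0)"
    by (rule curves_close[OF c K(4) L]) (use eq K(1) in auto)
  then show ?thesis using eq by simp
qed

lemma reparametrize:
  assumes "\<And>s. (c has_vector_derivative \<alpha> (s, c s)) (at s)"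
  shows "((\<lambda>\<sigma>. c (p + k * \<sigma>)) has_vector_derivative k *\<^sub>R \<alpha> (p + k * \<sigma>, c (p + k * \<sigma>))) (at \<sigma>)"
proof -
  have "((\<lambda>\<sigma>. p + k * \<sigma>) has_vector_derivative k) (at \<sigma>)" by (auto intro!: derivative_eq_intros)
  from vector_diff_chain_at[OF this assms] show ?thesis by (simp add: o_def)
qed

lemma solutions_unique:
  assumes c: "\<And>s. (c has_vector_derivative \<alpha> (s, c s)) (at s)" "\<And>s. (c' has_vector_derivative \<alpha> (s, c' s)) (at s)"
    and in_\<Omega>: "\<And>s. c' s \<in> \<Omega>" and eq: "c 0 = c' 0"
  shows "c t = c' t"
  using curves_unique[OF reparametrize[OF c(1), of 0 t] reparametrize[OF c(2), of 0 t]] in_\<Omega> eq by simp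

end

section \<open>The flow of the characteristics and its smoothness\<close>

locale characteristic_flow = vector_field \<Omega> \<alpha> for \<Omega> :: "(real^'n::finite) set" and \<alpha> +
  fixes \<gamma> :: "real \<times> (real^'n) \<Rightarrow> real^'n" and X :: "real \<times> (real^'n) \<Rightarrow> real^'n^'n"
  assumes \<gamma>_in: "\<And>t y. y \<in> \<Omega> \<Longrightarrow> \<gamma> (t, y) \<in> \<Omega>" and \<gamma>_0: "\<And>y. y \<in> \<Omega> \<Longrightarrow> \<gamma> (0, y) = y"
    and \<gamma>_deriv: "\<And>t y. y \<in> \<Omega> \<Longrightarrow> ((\<lambda>t. \<gamma> (t, y)) has_vector_derivative \<alpha> (t, \<gamma> (t, y))) (at t)"
    and X_0: "\<And>y. y \<in> \<Omega> \<Longrightarrow> X (0, y) = mat 1"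
    and X_deriv: "\<And>t y. y \<in> \<Omega> \<Longrightarrow>
      ((\<lambda>t. X (t, y)) has_vector_derivative - (X (t, y) ** spatial_jacobian \<alpha> (t, \<gamma> (t, y)))) (at t)"
begin

lemma \<gamma>_time_cont: "y \<in> \<Omega> \<Longrightarrow> continuous_on S (\<lambda>t. \<gamma> (t, y))"
  by (intro continuous_at_imp_continuous_on ballI has_vector_derivative_continuous[OF \<gamma>_deriv])

lemma reparametrized_deriv:
  assumes "y \<in> \<Omega>"
  shows "((\<lambda>\<sigma>. \<gamma> (p + k * \<sigma>, y)) has_vector_derivative k *\<^sub>R \<alpha> (p + k * \<sigma>, \<gamma> (p + k * \<sigma>, y))) (at \<sigma>)"
  by (rule reparametrize[OF \<gamma>_deriv[OF assms]])

text \<open>Two characteristics that meet at time \<open>t\<close> are followed back to time 0,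
  where uniqueness identifies their starting points.\<close>

lemma \<gamma>_inj: "inj_on (\<lambda>y. \<gamma> (t, y)) \<Omega>"
proof (rule inj_onI)
  fix y y' assume y: "y \<in> \<Omega>" "y' \<in> \<Omega>" "\<gamma> (t, y) = \<gamma> (t, y')"
  from curves_unique[OF reparametrized_deriv[OF y(1), of t "- t"] reparametrized_deriv[OF y(2), of t "- t"]]
  show "y = y'" using y \<gamma>_in[OF y(2)] \<gamma>_0 by simp
qed

lemma flow_close:
  assumes y0: "y0 \<in> \<Omega>" and T: "T \<ge> 0"
  obtains r C \<rho> K where "r > 0" "cball y0 r \<subseteq> \<Omega>" "C \<ge> 0" "compact K" "K \<subseteq> \<Omega>"
    "\<And>t. \<bar>t\<bar> \<le> T \<Longrightarrow> cball (\<gamma> (t, y0)) \<rho> \<subseteq> K"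
    "\<And>t y. \<bar>t\<bar> \<le> T \<Longrightarrow> y \<in> cball y0 r \<Longrightarrow> norm (\<gamma> (t, y) - \<gamma> (t, y0)) \<le> C * norm (y - y0)"
    "\<And>t y. \<bar>t\<bar> \<le> T \<Longrightarrow> y \<in> cball y0 r \<Longrightarrow> \<gamma> (t, y) \<in> cball (\<gamma> (t, y0)) \<rho>"
proof -
  let ?K0 = "(\<lambda>t. \<gamma> (t, y0)) ` {- T..T}"
  have "compact ?K0" by (intro compact_continuous_image \<gamma>_time_cont y0 compact_Icc)
  moreover have "?K0 \<subseteq> \<Omega>" using \<gamma>_in[OF y0] by blast
  ultimately obtain \<rho> K where \<rho>: "\<rho> > 0" and K: "compact K" "K \<subseteq> \<Omega>" "\<And>x. x \<in> ?K0 \<Longrightarrow> cball x \<rho> \<subseteq> K"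
    using compact_neighbourhood[OF _ \<Omega>] by metis
  have K': "cball (\<gamma> (t, y0)) \<rho> \<subseteq> K" if "\<bar>t\<bar> \<le> T" for t
    by (rule K(3)) (use that in \<open>auto simp: abs_le_iff\<close>)
  obtain L where L: "0 \<le> L" "\<And>s x y S. \<bar>s\<bar> \<le> T \<Longrightarrow> convex S \<Longrightarrow> S \<subseteq> K \<Longrightarrow> x \<in> S \<Longrightarrow> y \<in> S \<Longrightarrow>
      norm (\<alpha> (s, x) - \<alpha> (s, y)) \<le> L * norm (x - y)"
    using Ck_compact_lipschitz[OF \<alpha> K(1,2), of T] by blast
  obtain r0 where r0: "r0 > 0" "cball y0 r0 \<subseteq> \<Omega>" using \<Omega> y0 open_contains_cball by blast
  \<comment> \<open>Half of what the growth factor \<open>exp (T * L)\<close> permits, so that the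
    trajectories stay strictly closer than \<open>\<rho>\<close>.\<close>
  define r where "r = min r0 (\<rho> / (2 * exp (T * L)))"
  have r: "r > 0" "cball y0 r \<subseteq> \<Omega>" using r0 \<rho> by (auto simp: r_def)
  have small: "exp (T * L) * norm (y - y0) < \<rho>" if "y \<in> cball y0 r" for y
  proof -
    have "norm (y - y0) \<le> \<rho> / (2 * exp (T * L))" using that by (simp add: r_def dist_norm norm_minus_commute)
    then have "exp (T * L) * norm (y - y0) \<le> exp (T * L) * (\<rho> / (2 * exp (T * L)))" by (rule mult_left_mono) simp
    also have "\<dots> < \<rho>" using \<rho> by simp
    finally show ?thesis .
  qed
  have close: "norm (\<gamma> (t, y) - \<gamma> (t, y0)) \<le> exp (T * L) * norm (y - y0)" if t: "\<bar>t\<bar> \<le> T" and y: "y \<in> cball y0 r" for t y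
  proof -
    have y\<Omega>: "y \<in> \<Omega>" using y r by blast
    have tT: "\<bar>0 + t * \<sigma>\<bar> \<le> T" if "\<sigma> \<in> {0..1}" for \<sigma>
      using t that mult_mono[of "\<bar>t\<bar>" T "\<bar>\<sigma>\<bar>" 1] T by (auto simp: abs_mult)
    have "norm (\<gamma> (0 + t * 1, y) - \<gamma> (0 + t * 1, y0)) \<le> exp (T * L) * norm (\<gamma> (0 + t * 0, y) - \<gamma> (0 + t * 0, y0))"
    proof (rule curves_close[OF reparametrized_deriv[OF y\<Omega>] reparametrized_deriv[OF y0] _ L])
      show "cball (\<gamma> (0 + t * \<sigma>, y0)) \<rho> \<subseteq> K" if "\<sigma> \<in> {0..1}" for \<sigma> by (rule K'[OF tT[OF that]])
    qed (use t T small[OF y] \<gamma>_0[OF y\<Omega>] \<gamma>_0[OF y0] in auto)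
    then show ?thesis using \<gamma>_0[OF y\<Omega>] \<gamma>_0[OF y0] by simp
  qed
  show thesis
  proof (rule that[OF r _ K(1,2) K' close])
    show "\<gamma> (t, y) \<in> cball (\<gamma> (t, y0)) \<rho>" if "\<bar>t\<bar> \<le> T" "y \<in> cball y0 r" for t y
      using close[OF that] small[OF that(2)] by (simp add: dist_norm norm_minus_commute)
  qed simp_all
qed

lemma \<gamma>_continuous: "continuous_on (UNIV \<times> \<Omega>) \<gamma>"
proof (rule continuous_at_imp_continuous_on, rule ballI)
  fix p :: "real \<times> (real^'n)" assume "p \<in> UNIV \<times> \<Omega>"
  then obtain t0 y0 where p: "p = (t0, y0)" "y0 \<in> \<Omega>" by auto
  define T where "T = \<bar>t0\<bar> + 1"
  have T: "T \<ge> 0" by (simp add: T_def)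
  obtain r C where r: "r > 0" "C \<ge> 0"
    and C: "\<And>t y. \<bar>t\<bar> \<le> T \<Longrightarrow> y \<in> cball y0 r \<Longrightarrow> norm (\<gamma> (t, y) - \<gamma> (t, y0)) \<le> C * norm (y - y0)"
    by (rule flow_close[OF p(2) T]) blast
  show "isCont \<gamma> p"
    unfolding continuous_at_eps_delta p
  proof (intro allI impI)
    fix e :: real assume e: "e > 0"
    define d1 where "d1 = e / (2 * (C + 1))"
    have d1: "d1 > 0" "C * d1 < e / 2" using e r by (auto simp: d1_def field_simps)
    have "isCont (\<lambda>t. \<gamma> (t, y0)) t0"
      using \<gamma>_time_cont[OF p(2), of UNIV] by (simp add: continuous_on_eq_continuous_at)
    then obtain d2 where d2: "d2 > 0" "\<And>t. dist t t0 < d2 \<Longrightarrow> dist (\<gamma> (t, y0)) (\<gamma> (t0, y0)) < e / 2"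
      using e unfolding continuous_at_eps_delta by (metis half_gt_zero)
    show "\<exists>d>0. \<forall>x'. dist x' (t0, y0) < d \<longrightarrow> dist (\<gamma> x') (\<gamma> (t0, y0)) < e"
    proof (intro exI[of _ "Min {d1, d2, r, 1}"] conjI allI impI)
      show "Min {d1, d2, r, 1} > 0" using d1 d2 r by simp
      fix q assume q: "dist q (t0, y0) < Min {d1, d2, r, 1}"
      obtain t y where ty: "q = (t, y)" by (cases q)
      have dt: "dist t t0 < d2" "dist t t0 < 1" and dy: "dist y y0 < d1" "dist y y0 < r"
        using q dist_fst_le[of q "(t0, y0)"] dist_snd_le[of q "(t0, y0)"] by (auto simp: ty)
      have tT: "\<bar>t\<bar> \<le> T" using dt(2) by (auto simp: T_def dist_real_def)
      have yr: "y \<in> cball y0 r" using dy by (simp add: dist_commute)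
      have "norm (\<gamma> (t, y) - \<gamma> (t, y0)) \<le> C * d1"
        using dy(1) r by (intro order.trans[OF C[OF tT yr]] mult_left_mono) (auto simp: dist_norm)
      then have "dist (\<gamma> (t, y)) (\<gamma> (t, y0)) < e / 2" using d1 by (simp add: dist_norm)
      then show "dist (\<gamma> q) (\<gamma> (t0, y0)) < e"
        using d2(2)[OF dt(1)] dist_triangle[of "\<gamma> (t, y)" "\<gamma> (t0, y0)" "\<gamma> (t, y0)"] unfolding ty by linarith
    qed
  qed
qed

lemma open_dom: "open (UNIV \<times> \<Omega> :: (real \<times> (real^'n)) set)"
  using \<Omega> by (simp add: open_Times)

lemma jacobian_Ck: "Ck k (UNIV \<times> \<Omega>) (spatial_jacobian \<alpha>)"
  unfolding spatial_jacobian_def[abs_def]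
  by (intro Ck_vec_lambda Ck_vec_nth open_dom Ck_partial_deriv[OF \<alpha>]) (simp add: Basis_prod_def image_iff axis_in_Basis_iff)

lemma Ck_along_flow: "Ck k (UNIV \<times> \<Omega>) \<gamma> \<Longrightarrow> Ck k (UNIV \<times> \<Omega>) (\<lambda>p. f (fst p, \<gamma> p))"
  if "\<And>k. Ck k (UNIV \<times> \<Omega>) f"
  by (rule Ck_compose[OF open_dom open_dom _ that]) (auto intro!: Ck_intros open_dom \<gamma>_in)

sublocale linear_flow \<Omega> "\<lambda>p. spatial_jacobian \<alpha> (fst p, \<gamma> p)" X
proof
  show "continuous_on (UNIV \<times> \<Omega>) (\<lambda>p. spatial_jacobian \<alpha> (fst p, \<gamma> p))"
    using Ck_along_flow[OF jacobian_Ck, of 0] \<gamma>_continuous by simp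
qed (use \<Omega> X_0 X_deriv in simp_all)

text \<open>When \<open>X (s, y0) *v (\<gamma> (s, y) - \<gamma> (s, y0))\<close> is differentiated
  in time, the linear part of the vector field cancels, because \<open>X\<close> solves the adjoint
  equation. Only the Taylor remainder of \<open>\<alpha>\<close> is left, so the quantity stays
  within a quadratic error of its initial value \<open>y - y0\<close>; applying \<open>J\<close>
  gives the expansion of \<open>\<gamma>\<close>.\<close>

lemma \<gamma>_space_deriv:
  assumes y0: "y0 \<in> \<Omega>"
  shows "((\<lambda>y. \<gamma> (t, y)) has_derivative (\<lambda>h. J (t, y0) *v h)) (at y0)"
proof -
  interpret mv: bounded_bilinear "(*v) :: real^'n^'n \<Rightarrow> real^'n \<Rightarrow> real^'n"
    by (rule bounded_bilinear_matrix_vector_mult)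
  define T where "T = \<bar>t\<bar>"
  have T: "T \<ge> 0" "\<bar>t\<bar> \<le> T" by (auto simp: T_def)
  obtain r C \<rho> K where r: "r > 0" "cball y0 r \<subseteq> \<Omega>" "C \<ge> 0" and K: "compact K" "K \<subseteq> \<Omega>"
    "\<And>t. \<bar>t\<bar> \<le> T \<Longrightarrow> cball (\<gamma> (t, y0)) \<rho> \<subseteq> K"
    and C: "\<And>t y. \<bar>t\<bar> \<le> T \<Longrightarrow> y \<in> cball y0 r \<Longrightarrow> norm (\<gamma> (t, y) - \<gamma> (t, y0)) \<le> C * norm (y - y0)"
    "\<And>t y. \<bar>t\<bar> \<le> T \<Longrightarrow> y \<in> cball y0 r \<Longrightarrow> \<gamma> (t, y) \<in> cball (\<gamma> (t, y0)) \<rho>"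
    by (rule flow_close[OF y0 T(1)]) blast
  obtain M where M: "M \<ge> 0" "\<And>s x y S. \<bar>s\<bar> \<le> T \<Longrightarrow> convex S \<Longrightarrow> S \<subseteq> K \<Longrightarrow> x \<in> S \<Longrightarrow> y \<in> S \<Longrightarrow>
    norm (\<alpha> (s, x) - \<alpha> (s, y) - spatial_jacobian \<alpha> (s, y) *v (x - y)) \<le> M * (norm (x - y))\<^sup>2"
    using Ck_compact_taylor[OF \<alpha> K(1,2), of T] unfolding spatial_jacobian_mult by blast
  obtain k where k: "k > 0" "\<And>(A::real^'n^'n) (v::real^'n). norm (A *v v) \<le> norm A * norm v * k"
    using mv.pos_bounded by metis
  obtain D where D: "D \<ge> 0" "\<And>s. \<bar>s\<bar> \<le> T \<Longrightarrow> norm (X (s, y0)) \<le> D"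
  proof -
    obtain r' D where "r' > 0" "D \<ge> 0" "\<And>s y. \<bar>s\<bar> \<le> T \<Longrightarrow> y \<in> cball y0 r' \<Longrightarrow> norm (X (s, y)) \<le> D"
      by (rule bounds[OF y0 T(1)]) blast
    then show thesis using that[of D] by simp
  qed
  define E where "E = D * (M * C\<^sup>2) * k * T"
  have est: "norm (X (t, y0) *v (\<gamma> (t, y) - \<gamma> (t, y0)) - (y - y0)) \<le> E * (norm (y - y0))\<^sup>2" if y: "y \<in> cball y0 r" for y
  proof -
    have y\<Omega>: "y \<in> \<Omega>" using y r by blast
    let ?w = "\<lambda>s. \<gamma> (s, y) - \<gamma> (s, y0)"
    let ?R = "\<lambda>s. \<alpha> (s, \<gamma> (s, y)) - \<alpha> (s, \<gamma> (s, y0)) - spatial_jacobian \<alpha> (s, \<gamma> (s, y0)) *v ?w s"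
    have P: "((\<lambda>s. X (s, y0) *v ?w s) has_vector_derivative X (s, y0) *v ?R s) (at s)" for s
    proof -
      have "((\<lambda>s. X (s, y0) *v ?w s) has_vector_derivative
          (X (s, y0) *v (\<alpha> (s, \<gamma> (s, y)) - \<alpha> (s, \<gamma> (s, y0))) + - (X (s, y0) ** spatial_jacobian \<alpha> (s, \<gamma> (s, y0))) *v ?w s)) (at s)"
        by (rule mv.has_vector_derivative[OF X_deriv[OF y0, unfolded fst_conv] has_vector_derivative_diff[OF \<gamma>_deriv[OF y\<Omega>] \<gamma>_deriv[OF y0]]])
      then show ?thesis
        by (simp add: mv.diff_right mv.minus_left matrix_vector_mul_assoc algebra_simps)
    qed
    have "norm (X (t, y0) *v ?w t - X (0, y0) *v ?w 0) \<le> (D * (M * (C * norm (y - y0))\<^sup>2) * k) * \<bar>t\<bar>"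
    proof (rule norm_diff_le_mvt[OF P _ T(2)])
      fix s assume s: "\<bar>s\<bar> \<le> T"
      have "norm (?R s) \<le> M * (norm (?w s))\<^sup>2"
        by (rule M(2)[OF s convex_cball K(3)[OF s] C(2)[OF s y]]) (use C(2)[OF s, of y0] r in simp)
      also have "\<dots> \<le> M * (C * norm (y - y0))\<^sup>2"
        using C(1)[OF s y] M(1) by (intro mult_left_mono power_mono) auto
      finally have "norm (?R s) \<le> M * (C * norm (y - y0))\<^sup>2" .
      then have "norm (X (s, y0)) * norm (?R s) * k \<le> D * (M * (C * norm (y - y0))\<^sup>2) * k"
        using D(2)[OF s] D(1) k(1) by (intro mult_right_mono mult_mono) auto
      then show "norm (X (s, y0) *v ?R s) \<le> D * (M * (C * norm (y - y0))\<^sup>2) * k"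
        by (rule order.trans[OF k(2)])
    qed
    moreover have "X (0, y0) *v ?w 0 = y - y0" using X_0[OF y0] \<gamma>_0[OF y0] \<gamma>_0[OF y\<Omega>] by simp
    moreover have "(D * (M * (C * norm (y - y0))\<^sup>2) * k) * \<bar>t\<bar> = E * (norm (y - y0))\<^sup>2"
      by (simp add: E_def T_def power_mult_distrib)
    ultimately show ?thesis by simp
  qed
  have G: "((\<lambda>y. J (t, y0) *v y) has_derivative (\<lambda>h. J (t, y0) *v h)) (at y0)"
    by (rule bounded_linear_imp_has_derivative) simp
  show ?thesis
  proof (rule has_derivative_quadratic_remainder[OF G r(1)])
    fix y assume y: "y \<in> cball y0 r"
    have "J (t, y0) *v (X (t, y0) *v (\<gamma> (t, y) - \<gamma> (t, y0)) - (y - y0)) = \<gamma> (t, y) - \<gamma> (t, y0) - (J (t, y0) *v y - J (t, y0) *v y0)"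
      by (simp add: mv.diff_right matrix_vector_mul_assoc XJ[OF y0])
    then have "norm (\<gamma> (t, y) - \<gamma> (t, y0) - (J (t, y0) *v y - J (t, y0) *v y0))
        \<le> norm (J (t, y0)) * norm (X (t, y0) *v (\<gamma> (t, y) - \<gamma> (t, y0)) - (y - y0)) * k"
      using k(2) by metis
    also have "\<dots> \<le> norm (J (t, y0)) * (E * (norm (y - y0))\<^sup>2) * k"
      using est[OF y] k(1) by (intro mult_right_mono mult_left_mono) auto
    finally show "norm (\<gamma> (t, y) - \<gamma> (t, y0) - (J (t, y0) *v y - J (t, y0) *v y0)) \<le> (norm (J (t, y0)) * E * k) * (norm (y - y0))\<^sup>2"
      by (simp add: mult_ac)
  qed
qed

text \<open>Both partial derivatives of \<open>\<gamma>\<close> inherit its class: the one in time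
  is \<open>\<alpha>\<close> along \<open>\<gamma>\<close>, the one in space is \<open>J\<close>,
  which depends on \<open>\<gamma>\<close> through the Jacobian of \<open>\<alpha>\<close>. Hence
  each order yields the next.\<close>

lemma \<gamma>_Ck: "Ck k (UNIV \<times> \<Omega>) \<gamma>"
proof (induction k)
  case 0
  show ?case by (simp add: \<gamma>_continuous)
next
  case (Suc k)
  have CB: "Ck k (UNIV \<times> \<Omega>) (\<lambda>p. spatial_jacobian \<alpha> (fst p, \<gamma> p))" by (rule Ck_along_flow[OF jacobian_Ck Suc])
  have CJ: "Ck k (UNIV \<times> \<Omega>) J" unfolding J_def
    by (rule Ck_matrix_inv[OF open_dom X_Ck[OF CB]]) (auto intro: X_invertible)
  have C\<alpha>: "Ck k (UNIV \<times> \<Omega>) (\<lambda>p. \<alpha> (fst p, \<gamma> p))" by (rule Ck_along_flow[OF \<alpha> Suc])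
  show ?case
  proof (rule Ck_SucI[OF open_dom])
    fix p :: "real \<times> (real^'n)" assume "p \<in> UNIV \<times> \<Omega>"
    then obtain t y where p: "p = (t, y)" "y \<in> \<Omega>" by auto
    have "((\<lambda>t. \<gamma> (t, y)) has_vector_derivative (\<lambda>p. \<alpha> (fst p, \<gamma> p)) (t, y)) (at t)" if "y \<in> \<Omega>" for t y
      using \<gamma>_deriv[OF that] by simp
    from has_derivative_time_space[OF \<Omega> p(2) this Ck_continuous_on[OF C\<alpha>] \<gamma>_space_deriv[OF p(2)]]
    show "(\<gamma> has_derivative (\<lambda>(\<tau>, h). \<tau> *\<^sub>R \<alpha> (fst p, \<gamma> p) + J p *v h)) (at p)" by (simp add: p(1))
  next
    fix b :: "real \<times> (real^'n)"
    show "Ck k (UNIV \<times> \<Omega>) (\<lambda>p. case b of (\<tau>, h) \<Rightarrow> \<tau> *\<^sub>R \<alpha> (fst p, \<gamma> p) + J p *v h)"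
      unfolding case_prod_unfold by (intro Ck_intros open_dom C\<alpha> CJ)
  qed
qed

lemma X_smooth: "Ck k (UNIV \<times> \<Omega>) X"
  by (rule X_Ck[OF Ck_along_flow[OF jacobian_Ck \<gamma>_Ck]])

lemma Ck_time_slice:
  fixes f :: "real \<times> (real^'n) \<Rightarrow> 'b::real_normed_vector"
  assumes "Ck k (UNIV \<times> \<Omega>) f"
  shows "Ck k \<Omega> (\<lambda>y. f (t, y))"
  by (rule Ck_compose[OF \<Omega> open_dom _ assms]) (auto intro!: Ck_intros \<Omega>)

text \<open>The difference of the two sides solves the same linear equation with initial value
  0.\<close>

lemma covector_unique:
  assumes y: "y \<in> \<Omega>" and c: "\<And>s. (c has_vector_derivative - (c s v* spatial_jacobian \<alpha> (s, \<gamma> (s, y)))) (at s)"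
  shows "c t = c 0 v* X (t, y)"
proof -
  interpret vm: bounded_bilinear "(v*) :: real^'n \<Rightarrow> real^'n^'n \<Rightarrow> real^'n"
    by (rule bounded_bilinear_vector_matrix_mult)
  let ?A = "\<lambda>s. spatial_jacobian \<alpha> (s, \<gamma> (s, y))"
  obtain K where K: "K > 0" "\<And>(v::real^'n) (A::real^'n^'n). norm (v v* A) \<le> norm v * norm A * K"
    using vm.pos_bounded by metis
  obtain L where L: "L \<ge> 0" "\<And>s z. \<bar>s\<bar> \<le> \<bar>t\<bar> \<Longrightarrow> z \<in> {y} \<Longrightarrow> norm (spatial_jacobian \<alpha> (fst (s, z), \<gamma> (s, z))) \<le> L"
    using B_bound[of "{y}" "\<bar>t\<bar>"] y by auto
  let ?d = "\<lambda>s. c s - c 0 v* X (s, y)"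
  have "(?d has_vector_derivative - (?d s v* ?A s)) (at s)" for s
  proof -
    have "((\<lambda>s. c 0 v* X (s, y)) has_vector_derivative c 0 v* (- (X (s, y) ** ?A s))) (at s)"
      by (rule bounded_linear.has_vector_derivative[OF vm.bounded_linear_right X_deriv[OF y, unfolded fst_conv]])
    from has_vector_derivative_diff[OF c this] show ?thesis
      by (simp add: vm.diff_left vm.minus_right vector_matrix_mul_assoc)
  qed
  then have "norm (?d t) \<le> exp (L * K * \<bar>t\<bar>) * norm (?d 0)"
  proof (rule gronwall_abs(1))
    show "norm (- (?d s v* ?A s)) \<le> L * K * norm (?d s)" if "\<bar>s\<bar> \<le> \<bar>t\<bar>" for s
    proof -
      have "norm (?d s v* ?A s) \<le> norm (?d s) * norm (?A s) * K" by (rule K)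
      also have "\<dots> \<le> norm (?d s) * L * K"
        using L(2)[OF that, of y] K(1) by (intro mult_right_mono mult_left_mono) auto
      finally show ?thesis by (simp add: mult_ac)
    qed
  qed (use L K in auto)
  then show ?thesis using X_0[OF y] by simp
qed

text \<open>Continuity of the inverse comes from invariance of domain. Its derivative is then
  \<open>X (t, \<kappa> x)\<close>, an expression in \<open>\<kappa>\<close> itself, which gives
  smoothness by induction.\<close>

lemma inverse_flow:
  assumes onto: "(\<lambda>y. \<gamma> (t, y)) ` \<Omega> = \<Omega>"
  obtains \<kappa> where "\<And>x. x \<in> \<Omega> \<Longrightarrow> \<kappa> x \<in> \<Omega>" "\<And>x. x \<in> \<Omega> \<Longrightarrow> \<gamma> (t, \<kappa> x) = x" "\<And>y. y \<in> \<Omega> \<Longrightarrow> \<kappa> (\<gamma> (t, y)) = y"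
    "\<And>k. Ck k \<Omega> \<kappa>" "\<And>x. x \<in> \<Omega> \<Longrightarrow> (\<kappa> has_derivative (\<lambda>h. X (t, \<kappa> x) *v h)) (at x)"
proof -
  have c: "continuous_on \<Omega> (\<lambda>y. \<gamma> (t, y))" by (rule Ck_continuous_on[OF Ck_time_slice[OF \<gamma>_Ck]])
  obtain \<kappa> where h: "homeomorphism \<Omega> ((\<lambda>y. \<gamma> (t, y)) ` \<Omega>) (\<lambda>y. \<gamma> (t, y)) \<kappa>"
    using invariance_of_domain_homeomorphism[OF \<Omega> c _ \<gamma>_inj] by auto
  have \<kappa>: "\<And>x. x \<in> \<Omega> \<Longrightarrow> \<kappa> x \<in> \<Omega>" "\<And>x. x \<in> \<Omega> \<Longrightarrow> \<gamma> (t, \<kappa> x) = x" "\<And>y. y \<in> \<Omega> \<Longrightarrow> \<kappa> (\<gamma> (t, y)) = y"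
    and c\<kappa>: "continuous_on \<Omega> \<kappa>"
    using h unfolding homeomorphism_def onto by auto
  have D: "(\<kappa> has_derivative (\<lambda>h. X (t, \<kappa> x) *v h)) (at x)" if x: "x \<in> \<Omega>" for x
  proof (rule has_derivative_inverse_basic[where f="\<lambda>y. \<gamma> (t, y)" and f'="(*v) (J (t, \<kappa> x))" and T=\<Omega>])
    show "((\<lambda>y. \<gamma> (t, y)) has_derivative (*v) (J (t, \<kappa> x))) (at (\<kappa> x))"
      by (rule \<gamma>_space_deriv[OF \<kappa>(1)[OF x]])
    show "(*v) (X (t, \<kappa> x)) \<circ> (*v) (J (t, \<kappa> x)) = id"
      by (simp add: fun_eq_iff matrix_vector_mul_assoc XJ[OF \<kappa>(1)[OF x]])
    show "continuous (at x) \<kappa>" using c\<kappa> x \<Omega> by (simp add: continuous_on_eq_continuous_at)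
  qed (use \<kappa>(2) x \<Omega> in auto)
  have "Ck k \<Omega> \<kappa>" for k
  proof (induction k)
    case 0
    show ?case using c\<kappa> by simp
  next
    case (Suc k)
    show ?case
    proof (rule Ck_SucI[OF \<Omega> D])
      show "Ck k \<Omega> (\<lambda>x. X (t, \<kappa> x) *v b)" for b
        by (intro Ck_matrix_vector_mult \<Omega> Ck_const Ck_compose[OF \<Omega> \<Omega> \<kappa>(1) Ck_time_slice[OF X_smooth] Suc])
    qed
  qed
  with \<kappa> D show thesis by (intro that)
qed

end

section \<open>Transport along characteristics\<close>

text \<open>By substitution the expression equals \<open>g t - g 0\<close> for an antiderivative
  \<open>g\<close> of \<open>h\<close>, taken on an interval that has \<open>t\<close> in its
  interior.\<close>

lemma has_vector_derivative_rescaled_integral: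
  fixes h :: "real \<Rightarrow> 'b::euclidean_space"
  assumes h: "continuous_on UNIV h"
  shows "((\<lambda>t. t *\<^sub>R integral {0..1} (\<lambda>\<sigma>. h (t * \<sigma>))) has_vector_derivative h t) (at t)"
proof -
  define T where "T = \<bar>t\<bar> + 1"
  obtain g where g: "\<And>x. x \<in> {- T..T} \<Longrightarrow> (g has_vector_derivative h x) (at x within {- T..T})"
    using antiderivative_continuous[OF continuous_on_subset[OF h subset_UNIV]] by blast
  have g': "(g has_vector_derivative h x) (at x)" if "x \<in> {- T<..<T}" for x
  proof -
    have "(g has_vector_derivative h x) (at x within {- T<..<T})"
      by (rule has_vector_derivative_within_subset[OF g]) (use that in auto)
    then show ?thesis using that by (simp add: at_within_open[of x "{- T<..<T}"])
  qed
  have eq: "g s - g 0 = s *\<^sub>R integral {0..1} (\<lambda>\<sigma>. h (s * \<sigma>))" if s: "s \<in> {- T<..<T}" for s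
  proof -
    have "((\<lambda>\<sigma>. g (s * \<sigma>)) has_vector_derivative s *\<^sub>R h (s * \<sigma>)) (at \<sigma> within {0..1})" if \<sigma>: "\<sigma> \<in> {0..1}" for \<sigma>
    proof -
      have "\<bar>s * \<sigma>\<bar> \<le> \<bar>s\<bar>" using \<sigma> by (simp add: abs_mult mult_left_le)
      then have "s * \<sigma> \<in> {- T<..<T}" using s by (auto simp: abs_le_iff)
      moreover have "((\<lambda>\<sigma>. s * \<sigma>) has_vector_derivative s) (at \<sigma>)" by (auto intro!: derivative_eq_intros)
      ultimately show ?thesis
        using vector_diff_chain_at[of "\<lambda>\<sigma>. s * \<sigma>" s \<sigma> g "h (s * \<sigma>)"] g'
        by (auto simp: o_def intro: has_vector_derivative_at_within)
    qed
    then have "((\<lambda>\<sigma>. s *\<^sub>R h (s * \<sigma>)) has_integral (g (s * 1) - g (s * 0))) {0..1}"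
      by (intro fundamental_theorem_of_calculus) auto
    from integral_unique[OF this] show ?thesis by simp
  qed
  have "((\<lambda>s. g s - g 0) has_vector_derivative h t - 0) (at t)"
    by (intro has_vector_derivative_diff g' has_vector_derivative_const) (auto simp: T_def)
  then have "((\<lambda>s. g s - g 0) has_vector_derivative h t) (at t)" by simp
  then show ?thesis
    by (rule has_vector_derivative_transform_within_open[where S="{- T<..<T}"]) (auto simp: eq T_def)
qed

lemma colombeau_rel_eqI:
  assumes "open S" "u \<in> moderate_nets S" "w \<in> moderate_nets S" "\<And>\<epsilon> x. x \<in> S \<Longrightarrow> u \<epsilon> x = w \<epsilon> x"
  shows "(u, w) \<in> colombeau_rel S"
proof -
  have "net_bound K (\<lambda>\<epsilon> x. u \<epsilon> x - w \<epsilon> x) q" if "K \<subseteq> S" for K q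
    unfolding net_bound_def using assms(4) that by (intro exI[of _ 0]) (auto simp: subset_iff)
  then show ?thesis using assms(2,3) unfolding colombeau_rel_iff[OF assms(1)] negligible0_def by blast
qed

lemma colombeau_at_time_iff:
  "w \<in> colombeau_at_time \<Omega> t U \<longleftrightarrow> (\<exists>u\<in>U. (\<lambda>\<epsilon> x. u \<epsilon> (x, t), w) \<in> colombeau_rel \<Omega>)"
  by (auto simp: colombeau_at_time_def colombeau_map_def colombeau_class_def)

locale transport_equation = characteristic_flow \<Omega> \<alpha> \<gamma> X
  for \<Omega> :: "(real^'n::finite) set" and \<alpha> \<gamma> X +
  fixes a :: "'n \<Rightarrow> real \<times> (real^'n) \<Rightarrow> complex" and b :: "real \<times> (real^'n) \<Rightarrow> complex"
  assumes a_real: "\<And>j t x. x \<in> \<Omega> \<Longrightarrow> a j (t, x) = of_real (\<alpha> (t, x) $ j)"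
    and a: "\<And>j k. Ck k (UNIV \<times> \<Omega>) (a j)" and b: "\<And>k. Ck k (UNIV \<times> \<Omega>) b"
begin

text \<open>The integral is over \<open>{0..1}\<close> rather than over \<open>{0..t}\<close> because this makes sense for \<open>t < 0\<close> as well and
  allows differentiation under the integral sign.\<close>

definition phase :: "real \<times> (real^'n) \<Rightarrow> complex" where
  "phase p = fst p *\<^sub>R integral {0..1} (\<lambda>\<sigma>. b (fst p * \<sigma>, \<gamma> (fst p * \<sigma>, snd p)))"

lemma phase_Ck: "Ck k (UNIV \<times> \<Omega>) phase"
proof -
  have oo: "open ((UNIV \<times> \<Omega>) \<times> UNIV :: ((real \<times> (real^'n)) \<times> real) set)" using open_dom by (simp add: open_Times)
  have C: "Ck k (UNIV \<times> \<Omega>) (\<lambda>p. b (fst p, \<gamma> p))" by (rule Ck_along_flow[OF b \<gamma>_Ck])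
  have "Ck k ((UNIV \<times> \<Omega>) \<times> UNIV) (\<lambda>q. (\<lambda>p. b (fst p, \<gamma> p)) (fst (fst q) * snd q, snd (fst q)))"
    by (rule Ck_compose[OF oo open_dom _ C, of "\<lambda>q. (fst (fst q) * snd q, snd (fst q))"]) (auto intro!: Ck_intros oo)
  from Ck_integral_param[OF open_dom this]
  have "Ck k (UNIV \<times> \<Omega>) (\<lambda>p. integral {0..1} (\<lambda>\<sigma>. b (fst p * \<sigma>, \<gamma> (fst p * \<sigma>, snd p))))" by simp
  then show ?thesis unfolding phase_def[abs_def] by (intro Ck_intros open_dom)
qed

lemma phase_0: "phase (0, y) = 0" by (simp add: phase_def)

lemma phase_deriv:
  assumes y: "y \<in> \<Omega>"
  shows "((\<lambda>s. phase (s, y)) has_vector_derivative b (s, \<gamma> (s, y))) (at s)"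
proof -
  have "Ck 0 (UNIV \<times> \<Omega>) (\<lambda>p. b (fst p, \<gamma> p))" by (rule Ck_along_flow[OF b \<gamma>_Ck])
  then have "continuous_on UNIV (\<lambda>s. b (s, \<gamma> (s, y)))"
    using slice_continuous[of "\<lambda>p. b (fst p, \<gamma> p)" y UNIV] y by simp
  from has_vector_derivative_rescaled_integral[OF this] show ?thesis by (simp add: phase_def)
qed

text \<open>The curve \<open>(\<gamma> (s, y), s)\<close> has velocity \<open>(\<alpha>, 1)\<close>.
  Since the factors \<open>\<i>\<close> and \<open>- \<i>\<close> cancel, differentiating
  \<open>f\<close> along it yields the evolution operator up to its term of order zero, and the
  integrating factor \<open>exp (\<i> * phase)\<close> absorbs that term.\<close>

lemma along_characteristic:
  fixes f :: "(real^'n) \<times> real \<Rightarrow> complex"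
  assumes y: "y \<in> \<Omega>" and f: "\<And>z. z \<in> \<Omega> \<times> UNIV \<Longrightarrow> f differentiable at z"
  shows "((\<lambda>s. exp (\<i> * phase (s, y)) * f (\<gamma> (s, y), s)) has_vector_derivative
    exp (\<i> * phase (s, y)) * evolution_op a b f (\<gamma> (s, y), s)) (at s)"
proof -
  let ?z = "(\<gamma> (s, y), s)" and ?v = "\<alpha> (s, \<gamma> (s, y))"
  let ?D = "frechet_derivative f (at ?z)"
  have z: "?z \<in> \<Omega> \<times> UNIV" using \<gamma>_in[OF y] by simp
  have D: "(f has_derivative ?D) (at ?z)" using f[OF z] by (simp add: frechet_derivative_works)
  then interpret D: bounded_linear ?D by (rule has_derivative_bounded_linear)
  have "((\<lambda>s. (\<gamma> (s, y), s)) has_vector_derivative (?v, 1)) (at s)"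
    by (intro has_vector_derivative_Pair \<gamma>_deriv y has_vector_derivative_id)
  then have "((\<lambda>s. (\<gamma> (s, y), s)) has_derivative (\<lambda>h. h *\<^sub>R (?v, 1))) (at s)"
    by (simp add: has_vector_derivative_def)
  from has_derivative_compose[OF this D]
  have f1: "((\<lambda>s. f (\<gamma> (s, y), s)) has_vector_derivative ?D (?v, 1)) (at s)"
    by (simp add: has_vector_derivative_def D.scaleR[symmetric])
  have "(?v, 1::real) = (\<Sum>j\<in>UNIV. (?v $ j) *\<^sub>R (axis j 1, 0)) + (0, 1)"
  proof (rule prod_eqI)
    show "fst (?v, 1::real) = fst ((\<Sum>j\<in>UNIV. (?v $ j) *\<^sub>R (axis j 1, 0)) + (0, 1))"
      by (simp add: fst_sum vec_eq_iff axis_def if_distrib[of "\<lambda>x. _ * x"] cong: if_cong)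
    show "snd (?v, 1::real) = snd ((\<Sum>j\<in>UNIV. (?v $ j) *\<^sub>R (axis j 1 :: real^'n, 0)) + (0, 1))"
      by (simp add: snd_sum)
  qed
  then have "?D (?v, 1) = (\<Sum>j\<in>UNIV. (?v $ j) *\<^sub>R ?D (axis j 1, 0)) + ?D (0, 1)"
    by (simp only: D.add D.sum D.scaleR)
  also have "\<dots> = evolution_op a b f ?z - \<i> * b (s, \<gamma> (s, y)) * f ?z"
    using a_real[OF \<gamma>_in[OF y]]
    by (simp add: evolution_op_def first_order_op_def D_x_def partial_deriv_def scaleR_conv_of_real
      algebra_simps sum_distrib_left sum_negf)
  finally have f2: "((\<lambda>s. f (\<gamma> (s, y), s)) has_vector_derivative evolution_op a b f ?z - \<i> * b (s, \<gamma> (s, y)) * f ?z) (at s)"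
    using f1 by simp
  have "((\<lambda>s. \<i> * phase (s, y)) has_vector_derivative \<i> * b (s, \<gamma> (s, y))) (at s)"
    by (rule bounded_linear.has_vector_derivative[OF bounded_linear_mult_right phase_deriv[OF y]])
  then have "((\<lambda>s. exp (\<i> * phase (s, y))) has_vector_derivative (\<i> * b (s, \<gamma> (s, y))) * exp (\<i> * phase (s, y))) (at s)"
    using field_vector_diff_chain_at[of "\<lambda>s. \<i> * phase (s, y)" _ s exp] DERIV_exp by (fastforce simp: o_def)
  from has_vector_derivative_mult[OF this f2] show ?thesis
    by (simp add: algebra_simps)
qed

definition amplitude :: "real \<Rightarrow> real^'n \<Rightarrow> complex" where
  "amplitude t y = exp (- \<i> * phase (t, y))"

lemma amplitude_Ck: "Ck k \<Omega> (amplitude t)"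
  unfolding amplitude_def[abs_def] by (intro Ck_intros \<Omega> Ck_time_slice[OF phase_Ck])

lemma amplitude_nonzero: "amplitude t y \<noteq> 0" by (simp add: amplitude_def)

text \<open>By \<open>along_characteristic\<close> a small residual of the equation means a small
  derivative of \<open>exp (\<i> * phase) * u\<close>, and the mean value inequality bounds its
  increment between times 0 and \<open>t\<close>.\<close>

lemma transport_negligible:
  assumes u: "u \<in> moderate_nets (\<Omega> \<times> UNIV)" and n: "negligible0 (\<Omega> \<times> UNIV) (\<lambda>\<epsilon>. evolution_op a b (u \<epsilon>))"
  shows "negligible0 \<Omega> (\<lambda>\<epsilon> y. u \<epsilon> (\<gamma> (t, y), t) - amplitude t y * u \<epsilon> (y, 0))"
  unfolding negligible0_def
proof (intro allI impI, elim conjE)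
  fix K and q :: real assume K: "compact K" "K \<subseteq> \<Omega>"
  let ?I = "{- \<bar>t\<bar>..\<bar>t\<bar>} \<times> K"
  \<comment> \<open>The part of space-time swept out by the characteristics that start in
    \<open>K\<close>; its compactness gives one estimate of the residual for all of them.\<close>
  define K' where "K' = (\<lambda>p. (\<gamma> p, fst p)) ` ?I"
  have sub: "?I \<subseteq> UNIV \<times> \<Omega>" using K by auto
  have cI: "compact ?I" using K by (intro compact_Times compact_Icc)
  have "compact K'"
    unfolding K'_def by (intro compact_continuous_image continuous_on_Pair continuous_on_fst continuous_on_id
      continuous_on_subset[OF \<gamma>_continuous sub] cI)
  moreover have "K' \<subseteq> \<Omega> \<times> UNIV" unfolding K'_def using K \<gamma>_in by auto
  ultimately have "net_bound K' (\<lambda>\<epsilon>. evolution_op a b (u \<epsilon>)) q" using n unfolding negligible0_def by blast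
  then obtain C where C: "C \<ge> 0" "\<forall>\<^sub>F \<epsilon> in at_right 0. \<forall>z\<in>K'. norm (evolution_op a b (u \<epsilon>) z) \<le> C * \<epsilon> powr q"
    unfolding net_bound_def by blast
  have "compact (phase ` ?I)"
    by (rule compact_continuous_image[OF continuous_on_subset[OF Ck_continuous_on[OF phase_Ck] sub] cI])
  then have "compact ((\<lambda>w. exp (c * w)) ` phase ` ?I)" for c
    by (rule compact_continuous_image[rotated]) (intro continuous_intros)
  from this[of \<i>] this[of "- \<i>"] have "bounded ((\<lambda>w. exp (\<i> * w)) ` phase ` ?I)" "bounded ((\<lambda>w. exp (- \<i> * w)) ` phase ` ?I)"
    by (auto intro: compact_imp_bounded)
  then obtain B B' where B: "B > 0" "\<And>p. p \<in> ?I \<Longrightarrow> norm (exp (\<i> * phase p)) \<le> B"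
    and B': "B' > 0" "\<And>p. p \<in> ?I \<Longrightarrow> norm (exp (- \<i> * phase p)) \<le> B'"
    unfolding bounded_pos by (metis (no_types, lifting) imageI)
  have "\<forall>\<^sub>F \<epsilon> in at_right 0. \<forall>y\<in>K. norm (u \<epsilon> (\<gamma> (t, y), t) - amplitude t y * u \<epsilon> (y, 0)) \<le> (B' * (B * C * \<bar>t\<bar>)) * \<epsilon> powr q"
    using C(2) eventually_unit_interval
  proof eventually_elim
    case (elim \<epsilon>)
    show ?case
    proof
      fix y assume yK: "y \<in> K"
      then have y: "y \<in> \<Omega>" using K by blast
      have "smooth_net (\<Omega> \<times> UNIV) u" using u by (simp only: moderate_nets_iff)
      then have ud: "u \<epsilon> differentiable at z" if "z \<in> \<Omega> \<times> UNIV" for z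
        by (rule smooth_net_differentiable[OF _ elim(2) that])
      let ?P = "\<lambda>s. exp (\<i> * phase (s, y)) * u \<epsilon> (\<gamma> (s, y), s)"
      have "norm (?P t - ?P 0) \<le> (B * (C * \<epsilon> powr q)) * \<bar>t\<bar>"
      proof (rule norm_diff_le_mvt[OF along_characteristic[OF y ud]])
        fix s assume s: "\<bar>s\<bar> \<le> \<bar>t\<bar>"
        then have sI: "(s, y) \<in> ?I" using yK by (auto simp: abs_le_iff)
        then have "(\<gamma> (s, y), s) \<in> K'" unfolding K'_def by (intro image_eqI[OF _ sI]) simp
        then show "norm (exp (\<i> * phase (s, y)) * evolution_op a b (u \<epsilon>) (\<gamma> (s, y), s)) \<le> B * (C * \<epsilon> powr q)"
          unfolding norm_mult using B(1) B(2)[OF sI] elim(1) by (intro mult_mono) auto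
      qed auto
      moreover have "?P 0 = u \<epsilon> (y, 0)" by (simp add: phase_0 \<gamma>_0[OF y])
      moreover have "u \<epsilon> (\<gamma> (t, y), t) - amplitude t y * u \<epsilon> (y, 0) = exp (- \<i> * phase (t, y)) * (?P t - u \<epsilon> (y, 0))"
        by (simp add: amplitude_def right_diff_distrib exp_minus)
      moreover have "norm (exp (- \<i> * phase (t, y))) \<le> B'" by (rule B'(2)) (use yK in auto)
      ultimately have "norm (u \<epsilon> (\<gamma> (t, y), t) - amplitude t y * u \<epsilon> (y, 0)) \<le> B' * ((B * (C * \<epsilon> powr q)) * \<bar>t\<bar>)"
        unfolding norm_mult using B'(1) by (simp only: norm_mult) (intro mult_mono; simp)
      then show "norm (u \<epsilon> (\<gamma> (t, y), t) - amplitude t y * u \<epsilon> (y, 0)) \<le> (B' * (B * C * \<bar>t\<bar>)) * \<epsilon> powr q"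
        by (simp only: mult_ac)
    qed
  qed
  then show "net_bound K (\<lambda>\<epsilon> y. u \<epsilon> (\<gamma> (t, y), t) - amplitude t y * u \<epsilon> (y, 0)) q"
    unfolding net_bound_def using B B' C(1) by (intro exI[of _ "B' * (B * C * \<bar>t\<bar>)"]) auto
qed

lemma open_space_time: "open (\<Omega> \<times> UNIV :: ((real^'n) \<times> real) set)"
  using \<Omega> by (simp add: open_Times)

lemma evolution_op_moderate:
  assumes u: "u \<in> moderate_nets (\<Omega> \<times> UNIV)"
  shows "(\<lambda>\<epsilon>. evolution_op a b (u \<epsilon>)) \<in> moderate_nets (\<Omega> \<times> UNIV)"
proof -
  \<comment> \<open>Coefficients are functions of \<open>(t, x)\<close>, members of nets are
    functions of \<open>(x, t)\<close>.\<close>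
  have sw: "Ck k (\<Omega> \<times> UNIV) (\<lambda>z. f (snd z, fst z))" if "\<And>k. Ck k (UNIV \<times> \<Omega>) f" for f :: "real \<times> (real^'n) \<Rightarrow> complex" and k
    by (rule Ck_compose[OF open_space_time open_dom _ that]) (auto intro!: Ck_intros open_space_time)
  have "(\<lambda>\<epsilon> z. partial_deriv (0, 1) (u \<epsilon>) z + \<i> * ((\<Sum>j\<in>UNIV. a j (snd z, fst z) * (- \<i> * partial_deriv (axis j 1, 0) (u \<epsilon>) z))
      + b (snd z, fst z) * u \<epsilon> z)) \<in> moderate_nets (\<Omega> \<times> UNIV)"
    by (intro moderate_nets_add moderate_nets_mult moderate_nets_sum moderate_nets_partial_deriv u open_space_time
        sw a b Ck_const) (auto simp: Basis_prod_def image_iff axis_in_Basis_iff)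
  moreover have "evolution_op a b (u \<epsilon>) = (\<lambda>z. partial_deriv (0, 1) (u \<epsilon>) z + \<i> * ((\<Sum>j\<in>UNIV. a j (snd z, fst z) * (- \<i> * partial_deriv (axis j 1, 0) (u \<epsilon>) z))
      + b (snd z, fst z) * u \<epsilon> z))" for \<epsilon>
    by (auto simp: fun_eq_iff evolution_op_def first_order_op_def D_x_def)
  ultimately show ?thesis by presburger
qed

text \<open>An inclusion is assumed because \<open>colombeau_map\<close> is a union over
  representatives: the equation directly shows each single class to be contained in that of
  0.\<close>

lemma transport_rel:
  assumes u: "u \<in> moderate_nets (\<Omega> \<times> UNIV)"
    and eq: "colombeau_class (\<Omega> \<times> UNIV) (\<lambda>\<epsilon>. evolution_op a b (u \<epsilon>)) \<subseteq> colombeau_class (\<Omega> \<times> UNIV) (\<lambda>\<epsilon> z. 0)"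
  shows "(\<lambda>\<epsilon> y. u \<epsilon> (\<gamma> (t, y), t), \<lambda>\<epsilon> y. amplitude t y * u \<epsilon> (y, 0)) \<in> colombeau_rel \<Omega>"
proof -
  let ?n = "\<lambda>\<epsilon>. evolution_op a b (u \<epsilon>)"
  have "?n \<in> colombeau_class (\<Omega> \<times> UNIV) ?n"
    unfolding colombeau_class_def using colombeau_rel_refl[OF open_space_time evolution_op_moderate[OF u]] by simp
  then have "(\<lambda>\<epsilon> z. 0, ?n) \<in> colombeau_rel (\<Omega> \<times> UNIV)" using eq by (auto simp: colombeau_class_def)
  then have "(?n, \<lambda>\<epsilon> z. 0) \<in> colombeau_rel (\<Omega> \<times> UNIV)" by (rule colombeau_rel_sym[OF open_space_time])
  then have n: "negligible0 (\<Omega> \<times> UNIV) ?n" unfolding colombeau_rel_iff[OF open_space_time] by simp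
  have "(\<lambda>\<epsilon> y. u \<epsilon> (\<gamma> (t, y), t)) \<in> moderate_nets \<Omega>"
    by (rule moderate_nets_compose[OF \<Omega> open_space_time _ _ u, of "\<lambda>y. (\<gamma> (t, y), t)"])
      (auto intro!: Ck_intros \<Omega> Ck_time_slice[OF \<gamma>_Ck] \<gamma>_in)
  moreover have "(\<lambda>\<epsilon> y. u \<epsilon> (y, 0)) \<in> moderate_nets \<Omega>"
    by (rule moderate_nets_compose[OF \<Omega> open_space_time _ _ u, of "\<lambda>y. (y, 0)"]) (auto intro!: Ck_intros \<Omega>)
  then have "(\<lambda>\<epsilon> y. amplitude t y * u \<epsilon> (y, 0)) \<in> moderate_nets \<Omega>"
    by (rule moderate_nets_mult[OF \<Omega> amplitude_Ck])
  ultimately show ?thesis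
    unfolding colombeau_rel_iff[OF \<Omega>] using transport_negligible[OF u n] by blast
qed

section \<open>Regularity and wave front sets under transport\<close>

context
  fixes U :: "((real^'n) \<times> real) net set" and G :: "(real^'n) net set"
  assumes U: "U \<in> colombeau (\<Omega> \<times> UNIV)" and G: "G \<in> colombeau \<Omega>"
    and evolution: "colombeau_map (\<Omega> \<times> UNIV) (evolution_op a b) U = colombeau_class (\<Omega> \<times> UNIV) (\<lambda>\<epsilon> z. 0)"
    and initial: "colombeau_at_time \<Omega> 0 U = G"
begin

lemma U_moderate: "u \<in> U \<Longrightarrow> u \<in> moderate_nets (\<Omega> \<times> UNIV)"
  by (rule colombeau_class_memberD(1)[OF open_space_time U])

lemma U_transport:
  assumes "u \<in> U"
  shows "(\<lambda>\<epsilon> y. u \<epsilon> (\<gamma> (t, y), t), \<lambda>\<epsilon> y. amplitude t y * u \<epsilon> (y, 0)) \<in> colombeau_rel \<Omega>"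
  by (rule transport_rel[OF U_moderate[OF assms]])
    (use assms in \<open>auto simp: evolution[symmetric] colombeau_map_def\<close>)

lemma slice_moderate:
  assumes "u \<in> U"
  shows "(\<lambda>\<epsilon> x. u \<epsilon> (x, t)) \<in> moderate_nets \<Omega>"
  by (rule moderate_nets_compose[OF \<Omega> open_space_time _ _ U_moderate[OF assms], of "\<lambda>x. (x, t)"])
    (auto intro!: Ck_intros \<Omega>)

lemma slice_0_in_G: "u \<in> U \<Longrightarrow> (\<lambda>\<epsilon> x. u \<epsilon> (x, 0)) \<in> G"
  unfolding initial[symmetric] colombeau_at_time_iff
  using colombeau_rel_refl[OF \<Omega> slice_moderate] by blast

text \<open>Solved for the value at \<open>(x, t)\<close>, the transport relation expresses
  \<open>u\<close> as \<open>amplitude t (\<kappa> x) * g (\<kappa> x)\<close>, where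
  \<open>\<kappa>\<close> inverts the flow map and has Jacobian \<open>X (t, y0)\<close> at
  \<open>\<gamma> (t, y0)\<close>.\<close>

lemma regular_forward:
  assumes onto: "(\<lambda>y. \<gamma> (t, y)) ` \<Omega> = \<Omega>" and y0: "y0 \<in> \<Omega>"
    and reg: "microlocally_regular \<Omega> G (y0, \<xi>0)"
  shows "microlocally_regular \<Omega> (colombeau_at_time \<Omega> t U) (\<gamma> (t, y0), \<xi>0 v* X (t, y0))"
proof -
  obtain \<kappa> where \<kappa>: "\<And>x. x \<in> \<Omega> \<Longrightarrow> \<kappa> x \<in> \<Omega>" "\<And>x. x \<in> \<Omega> \<Longrightarrow> \<gamma> (t, \<kappa> x) = x" "\<And>y. y \<in> \<Omega> \<Longrightarrow> \<kappa> (\<gamma> (t, y)) = y"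
    "\<And>k. Ck k \<Omega> \<kappa>" "\<And>x. x \<in> \<Omega> \<Longrightarrow> (\<kappa> has_derivative (\<lambda>h. X (t, \<kappa> x) *v h)) (at x)"
    using inverse_flow[OF onto] by blast
  have D: "frechet_derivative \<kappa> (at (\<gamma> (t, y0))) = (\<lambda>h. X (t, y0) *v h)"
    using frechet_derivative_at[OF \<kappa>(5)[OF \<gamma>_in[OF y0, of t]]] \<kappa>(3)[OF y0] by simp
  have CM: "Ck k \<Omega> (\<lambda>x. amplitude t (\<kappa> x))" for k
    by (rule Ck_compose[OF \<Omega> \<Omega> \<kappa>(1) amplitude_Ck \<kappa>(4)])
  have inj: "inj (\<lambda>\<eta>. \<eta> v* X (t, y0))"
  proof (rule injI)
    fix \<eta> \<eta>' assume "\<eta> v* X (t, y0) = \<eta>' v* X (t, y0)"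
    then have "\<eta> v* X (t, y0) v* J (t, y0) = \<eta>' v* X (t, y0) v* J (t, y0)" by simp
    then show "\<eta> = \<eta>'" by (simp add: vector_matrix_mul_assoc XJ[OF y0])
  qed
  have reg': "microlocally_regular \<Omega> G (\<kappa> (\<gamma> (t, y0)), \<xi>0)" using reg \<kappa>(3)[OF y0] by simp
  have W: "(\<lambda>\<epsilon> x. amplitude t (\<kappa> x) * g \<epsilon> (\<kappa> x)) \<in> colombeau_at_time \<Omega> t U" if g: "g \<in> G" for g
  proof -
    obtain u where u: "u \<in> U" using colombeau_nonempty[OF open_space_time U] by blast
    have 1: "(\<lambda>\<epsilon> x. u \<epsilon> (x, 0), g) \<in> colombeau_rel \<Omega>"
      using colombeau_class_memberD(2)[OF \<Omega> G slice_0_in_G[OF u]] g by blast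
    have 2: "(\<lambda>\<epsilon> x. amplitude t (\<kappa> x) * u \<epsilon> (\<kappa> x, 0), \<lambda>\<epsilon> x. amplitude t (\<kappa> x) * g \<epsilon> (\<kappa> x)) \<in> colombeau_rel \<Omega>"
      by (rule colombeau_rel_mult[OF \<Omega> CM colombeau_rel_compose[OF \<Omega> \<Omega> \<kappa>(1) \<kappa>(4) 1]])
    have 3: "(\<lambda>\<epsilon> x. u \<epsilon> (\<gamma> (t, \<kappa> x), t), \<lambda>\<epsilon> x. amplitude t (\<kappa> x) * u \<epsilon> (\<kappa> x, 0)) \<in> colombeau_rel \<Omega>"
      by (rule colombeau_rel_compose[OF \<Omega> \<Omega> \<kappa>(1) \<kappa>(4) U_transport[OF u]])
    have "(\<lambda>\<epsilon> x. u \<epsilon> (\<gamma> (t, \<kappa> x), t)) \<in> moderate_nets \<Omega>"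
      using 3 unfolding colombeau_rel_iff[OF \<Omega>] by blast
    then have 4: "(\<lambda>\<epsilon> x. u \<epsilon> (x, t), \<lambda>\<epsilon> x. u \<epsilon> (\<gamma> (t, \<kappa> x), t)) \<in> colombeau_rel \<Omega>"
      by (rule colombeau_rel_eqI[OF \<Omega> slice_moderate[OF u]]) (simp add: \<kappa>(2))
    show ?thesis
      unfolding colombeau_at_time_iff
      by (rule bexI[of _ u, OF _ u]) (rule colombeau_rel_trans[OF \<Omega> 4 colombeau_rel_trans[OF \<Omega> 3 2]])
  qed
  show ?thesis
  proof (rule microlocally_regular_pullback[OF \<Omega> \<gamma>_in[OF y0] \<kappa>(4,1) _ inj _ CM _ reg' W])
    show "linear (\<lambda>\<eta>. \<eta> v* X (t, y0))"
      by (rule bounded_linear.linear[OF bounded_bilinear.bounded_linear_left[OF bounded_bilinear_vector_matrix_mult]])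
    show "frechet_derivative \<kappa> (at (\<gamma> (t, y0))) h \<bullet> \<eta> = h \<bullet> (\<eta> v* X (t, y0))" for h \<eta>
      unfolding D by (metis dot_lmul_matrix inner_commute)
    show "g \<in> moderate_nets \<Omega>" if "g \<in> G" for g by (rule colombeau_class_memberD(1)[OF \<Omega> G that])
  qed
qed

text \<open>Here the transport relation is solved for \<open>g\<close>: it is the pullback of the
  slice at time \<open>t\<close> along the flow map, with the reciprocal amplitude as
  factor.\<close>

lemma regular_backward:
  assumes y0: "y0 \<in> \<Omega>" and reg: "microlocally_regular \<Omega> (colombeau_at_time \<Omega> t U) (\<gamma> (t, y0), \<xi>)"
  shows "microlocally_regular \<Omega> G (y0, \<xi> v* J (t, y0))"
proof -
  have D: "frechet_derivative (\<lambda>y. \<gamma> (t, y)) (at y0) = (\<lambda>h. J (t, y0) *v h)"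
    using frechet_derivative_at[OF \<gamma>_space_deriv[OF y0]] by simp
  have CM: "Ck k \<Omega> (\<lambda>y. inverse (amplitude t y))" for k
    by (intro Ck_inverse \<Omega> amplitude_Ck amplitude_nonzero)
  have inj: "inj (\<lambda>\<eta>. \<eta> v* J (t, y0))"
  proof (rule injI)
    fix \<eta> \<eta>' assume "\<eta> v* J (t, y0) = \<eta>' v* J (t, y0)"
    then have "\<eta> v* J (t, y0) v* X (t, y0) = \<eta>' v* J (t, y0) v* X (t, y0)" by simp
    then show "\<eta> = \<eta>'" by (simp add: vector_matrix_mul_assoc XJ[OF y0])
  qed
  have C\<gamma>: "Ck k \<Omega> (\<lambda>y. \<gamma> (t, y))" for k by (rule Ck_time_slice[OF \<gamma>_Ck])
  have W: "(\<lambda>\<epsilon> y. inverse (amplitude t y) * w \<epsilon> (\<gamma> (t, y))) \<in> G" if w: "w \<in> colombeau_at_time \<Omega> t U" for w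
  proof -
    obtain u where u: "u \<in> U" and uw: "(\<lambda>\<epsilon> x. u \<epsilon> (x, t), w) \<in> colombeau_rel \<Omega>"
      using w unfolding colombeau_at_time_iff by blast
    have 1: "(\<lambda>\<epsilon> y. inverse (amplitude t y) * u \<epsilon> (\<gamma> (t, y), t), \<lambda>\<epsilon> y. inverse (amplitude t y) * w \<epsilon> (\<gamma> (t, y))) \<in> colombeau_rel \<Omega>"
      by (rule colombeau_rel_mult[OF \<Omega> CM colombeau_rel_compose[OF \<Omega> \<Omega> \<gamma>_in C\<gamma> uw]])
    have "(\<lambda>\<epsilon> y. inverse (amplitude t y) * u \<epsilon> (\<gamma> (t, y), t), \<lambda>\<epsilon> y. inverse (amplitude t y) * (amplitude t y * u \<epsilon> (y, 0))) \<in> colombeau_rel \<Omega>"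
      by (rule colombeau_rel_mult[OF \<Omega> CM U_transport[OF u]])
    moreover have "inverse (amplitude t y) * (amplitude t y * c) = c" for y c
      using amplitude_nonzero[of t y] by simp
    ultimately have "(\<lambda>\<epsilon> y. inverse (amplitude t y) * u \<epsilon> (\<gamma> (t, y), t), \<lambda>\<epsilon> y. u \<epsilon> (y, 0)) \<in> colombeau_rel \<Omega>" by simp
    from colombeau_rel_trans[OF \<Omega> colombeau_rel_sym[OF \<Omega> this] 1] show ?thesis
      using colombeau_class_memberD(2)[OF \<Omega> G slice_0_in_G[OF u]] by blast
  qed
  show ?thesis
  proof (rule microlocally_regular_pullback[OF \<Omega> y0 C\<gamma> \<gamma>_in _ inj _ CM _ reg W])
    show "linear (\<lambda>\<eta>. \<eta> v* J (t, y0))"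
      by (rule bounded_linear.linear[OF bounded_bilinear.bounded_linear_left[OF bounded_bilinear_vector_matrix_mult]])
    show "frechet_derivative (\<lambda>y. \<gamma> (t, y)) (at y0) h \<bullet> \<eta> = h \<bullet> (\<eta> v* J (t, y0))" for h \<eta>
      unfolding D by (metis dot_lmul_matrix inner_commute)
    show "w \<in> moderate_nets \<Omega>" if "w \<in> colombeau_at_time \<Omega> t U" for w
      using that unfolding colombeau_at_time_iff colombeau_rel_iff[OF \<Omega>] by blast
  qed
qed

text \<open>These are the contrapositives of the two preceding lemmas. On covectors \<open>J\<close>
  undoes \<open>X\<close>, so nonzero ones correspond to nonzero ones.\<close>

lemma WF_g_transport:
  assumes onto: "(\<lambda>y. \<gamma> (t, y)) ` \<Omega> = \<Omega>"
  shows "WF_g \<Omega> (colombeau_at_time \<Omega> t U) = (\<lambda>(y, \<xi>). (\<gamma> (t, y), \<xi> v* X (t, y))) ` WF_g \<Omega> G"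
proof (intro set_eqI iffI)
  fix w assume "w \<in> WF_g \<Omega> (colombeau_at_time \<Omega> t U)"
  then obtain x \<xi> where w: "w = (x, \<xi>)" "x \<in> \<Omega>" "\<xi> \<noteq> 0" "\<not> microlocally_regular \<Omega> (colombeau_at_time \<Omega> t U) (x, \<xi>)"
    by (auto simp: WF_g_def)
  obtain y where y: "y \<in> \<Omega>" "x = \<gamma> (t, y)" using w(2) onto by auto
  have \<xi>: "\<xi> = \<xi> v* J (t, y) v* X (t, y)" by (simp add: vector_matrix_mul_assoc XJ[OF y(1)])
  have "\<xi> v* J (t, y) \<noteq> 0" using \<xi> w(3) by auto
  moreover have "\<not> microlocally_regular \<Omega> G (y, \<xi> v* J (t, y))"
    using regular_forward[OF onto y(1), of "\<xi> v* J (t, y)"] w(4) y(2) \<xi> by auto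
  ultimately have "(y, \<xi> v* J (t, y)) \<in> WF_g \<Omega> G" using y(1) by (simp add: WF_g_def)
  then show "w \<in> (\<lambda>(y, \<xi>). (\<gamma> (t, y), \<xi> v* X (t, y))) ` WF_g \<Omega> G"
    by (rule rev_image_eqI) (use w(1) y(2) \<xi> in simp)
next
  fix w assume "w \<in> (\<lambda>(y, \<xi>). (\<gamma> (t, y), \<xi> v* X (t, y))) ` WF_g \<Omega> G"
  then obtain y \<xi> where w: "w = (\<gamma> (t, y), \<xi> v* X (t, y))" and y: "y \<in> \<Omega>" "\<xi> \<noteq> 0" "\<not> microlocally_regular \<Omega> G (y, \<xi>)"
    by (auto simp: WF_g_def)
  have \<xi>: "\<xi> v* X (t, y) v* J (t, y) = \<xi>" by (simp add: vector_matrix_mul_assoc XJ[OF y(1)])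
  then have "\<xi> v* X (t, y) \<noteq> 0" using y(2) by auto
  moreover have "\<not> microlocally_regular \<Omega> (colombeau_at_time \<Omega> t U) w"
    using regular_backward[OF y(1), of t "\<xi> v* X (t, y)"] \<xi> y(3) w by auto
  ultimately show "w \<in> WF_g \<Omega> (colombeau_at_time \<Omega> t U)"
    using \<gamma>_in[OF y(1)] by (simp add: WF_g_def w)
qed

end

end

section \<open>From the Hamilton flow to the characteristics\<close>

lemma gradient_eq:
  assumes "(f has_derivative f') (at x)"
  shows "gradient f x = (\<chi> j. f' (axis j 1))"
  by (simp add: gradient_def partial_deriv_eq[OF assms])

lemma has_vector_derivative_vec_lambda:
  fixes f :: "'i::finite \<Rightarrow> real \<Rightarrow> 'b::real_normed_vector"
  assumes "\<And>i. (f i has_vector_derivative f' i) (at t)"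
  shows "((\<lambda>t. \<chi> i. f i t) has_vector_derivative (\<chi> i. f' i)) (at t)"
  unfolding sum_axis_eq[symmetric]
  by (intro has_vector_derivative_sum bounded_linear.has_vector_derivative[OF bounded_linear_axis] assms)

theorem proposition3p3:
  fixes \<Omega> :: "(real^'n::finite) set"
    and a :: "'n \<Rightarrow> real \<times> (real^'n) \<Rightarrow> complex"
    and b :: "real \<times> (real^'n) \<Rightarrow> complex"
    and U :: "((real^'n) \<times> real) net set"
    and G :: "(real^'n) net set"
    and \<Phi> :: "real \<Rightarrow> (real^'n) \<times> (real^'n) \<Rightarrow> (real^'n) \<times> (real^'n)"
  assumes "open \<Omega>"
    and "\<And>j. smooth_on (UNIV \<times> \<Omega>) (a j)" and "smooth_on (UNIV \<times> \<Omega>) b"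
    and "\<And>j. constant_outside_compact \<Omega> (a j)" and "constant_outside_compact \<Omega> b"
    and "\<And>t x \<xi>. x \<in> \<Omega> \<Longrightarrow> principal_symbol a t x \<xi> \<in> \<real>"
    and "U \<in> colombeau (\<Omega> \<times> UNIV)" and "G \<in> colombeau \<Omega>"
    and "colombeau_map (\<Omega> \<times> UNIV) (evolution_op a b) U
           = colombeau_class (\<Omega> \<times> UNIV) (\<lambda>\<epsilon> z. 0)"
    and "colombeau_at_time \<Omega> 0 U = G"
    and "hamilton_flow \<Omega> (\<lambda>t x \<xi>. Re (principal_symbol a t x \<xi>)) \<Phi>"
  shows "\<forall>t. WF_g \<Omega> (colombeau_at_time \<Omega> t U) = \<Phi> t ` WF_g \<Omega> G"
proof
  fix t
  define \<alpha> :: "real \<times> (real^'n) \<Rightarrow> real^'n" where "\<alpha> p = (\<chi> j. Re (a j p))" for p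
  have o: "open (UNIV \<times> \<Omega> :: (real \<times> (real^'n)) set)" using assms(1) by (simp add: open_Times)
  have Ca: "Ck k (UNIV \<times> \<Omega>) (a j)" for j k using assms(2) by (simp add: smooth_on_iff_Ck)
  have C\<alpha>: "Ck k (UNIV \<times> \<Omega>) \<alpha>" for k unfolding \<alpha>_def[abs_def] by (intro Ck_intros o Ca)
  have a_real: "a j (t, x) = of_real (\<alpha> (t, x) $ j)" if "x \<in> \<Omega>" for j t x
  proof -
    \<comment> \<open>Evaluating the symbol at unit covectors shows that each single coefficient is
      real.\<close>
    have "principal_symbol a t x (axis j 1) = a j (t, x)"
      by (simp add: principal_symbol_def axis_def if_distrib[of complex_of_real] if_distrib[of "\<lambda>c. _ * c"] cong: if_cong)
    with assms(6)[OF that, of t "axis j 1"] have "a j (t, x) \<in> \<real>" by simp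
    then show ?thesis by (simp add: \<alpha>_def of_real_Re)
  qed
  have symbol: "Re (principal_symbol a t x \<xi>) = \<alpha> (t, x) \<bullet> \<xi>" for t x \<xi>
    by (simp add: principal_symbol_def \<alpha>_def inner_vec_def)
  have grad_\<xi>: "gradient (\<lambda>\<eta>. \<alpha> (t, x) \<bullet> \<eta>) \<xi> = \<alpha> (t, x)" for t x \<xi>
  proof -
    have "((\<lambda>\<eta>. \<alpha> (t, x) \<bullet> \<eta>) has_derivative (\<lambda>h. \<alpha> (t, x) \<bullet> h)) (at \<xi>)" by (auto intro!: derivative_eq_intros)
    from gradient_eq[OF this] show ?thesis by (simp add: vec_eq_iff inner_axis)
  qed
  have grad_x: "gradient (\<lambda>y. \<alpha> (t, y) \<bullet> \<xi>) x = \<xi> v* spatial_jacobian \<alpha> (t, x)" if x: "x \<in> \<Omega>" for t x \<xi>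
  proof -
    have "((\<lambda>y. \<alpha> (t, y) \<bullet> \<xi>) has_derivative (\<lambda>h. (spatial_jacobian \<alpha> (t, x) *v h) \<bullet> \<xi>)) (at x)"
      unfolding spatial_jacobian_mult
      by (rule bounded_linear.has_derivative[OF bounded_linear_inner_left Ck_has_derivative_space[OF C\<alpha> x]])
    from gradient_eq[OF this] show ?thesis
      by (simp add: vec_eq_iff dot_lmul_matrix[symmetric] inner_commute[of _ \<xi>] inner_axis)
  qed
  have onto: "\<Phi> t ` (\<Omega> \<times> UNIV) = \<Omega> \<times> UNIV" for t
    using assms(11) by (auto simp: hamilton_flow_def)
  have \<Phi>0: "\<Phi> 0 z = z" if "z \<in> \<Omega> \<times> UNIV" for z
    using that assms(11) by (auto simp: hamilton_flow_def)
  have in_\<Omega>: "fst (\<Phi> t z) \<in> \<Omega>" if "z \<in> \<Omega> \<times> UNIV" for t z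
    using onto[of t] imageI[OF that, of "\<Phi> t"] by (auto simp: mem_Times_iff)
  have D1: "((\<lambda>s. fst (\<Phi> s z)) has_vector_derivative \<alpha> (t, fst (\<Phi> t z))) (at t)"
    and D2: "((\<lambda>s. snd (\<Phi> s z)) has_vector_derivative - (snd (\<Phi> t z) v* spatial_jacobian \<alpha> (t, fst (\<Phi> t z)))) (at t)"
    if z: "z \<in> \<Omega> \<times> UNIV" for t z
  proof -
    have "((\<lambda>s. fst (\<Phi> s z)) has_vector_derivative gradient (\<lambda>\<eta>. \<alpha> (t, fst (\<Phi> t z)) \<bullet> \<eta>) (snd (\<Phi> t z))) (at t)"
      "((\<lambda>s. snd (\<Phi> s z)) has_vector_derivative - gradient (\<lambda>y. \<alpha> (t, y) \<bullet> snd (\<Phi> t z)) (fst (\<Phi> t z))) (at t)"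
      using assms(11) z unfolding hamilton_flow_def symbol by blast+
    then show "((\<lambda>s. fst (\<Phi> s z)) has_vector_derivative \<alpha> (t, fst (\<Phi> t z))) (at t)"
      "((\<lambda>s. snd (\<Phi> s z)) has_vector_derivative - (snd (\<Phi> t z) v* spatial_jacobian \<alpha> (t, fst (\<Phi> t z)))) (at t)"
      by (simp_all only: grad_\<xi> grad_x[OF in_\<Omega>[OF z]])
  qed
  \<comment> \<open>The symbol is linear in the covector, so the base point moves independently of
    it. The covector 0 is an arbitrary choice, justified by \<open>fst_\<Phi>\<close>.\<close>
  define \<gamma> where "\<gamma> p = fst (\<Phi> (fst p) (snd p, 0))" for p
  \<comment> \<open>The covector equation is linear, so the rows of its fundamental matrix are the images of the unit covectors.\<close>
  define X :: "real \<times> (real^'n) \<Rightarrow> real^'n^'n" where "X p = (\<chi> k. snd (\<Phi> (fst p) (snd p, axis k 1)))" for p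
  interpret vector_field \<Omega> \<alpha> by standard (use assms(1) C\<alpha> in auto)
  have fst_\<Phi>: "fst (\<Phi> t (y, \<xi>)) = \<gamma> (t, y)" if y: "y \<in> \<Omega>" for t y \<xi>
    unfolding \<gamma>_def fst_conv snd_conv
    by (rule solutions_unique[OF D1 D1 in_\<Omega>]) (use y \<Phi>0 in auto)
  interpret characteristic_flow \<Omega> \<alpha> \<gamma> X
  proof
    fix y assume y: "y \<in> \<Omega>"
    then have z: "(y, \<xi>) \<in> \<Omega> \<times> UNIV" for \<xi> :: "real^'n" by simp
    show "\<gamma> (t, y) \<in> \<Omega>" for t using in_\<Omega>[OF z] by (simp add: \<gamma>_def)
    show "\<gamma> (0, y) = y" using \<Phi>0[OF z] by (simp add: \<gamma>_def)
    show "((\<lambda>t. \<gamma> (t, y)) has_vector_derivative \<alpha> (t, \<gamma> (t, y))) (at t)" for t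
      using D1[OF z] by (simp add: \<gamma>_def)
    show "X (0, y) = mat 1" using \<Phi>0[OF z] by (simp add: X_def vec_eq_iff mat_def axis_def)
    show "((\<lambda>t. X (t, y)) has_vector_derivative - (X (t, y) ** spatial_jacobian \<alpha> (t, \<gamma> (t, y)))) (at t)" for t
    proof -
      have "((\<lambda>t. \<chi> k. snd (\<Phi> t (y, axis k 1))) has_vector_derivative
        (\<chi> k. - (snd (\<Phi> t (y, axis k 1)) v* spatial_jacobian \<alpha> (t, fst (\<Phi> t (y, axis k 1)))))) (at t)"
        by (rule has_vector_derivative_vec_lambda[OF D2[OF z]])
      moreover have "(\<chi> k. - (snd (\<Phi> t (y, axis k 1)) v* spatial_jacobian \<alpha> (t, fst (\<Phi> t (y, axis k 1)))))
        = - (X (t, y) ** spatial_jacobian \<alpha> (t, \<gamma> (t, y)))"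
        by (simp add: fst_\<Phi>[OF y] X_def vec_eq_iff matrix_matrix_mult_def vector_matrix_mult_def mult.commute)
      ultimately show ?thesis by (simp add: X_def)
    qed
  qed
  interpret transport_equation \<Omega> \<alpha> \<gamma> X a b
    by standard (use a_real Ca assms(3) in \<open>auto simp: smooth_on_iff_Ck\<close>)
  have \<Phi>: "\<Phi> t (y, \<xi>) = (\<gamma> (t, y), \<xi> v* X (t, y))" if y: "y \<in> \<Omega>" for t y \<xi>
  proof -
    have z: "(y, \<xi>) \<in> \<Omega> \<times> UNIV" using y by simp
    have "snd (\<Phi> t (y, \<xi>)) = snd (\<Phi> 0 (y, \<xi>)) v* X (t, y)"
      by (rule covector_unique[OF y]) (use D2[OF z] fst_\<Phi>[OF y] in simp)
    then show ?thesis using \<Phi>0[OF z] fst_\<Phi>[OF y] by (simp add: prod_eq_iff)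
  qed
  \<comment> \<open>That \<open>\<Phi> t\<close> is onto is part of \<open>hamilton_flow\<close>;
    projecting to the base shows that no point of \<open>\<Omega>\<close> is missed by the
    characteristics.\<close>
  have "(\<lambda>y. \<gamma> (t, y)) ` \<Omega> = \<Omega>"
  proof (intro equalityI subsetI)
    fix x assume "x \<in> \<Omega>"
    then have "(x, 0) \<in> \<Phi> t ` (\<Omega> \<times> UNIV)" unfolding onto by simp
    then obtain y \<xi> where "y \<in> \<Omega>" "\<Phi> t (y, \<xi>) = (x, 0)" by auto
    then show "x \<in> (\<lambda>y. \<gamma> (t, y)) ` \<Omega>" using \<Phi> by auto
  qed (auto intro: \<gamma>_in)
  from WF_g_transport[OF assms(7-10) this]
  have "WF_g \<Omega> (colombeau_at_time \<Omega> t U) = (\<lambda>(y, \<xi>). (\<gamma> (t, y), \<xi> v* X (t, y))) ` WF_g \<Omega> G" .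
  also have "\<dots> = \<Phi> t ` WF_g \<Omega> G"
    by (rule image_cong) (auto simp: WF_g_def \<Phi>)
  finally show "WF_g \<Omega> (colombeau_at_time \<Omega> t U) = \<Phi> t ` WF_g \<Omega> G" .
qed

end
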